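(* There exists a sequence $\theta_\varepsilon\uparrow b$ with the following properties. Assume that $\alpha_\varepsilon,\beta_\varepsilon\in[\alpha_-,b]$ for all $\varepsilon>0$ and that $d_W(\alpha_\varepsilon,\alpha),\ d_W(\beta_\varepsilon,b)\in o(\varepsilon)$ as $\varepsilon\to0$. We have that $d_W(\theta_\varepsilon,b)\in o(\varepsilon)$, and if $v_\varepsilon\in\operatorname{argmin}G^{(0)}_\varepsilon$, then there exists a unique smallest $S_\varepsilon\ge0$ such that $v_\varepsilon(S_\varepsilon)=\theta_\varepsilon$ and such that $v_\varepsilon$ is increasing on $[0,S_\varepsilon]$. Moreover $$\lim_{\varepsilon\to0}\frac{S_\varepsilon}{\varepsilon}=T^{(\alpha)}.$$ If we quantify the estimates, then for $\varepsilon>0$ sufficiently small there exists $M>0$ such that $$\frac{S_\varepsilon}{\varepsilon}\le M,$$ where $M$ only depends on $W$ and the convergence rate of $\beta_\varepsilon$ to $b$, and there exists a constant $C>0$ such that $\theta_\varepsilon$ satisfies the bound $$\theta_\varepsilon\ge b-C\max\{b-\beta_\varepsilon,\ \varepsilon^{1/(1+q)}\}.$$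
   Context: Potential. $W:\mathbb{R}\to[0,\infty)$ is continuous, $W^{-1}(\{0\})=\{a,b\}$ with $a<b$, $W\in C^2(\mathbb{R}\setminus\{a,b\})$, and there is $q\in(0,1)$ with $\lim_{s\to a}W''(s)|s-a|^{1-q}\in(0,\infty)$ and $\lim_{s\to b}W''(s)|s-b|^{1-q}\in(0,\infty)$; moreover $W(x)\sim|x-a|^{1+q}$ for $x$ near $a$ and $W(x)\sim|x-b|^{1+q}$ for $x$ near $b$ (bounded above and below by positive constant multiples). Set $d_W(r,s)=\left|\int_r^s2\sqrt{W(\rho)}\,d\rho\right|$ and $T^{(\alpha)}=\int_\alpha^b W(s)^{-1/2}\,ds$ for $\alpha\in[a,b]$. One-dimensional setting. $I=(0,T)$ with $0<T\le1$; $\omega\in C^1([0,T])$ is a positive weight with $\omega(0)=1$; $\omega_0=\min_{[0,T]}\omega$, $\omega_1=\max_{[0,T]}\omega$. The interval length $T$ is very short, so that $\omega$ is almost constant: $\omega_1-\omega_0$ is assumed to be (sufficiently) small. Fixed constants $\alpha_-\in(a,b)$ and $\kappa_0<0$ are given. For $\varepsilon>0$ the boundary values satisfy $\alpha_\varepsilon\in[a,b]$, $\beta_\varepsilon\in[\alpha_-,b]$, and [$\alpha_\varepsilon\in[\alpha_-,b]$ or $\omega'(0)\ge-\kappa_0$], with $\alpha_\varepsilon\to\alpha\in[a,b]$ and $\beta_\varepsilon\to b$ as $\varepsilon\to0$. If $\omega'(0)\ge-\kappa_0$, then $T$ is so small that $\omega'(t)\ge-\kappa_0/2$ on $[0,T]$.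 Functional on $L^1(I)$: $G^{(0)}_\varepsilon(v)=\int_0^T\big(W(v)+\varepsilon^2(v')^2\big)\omega\,dt$ if $v\in H^1(I)$, $v(0)=\alpha_\varepsilon$, $v(T)=\beta_\varepsilon$, and $+\infty$ otherwise. Conventions: constants $C$ depend only on $W$, $\alpha_-$, $\|\omega\|_{C^1([0,T])}$ and $\kappa_0$. "For $\varepsilon>0$ sufficiently small" means for all $0<\varepsilon<\varepsilon_0$, where $\varepsilon_0>0$ may depend on $W$, $\alpha_-$, $\|\omega\|_{C^1([0,T])}$, $\kappa_0$ and the convergence speed of $\beta_\varepsilon\to b$. *)

theory Defs
  imports "HOL-Analysis.Analysis" "HOL-Library.Landau_Symbols"
begin

locale double_well =
  fixes W :: "real \<Rightarrow> real" and a b q :: real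
  assumes a_less_b: "a < b"
    and q_range: "0 < q" "q < 1"
    and W_cont: "continuous_on UNIV W"
    and W_nonneg: "\<And>s. 0 \<le> W s"
    and W_zeros: "W -` {0} = {a, b}"
    and W_C2: "\<And>s. s \<notin> {a, b} \<Longrightarrow> W differentiable (at s)"
      "\<And>s. s \<notin> {a, b} \<Longrightarrow> deriv W differentiable (at s)"
      "continuous_on (- {a, b}) (deriv (deriv W))"
    and W_deriv2_lim: "\<And>p. p \<in> {a, b} \<Longrightarrow>
      \<exists>l>0. ((\<lambda>s. deriv (deriv W) s * \<bar>s - p\<bar> powr (1 - q)) \<longlongrightarrow> l) (at p)"
    and W_growth: "\<And>p. p \<in> {a, b} \<Longrightarrow>
      \<exists>c>0. \<exists>c'>0. \<forall>\<^sub>F x in at p.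
        c * \<bar>x - p\<bar> powr (1 + q) \<le> W x \<and> W x \<le> c' * \<bar>x - p\<bar> powr (1 + q)"

definition d_W :: "(real \<Rightarrow> real) \<Rightarrow> real \<Rightarrow> real \<Rightarrow> real" where
  "d_W W r s = \<bar>LBINT \<rho>=ereal r..ereal s. 2 * sqrt (W \<rho>)\<bar>"

definition transition_length :: "(real \<Rightarrow> real) \<Rightarrow> real \<Rightarrow> real \<Rightarrow> real" where
  "transition_length W b \<alpha> = (LBINT s=ereal \<alpha>..ereal b. W s powr (- 1 / 2))"

definition L2_fun :: "real set \<Rightarrow> (real \<Rightarrow> real) \<Rightarrow> bool" where
  "L2_fun I v \<longleftrightarrow> v \<in> borel_measurable (lebesgue_on I) \<and>
     integrable (lebesgue_on I) (\<lambda>t. (v t)\<^sup>2)"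

text \<open>Weak derivative on an open bounded interval \<open>I\<close>, tested against \<open>C\<^sup>1\<close> functions with
  compact support in \<open>I\<close> (the closed support is bounded, hence compact, when it lies in \<open>I\<close>).\<close>

definition is_weak_deriv :: "real set \<Rightarrow> (real \<Rightarrow> real) \<Rightarrow> (real \<Rightarrow> real) \<Rightarrow> bool" where
  "is_weak_deriv I v g \<longleftrightarrow>
     (\<forall>\<phi> \<phi>'. (\<forall>t. (\<phi> has_real_derivative \<phi>' t) (at t)) \<longrightarrow> continuous_on UNIV \<phi>' \<longrightarrow>
        closure {t. \<phi> t \<noteq> 0} \<subseteq> I \<longrightarrow>
        (\<integral>t. v t * \<phi>' t \<partial>lebesgue_on I) = - (\<integral>t. g t * \<phi> t \<partial>lebesgue_on I))"

definition H1_fun :: "real set \<Rightarrow> (real \<Rightarrow> real) \<Rightarrow> bool" where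
  "H1_fun I v \<longleftrightarrow> L2_fun I v \<and> (\<exists>g. L2_fun I g \<and> is_weak_deriv I v g)"

text \<open>Unique up to null sets when \<open>H1_fun I v\<close>.\<close>

definition weak_deriv :: "real set \<Rightarrow> (real \<Rightarrow> real) \<Rightarrow> real \<Rightarrow> real" where
  "weak_deriv I v = (SOME g. L2_fun I g \<and> is_weak_deriv I v g)"

text \<open>Boundary values of an \<open>H\<^sup>1\<close> function are those of its continuous representative.\<close>

definition boundary_values :: "real \<Rightarrow> (real \<Rightarrow> real) \<Rightarrow> real \<Rightarrow> real \<Rightarrow> bool" where
  "boundary_values T v \<alpha> \<beta> \<longleftrightarrow>
     (\<exists>w. continuous_on {0..T} w \<and> (AE t in lebesgue_on {0<..<T}. v t = w t) \<and>
          w 0 = \<alpha> \<and> w T = \<beta>)"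

definition G_fun :: "(real \<Rightarrow> real) \<Rightarrow> real \<Rightarrow> (real \<Rightarrow> real) \<Rightarrow> real \<Rightarrow> real \<Rightarrow> real \<Rightarrow>
    (real \<Rightarrow> real) \<Rightarrow> ennreal" where
  "G_fun W T \<omega> \<alpha> \<beta> \<epsilon> v =
     (if H1_fun {0<..<T} v \<and> boundary_values T v \<alpha> \<beta>
      then \<integral>\<^sup>+t. ennreal ((W (v t) + \<epsilon>\<^sup>2 * (weak_deriv {0<..<T} v t)\<^sup>2) * \<omega> t)
             \<partial>lebesgue_on {0<..<T}
      else \<infinity>)"

text \<open>\<open>v\<close> is the continuous representative of a minimizer of \<open>G\<close> over \<open>L\<^sup>1(0,T)\<close>, so that its
  pointwise values are meaningful.\<close>

definition G_minimizer :: "(real \<Rightarrow> real) \<Rightarrow> real \<Rightarrow> (real \<Rightarrow> real) \<Rightarrow> real \<Rightarrow> real \<Rightarrow> real \<Rightarrow>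
    (real \<Rightarrow> real) \<Rightarrow> bool" where
  "G_minimizer W T \<omega> \<alpha> \<beta> \<epsilon> v \<longleftrightarrow>
     is_arg_min (G_fun W T \<omega> \<alpha> \<beta> \<epsilon>) (\<lambda>u. integrable (lebesgue_on {0<..<T}) u) v \<and>
     continuous_on {0..T} v"

text \<open>\<open>S\<close> is the smallest time at which \<open>v\<close> takes the value \<open>\<theta>\<close>, and \<open>v\<close> is (strictly)
  increasing up to \<open>S\<close>.\<close>

definition increasing_hit :: "real \<Rightarrow> (real \<Rightarrow> real) \<Rightarrow> real \<Rightarrow> real \<Rightarrow> bool" where
  "increasing_hit T v \<theta> S \<longleftrightarrow>
     0 \<le> S \<and> S \<le> T \<and> v S = \<theta> \<and> strict_mono_on {0..S} v \<and>
     (\<forall>s\<in>{0..T}. v s = \<theta> \<longrightarrow> S \<le> s)"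

definition C1_norm :: "real \<Rightarrow> (real \<Rightarrow> real) \<Rightarrow> (real \<Rightarrow> real) \<Rightarrow> real" where
  "C1_norm T \<omega> \<omega>' = (SUP t\<in>{0..T}. \<bar>\<omega> t\<bar>) + (SUP t\<in>{0..T}. \<bar>\<omega>' t\<bar>)"

text \<open>The parameter \<open>\<omega>'\<close> is the derivative of \<open>\<omega>\<close> (one-sided at the endpoints); \<open>\<alpha>\<close> and \<open>\<beta>\<close> are
  the families of boundary values indexed by \<open>\<epsilon> > 0\<close>, and \<open>\<alpha>\<^sub>0\<close> is the limit of \<open>\<alpha>\<close>.\<close>

locale layer_setting = double_well W a b q
  for W :: "real \<Rightarrow> real" and a b q :: real +
  fixes \<alpha>m \<kappa>\<^sub>0 T :: real and \<omega> \<omega>' \<alpha> \<beta> :: "real \<Rightarrow> real" and \<alpha>\<^sub>0 :: real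
  assumes \<alpha>m_range: "a < \<alpha>m" "\<alpha>m < b"
    and \<kappa>\<^sub>0_neg: "\<kappa>\<^sub>0 < 0"
    and T_range: "0 < T" "T \<le> 1"
    and \<omega>_deriv: "\<And>t. t \<in> {0..T} \<Longrightarrow> (\<omega> has_real_derivative \<omega>' t) (at t within {0..T})"
    and \<omega>'_cont: "continuous_on {0..T} \<omega>'"
    and \<omega>_pos: "\<And>t. t \<in> {0..T} \<Longrightarrow> 0 < \<omega> t"
    and \<omega>_0: "\<omega> 0 = 1"
    and \<omega>'_lower: "- \<kappa>\<^sub>0 \<le> \<omega>' 0 \<Longrightarrow> \<forall>t\<in>{0..T}. - \<kappa>\<^sub>0 / 2 \<le> \<omega>' t"
    and \<alpha>_range: "\<And>\<epsilon>. 0 < \<epsilon> \<Longrightarrow> \<alpha> \<epsilon> \<in> {a..b}"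
    and \<beta>_range: "\<And>\<epsilon>. 0 < \<epsilon> \<Longrightarrow> \<beta> \<epsilon> \<in> {\<alpha>m..b}"
    and \<alpha>_or_slope: "\<And>\<epsilon>. 0 < \<epsilon> \<Longrightarrow> \<alpha> \<epsilon> \<in> {\<alpha>m..b} \<or> - \<kappa>\<^sub>0 \<le> \<omega>' 0"
    and \<alpha>\<^sub>0_range: "\<alpha>\<^sub>0 \<in> {a..b}"
    and \<alpha>_lim: "(\<alpha> \<longlongrightarrow> \<alpha>\<^sub>0) (at_right 0)"
    and \<beta>_lim: "(\<beta> \<longlongrightarrow> b) (at_right 0)"

end

(*
  Testing minimality against v + \<tau> \<phi> and the du Bois-Reymond lemma show that a minimizer v and its
  momentum \<omega> v' are C1 and that 2 \<epsilon>^2 (\<omega> v')' = \<omega> W'(v). Cutting out loops shows that v cannot drop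
  below a fixed level between a and \<alpha>m. The Hamiltonian \<epsilon>^2 (\<omega> v')^2 - \<omega>^2 W(v) has derivative
  -2 \<omega> \<omega>' W(v), hence drifts by O(\<epsilon>) only, and it is almost nonnegative at T because \<beta> is close
  to b; so v' does not vanish away from the wells and \<epsilon> v' is close to sqrt (W v) there. Near b the
  momentum decreases, and as q < 1 the difference b - v is dominated by an explicit barrier that
  vanishes at its centre (a dead core), so v reaches b after a time of order \<epsilon>. Therefore \<theta> = b
  works when T is at least K \<epsilon>, for a constant K that depends only on W. When T < K \<epsilon> every hitting
  time is at most K \<epsilon> anyway, and \<theta> can be taken to be max \<alpha> \<beta>.
*)

theory Submission
  imports Defs
begin

section \<open>Weak derivatives on an interval\<close>

text \<open>The shape of the estimates is dictated by uniformity: thresholds for \<epsilon> may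
  depend on the C1 norm of \<omega> but not on \<open>T\<close>, which may be far shorter than
  \<epsilon>. The energy is known to be O(\<epsilon>) only if \<epsilon> \<le> \<open>T\<close>; on
  shorter intervals the bound contains \<epsilon>^2 / \<open>T\<close>. What survives in both
  regimes is that the integral of \<open>W (v t)\<close> is O(\<epsilon>) and that \<omega> varies
  by at most \<open>N * T\<close>. Smallness of the oscillation of \<omega> keeps \<omega> between
  1/2 and 2 and pays for excision, where the shifted rest of the path is weighted at other times.
  The exponent of the barrier comes from balancing powers: k |s|^m can satisfy u'' = const u^q only
  if m - 2 = q m, that is m = 2 / (1 - q). The same condition q < 1 makes 1 / sqrt W integrable, so
  the limit time is finite. The bound \<open>M\<close> comes from crude choices (half the ideal
  speed, a fixed neighbourhood of \<open>b\<close>). The exact limit repeats the argument with speed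
  ratio tending to 1 and shrinking neighbourhood; the matching lower bound on the hitting time uses
  that the Hamiltonian vanishes where the path rests at \<open>b\<close>.\<close>

abbreviation leb :: "real \<Rightarrow> real measure" where
  "leb T \<equiv> lebesgue_on {0<..<T}"

section \<open>Compactly supported C1 test functions on an open interval\<close>

definition test_fun :: "real \<Rightarrow> (real \<Rightarrow> real) \<Rightarrow> (real \<Rightarrow> real) \<Rightarrow> bool" where
  "test_fun T \<phi> \<phi>' \<longleftrightarrow> (\<forall>t. (\<phi> has_real_derivative \<phi>' t) (at t)) \<and> continuous_on UNIV \<phi>' \<and>
     closure {t. \<phi> t \<noteq> 0} \<subseteq> {0<..<T}"

lemma is_weak_deriv_iff_test_fun:
  "is_weak_deriv {0<..<T} v g \<longleftrightarrow> (\<forall>\<phi> \<phi>'. test_fun T \<phi> \<phi>' \<longrightarrow>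
     (\<integral>t. v t * \<phi>' t \<partial>leb T) = - (\<integral>t. g t * \<phi> t \<partial>leb T))"
  unfolding is_weak_deriv_def test_fun_def by blast

lemma test_fun_zero:
  assumes "test_fun T \<phi> \<phi>'" "t \<notin> {0<..<T}"
  shows "\<phi> t = 0"
  using assms closure_subset[of "{t. \<phi> t \<noteq> 0}"] unfolding test_fun_def by blast

lemma test_fun_cont:
  assumes "test_fun T \<phi> \<phi>'"
  shows "continuous_on S \<phi>" "continuous_on S \<phi>'"
proof -
  show "continuous_on S \<phi>"
    using assms DERIV_isCont unfolding test_fun_def by (blast intro: continuous_at_imp_continuous_on)
  show "continuous_on S \<phi>'"
    using assms continuous_on_subset unfolding test_fun_def by blast
qed

lemma test_fun_deriv_zero:
  assumes "test_fun T \<phi> \<phi>'" "t \<notin> {0<..<T}"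
  shows "\<phi>' t = 0"
proof -
  let ?K = "closure {t. \<phi> t \<noteq> 0}"
  have "open (- ?K)" "t \<in> - ?K" using assms unfolding test_fun_def by auto
  moreover have "(\<phi> has_real_derivative \<phi>' t) (at t)" using assms by (auto simp: test_fun_def)
  ultimately have "((\<lambda>_. 0) has_real_derivative \<phi>' t) (at t)"
    by (rule_tac has_field_derivative_transform_within_open[of \<phi>])
       (use closure_subset[of "{t. \<phi> t \<noteq> 0}"] in auto)
  thus ?thesis using DERIV_unique DERIV_const by blast
qed

lemma bounded_test_fun:
  assumes "test_fun T \<phi> \<phi>'"
  obtains B where "\<And>t. \<bar>\<phi> t\<bar> \<le> B" "\<And>t. \<bar>\<phi>' t\<bar> \<le> B"
proof -
  have "bounded (\<phi> ` {0..T})" "bounded (\<phi>' ` {0..T})"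
    by (intro compact_imp_bounded compact_continuous_image test_fun_cont[OF assms] compact_Icc)+
  then obtain B1 B2 where B: "\<forall>x\<in>{0..T}. \<bar>\<phi> x\<bar> \<le> B1" "\<forall>x\<in>{0..T}. \<bar>\<phi>' x\<bar> \<le> B2"
    by (auto simp: bounded_iff)
  have "\<bar>\<phi> t\<bar> \<le> max \<bar>B1\<bar> \<bar>B2\<bar> \<and> \<bar>\<phi>' t\<bar> \<le> max \<bar>B1\<bar> \<bar>B2\<bar>" for t
  proof (cases "t \<in> {0<..<T}")
    case True
    hence "\<bar>\<phi> t\<bar> \<le> B1" "\<bar>\<phi>' t\<bar> \<le> B2" using B by auto
    thus ?thesis by linarith
  next
    case False
    thus ?thesis using test_fun_zero[OF assms, of t] test_fun_deriv_zero[OF assms, of t] by simp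
  qed
  thus ?thesis using that by blast
qed

lemma integrable_lebesgue_on_mult_bounded:
  fixes f g :: "real \<Rightarrow> real"
  assumes "integrable (lebesgue_on S) f" "g \<in> borel_measurable (lebesgue_on S)"
    and "\<And>x. x \<in> S \<Longrightarrow> \<bar>g x\<bar> \<le> B" "S \<in> sets lebesgue"
  shows "integrable (lebesgue_on S) (\<lambda>x. f x * g x)"
proof (rule Bochner_Integration.integrable_bound[of _ "\<lambda>x. B * f x"])
  show "integrable (lebesgue_on S) (\<lambda>x. B * f x)" using assms(1) by simp
  show "(\<lambda>x. f x * g x) \<in> borel_measurable (lebesgue_on S)"
    using assms(1,2) by (intro borel_measurable_times) auto
  show "AE x in lebesgue_on S. norm (f x * g x) \<le> norm (B * f x)"
  proof (rule AE_I2)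
    fix x assume "x \<in> space (lebesgue_on S)"
    hence "\<bar>g x\<bar> \<le> \<bar>B\<bar>" using assms(3)[of x] by auto
    thus "norm (f x * g x) \<le> norm (B * f x)"
      using mult_left_mono[of "\<bar>g x\<bar>" "\<bar>B\<bar>" "\<bar>f x\<bar>"] by (simp add: abs_mult mult.commute)
  qed
qed

lemma integrable_mult_test_fun:
  assumes "integrable (leb T) f" "test_fun T \<phi> \<phi>'"
  shows "integrable (leb T) (\<lambda>x. f x * \<phi> x)"
    "integrable (leb T) (\<lambda>x. f x * \<phi>' x)"
proof -
  obtain B where B: "\<And>t. \<bar>\<phi> t\<bar> \<le> B" "\<And>t. \<bar>\<phi>' t\<bar> \<le> B"
    using bounded_test_fun[OF assms(2)] by blast
  show "integrable (leb T) (\<lambda>x. f x * \<phi> x)"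
    "integrable (leb T) (\<lambda>x. f x * \<phi>' x)"
    using assms(1) B
    by (auto intro!: integrable_lebesgue_on_mult_bounded
        continuous_imp_measurable_on_sets_lebesgue test_fun_cont[OF assms(2)])
qed

section \<open>Approximation of interval indicators and the fundamental lemma of the calculus of
  variations\<close>

lemma has_real_derivative_pos_part_sq:
  "((\<lambda>u::real. (max 0 u)\<^sup>2) has_real_derivative 2 * max 0 u) (at u)"
proof -
  consider "u > 0" | "u < 0" | "u = 0" by linarith
  thus ?thesis
  proof cases
    case 1
    have "((\<lambda>u::real. u\<^sup>2) has_real_derivative 2 * max 0 u) (at u)"
      using 1 by (auto intro!: derivative_eq_intros)
    thus ?thesis
      by (rule has_field_derivative_transform_within_open[of _ _ _ "{0<..}"]) (use 1 in auto)
  next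
    case 2
    have "((\<lambda>u::real. 0) has_real_derivative 2 * max 0 u) (at u)"
      using 2 by (auto intro!: derivative_eq_intros)
    thus ?thesis
      by (rule has_field_derivative_transform_within_open[of _ _ _ "{..<0}"]) (use 2 in auto)
  next
    case 3
    have "((\<lambda>h::real. (max 0 h)\<^sup>2 / h) \<longlongrightarrow> 0) (at 0)"
    proof (rule tendsto_sandwich[of "\<lambda>h. - \<bar>h\<bar>" _ _ "\<lambda>h. \<bar>h\<bar>"])
      show "\<forall>\<^sub>F h::real in at 0. - \<bar>h\<bar> \<le> (max 0 h)\<^sup>2 / h" "\<forall>\<^sub>F h::real in at 0. (max 0 h)\<^sup>2 / h \<le> \<bar>h\<bar>"
        by (auto intro!: always_eventually simp: max_def power2_eq_square divide_simps)
    qed (auto intro!: tendsto_eq_intros)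
    thus ?thesis using 3 by (simp add: has_field_derivative_iff)
  qed
qed

text \<open>Test functions need only be C1, so squared positive parts replace a smooth bump.
  \<open>F\<close> is positive exactly between \<open>x + k\<close> and \<open>y - k\<close>; the
  margin \<open>k\<close> keeps the closed support inside the open interval even for
  \<open>x = 0\<close> or \<open>y = T\<close>, and where \<open>F\<close> is positive the quotient
  tends to 1 from below as \<open>n\<close> grows.\<close>

lemma test_fun_bump:
  fixes x y :: real
  assumes "0 < k" "k < (y - x) / 2" "0 \<le> x" "y \<le> T" "0 < n"
  defines "F \<equiv> \<lambda>t. (max 0 (t - x - k))\<^sup>2 * (max 0 (y - k - t))\<^sup>2"
  shows "\<exists>\<phi>'. test_fun T (\<lambda>t. n * F t / (1 + n * F t)) \<phi>'"
proof -
  define F' where "F' = (\<lambda>t. 2 * max 0 (t - x - k) * (max 0 (y - k - t))\<^sup>2 - (max 0 (t - x - k))\<^sup>2 * (2 * max 0 (y - k - t)))"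
  have F': "(F has_real_derivative F' t) (at t)" for t
  proof -
    have 1: "((\<lambda>t. (max 0 (t - x - k))\<^sup>2) has_real_derivative 2 * max 0 (t - x - k) * 1) (at t)"
      by (rule DERIV_chain2[OF has_real_derivative_pos_part_sq]) (auto intro!: derivative_eq_intros)
    have 2: "((\<lambda>t. (max 0 (y - k - t))\<^sup>2) has_real_derivative 2 * max 0 (y - k - t) * (-1)) (at t)"
      by (rule DERIV_chain2[OF has_real_derivative_pos_part_sq]) (auto intro!: derivative_eq_intros)
    show ?thesis unfolding F_def F'_def
      by (rule DERIV_cong[OF DERIV_mult[OF 1 2]]) (simp add: algebra_simps)
  qed
  have pos: "0 < 1 + n * F t" for t
    using assms(5) by (auto simp: F_def intro!: add_pos_nonneg mult_nonneg_nonneg)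
  have "test_fun T (\<lambda>t. n * F t / (1 + n * F t)) (\<lambda>t. n * F' t / (1 + n * F t)\<^sup>2)"
    unfolding test_fun_def
  proof (intro conjI allI)
    fix t
    show "((\<lambda>t. n * F t / (1 + n * F t)) has_real_derivative n * F' t / (1 + n * F t)\<^sup>2) (at t)"
      using pos[of t]
      by (auto intro!: derivative_eq_intros F' simp: divide_simps power2_eq_square algebra_simps)
  next
    have "continuous_on UNIV F" "continuous_on UNIV F'"
      unfolding F_def F'_def by (intro continuous_intros)+
    moreover have "1 + n * F t \<noteq> 0" for t using pos[of t] by simp
    ultimately show "continuous_on UNIV (\<lambda>t. n * F' t / (1 + n * F t)\<^sup>2)"
      by (intro continuous_intros) auto
  next
    have "{t. n * F t / (1 + n * F t) \<noteq> 0} \<subseteq> {x + k .. y - k}"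
      unfolding F_def by auto
    hence "closure {t. n * F t / (1 + n * F t) \<noteq> 0} \<subseteq> {x + k .. y - k}"
      using closure_minimal closed_atLeastAtMost by blast
    also have "\<dots> \<subseteq> {0<..<T}" using assms by auto
    finally show "closure {t. n * F t / (1 + n * F t) \<noteq> 0} \<subseteq> {0<..<T}" .
  qed
  thus ?thesis by blast
qed

text \<open>The bumps with parameter \<open>n\<close> and margin \<open>1 / n\<close> converge
  pointwise to the indicator and are bounded by 1, so dominated convergence applies with the bound
  \<open>\<bar>f t\<bar>\<close>.\<close>

lemma integral_subinterval_eq_0_of_test_fun:
  assumes f: "integrable (leb T) f"
    and 0: "\<And>\<phi> \<phi>'. test_fun T \<phi> \<phi>' \<Longrightarrow> (\<integral>t. f t * \<phi> t \<partial>leb T) = 0"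
    and xy: "0 \<le> x" "x < y" "y \<le> T"
  shows "(\<integral>t. f t * indicator {x<..<y} t \<partial>leb T) = 0"
proof -
  define F where "F = (\<lambda>n t. (max 0 (t - x - 1 / real n))\<^sup>2 * (max 0 (y - 1 / real n - t))\<^sup>2)"
  define \<phi> where "\<phi> = (\<lambda>n t. real n * F n t / (1 + real n * F n t))"
  have F0: "F n t \<ge> 0" for n t by (auto simp: F_def)
  have F1: "0 < 1 + real n * F n t" for n t
    using F0[of n t] by (intro add_pos_nonneg) auto
  have \<phi>01: "0 \<le> \<phi> n t" "\<phi> n t \<le> 1" for n t
    using F0[of n t] F1[of n t] by (auto simp: \<phi>_def)
  have ev: "\<forall>\<^sub>F n in sequentially. \<exists>\<phi>'. test_fun T (\<phi> n) \<phi>'"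
  proof -
    have "\<forall>\<^sub>F n in sequentially. 1 / real n < (y - x) / 2"
      by (rule order_tendstoD(2)[of _ 0]) (use xy in \<open>auto intro: lim_1_over_n\<close>)
    moreover have "\<forall>\<^sub>F n in sequentially. (0::nat) < n" by (rule eventually_gt_at_top)
    ultimately show ?thesis
      by eventually_elim (unfold \<phi>_def F_def, rule test_fun_bump, use xy in auto)
  qed
  have "(\<lambda>n. \<integral>t. f t * \<phi> n t \<partial>leb T) \<longlonglongrightarrow> (\<integral>t. f t * indicator {x<..<y} t \<partial>leb T)"
  proof (rule integral_dominated_convergence[where w = "\<lambda>t. \<bar>f t\<bar>"])
    show "(\<lambda>t. f t * indicat_real {x<..<y} t) \<in> borel_measurable (leb T)"
    proof (intro borel_measurable_times)
      have "indicat_real {x<..<y} \<in> borel_measurable lebesgue"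
        by (intro borel_measurable_indicator) auto
      thus "indicat_real {x<..<y} \<in> borel_measurable (leb T)"
        by (rule measurable_restrict_space1)
    qed (use f in auto)
    show "(\<lambda>t. f t * \<phi> n t) \<in> borel_measurable (leb T)" for n
    proof (rule borel_measurable_times[OF _ continuous_imp_measurable_on_sets_lebesgue])
      have "1 + real n * F n t \<noteq> 0" for t using F1[of n t] by simp
      moreover have "continuous_on {0<..<T} (F n)" unfolding F_def by (intro continuous_intros)
      ultimately show "continuous_on {0<..<T} (\<phi> n)"
        unfolding \<phi>_def by (intro continuous_intros) auto
    qed (use borel_measurable_integrable[OF f] in auto)
    show "integrable (leb T) (\<lambda>t. \<bar>f t\<bar>)" using f by simp
    show "AE t in leb T. norm (f t * \<phi> n t) \<le> \<bar>f t\<bar>" for n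
      using \<phi>01[of n] by (auto simp: abs_mult intro!: mult_left_le)
    show "AE t in leb T. (\<lambda>n. f t * \<phi> n t) \<longlonglongrightarrow> f t * indicat_real {x<..<y} t"
    proof (rule AE_I2)
      fix t
      have "(\<lambda>n. \<phi> n t) \<longlonglongrightarrow> indicat_real {x<..<y} t"
      proof (cases "t \<in> {x<..<y}")
        case True
        have lim: "(\<lambda>n. F n t) \<longlonglongrightarrow> (max 0 (t - x - 0))\<^sup>2 * (max 0 (y - 0 - t))\<^sup>2"
          unfolding F_def by (intro tendsto_intros lim_1_over_n)
        \<comment> \<open>Half of the limit of \<open>F n t\<close>, hence eventually a positive
          lower bound for it; this gives the rate 1 / (n d) for
          \<open>1 - \<phi> n t\<close>.\<close>
        define d where "d = (max 0 (t - x - 0))\<^sup>2 * (max 0 (y - 0 - t))\<^sup>2 / 2"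
        have d: "0 < d" using True by (auto simp: d_def)
        have "\<forall>\<^sub>F n in sequentially. d < F n t"
          by (rule order_tendstoD(1)[OF lim]) (use d in \<open>auto simp: d_def\<close>)
        moreover have "\<forall>\<^sub>F n in sequentially. (0::nat) < n" by (rule eventually_gt_at_top)
        ultimately have low: "\<forall>\<^sub>F n in sequentially. 1 - (1/d) * (1 / real n) \<le> \<phi> n t"
        proof eventually_elim
          case (elim n)
          have "1 - \<phi> n t = 1 / (1 + real n * F n t)"
            using F1[of n t] by (simp add: \<phi>_def field_simps)
          also have "\<dots> \<le> 1 / (real n * d)"
          proof (rule divide_left_mono)
            show "real n * d \<le> 1 + real n * F n t"
              using elim by (intro add_increasing mult_left_mono) auto
            show "0 < (1 + real n * F n t) * (real n * d)"
              using elim d F0[of n t] by (intro mult_pos_pos add_pos_nonneg) auto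
          qed simp
          also have "\<dots> = (1/d) * (1 / real n)" by (simp only: times_divide_times_eq mult_1 mult.commute[of d])
          finally have le: "1 - \<phi> n t \<le> (1/d) * (1 / real n)" .
          have "1 - x \<le> y" if "1 - y \<le> x" for x y :: real using that by linarith
          from this[OF le] show ?case .
        qed
        have lim1: "(\<lambda>n. 1 - (1/d) * (1 / real n)) \<longlonglongrightarrow> 1"
          using tendsto_diff[OF tendsto_const tendsto_mult[OF tendsto_const lim_1_over_n], of "1::real" "1/d"] by simp
        have "(\<lambda>n. \<phi> n t) \<longlonglongrightarrow> 1"
          by (rule tendsto_sandwich[OF low always_eventually lim1 tendsto_const]) (use \<phi>01(2) in blast)
        thus ?thesis using True by simp
      next
        case False
        have "\<phi> n t = 0" for n
        proof -
          have "t - x - 1 / real n \<le> 0 \<or> y - 1 / real n - t \<le> 0"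
          proof -
            have "0 \<le> 1 / real n" by simp
            moreover have "t \<le> x \<or> y \<le> t" using False by auto
            ultimately show ?thesis by linarith
          qed
          thus ?thesis by (auto simp: \<phi>_def F_def)
        qed
        thus ?thesis using False by simp
      qed
      thus "(\<lambda>n. f t * \<phi> n t) \<longlonglongrightarrow> f t * indicat_real {x<..<y} t" by (intro tendsto_intros)
    qed
  qed
  moreover have "(\<lambda>n. \<integral>t. f t * \<phi> n t \<partial>leb T) \<longlonglongrightarrow> 0"
    by (rule tendsto_eventually, use ev in eventually_elim) (use 0 in blast)
  ultimately show ?thesis using LIMSEQ_unique by blast
qed

text \<open>\<open>F\<close> may change sign, so uniqueness of measures on a generator is not
  directly available. Instead, the sets over which \<open>F\<close> integrates to zero are closed
  under complements and disjoint unions, and open intervals form an intersection-stable generator.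
  The total integral is a separate premise because complements need it and the whole line is not of
  the form \<open>{x<..<y}\<close>.\<close>

lemma AE_eq_0_of_interval_integrals:
  fixes F :: "real \<Rightarrow> real"
  assumes F: "integrable lborel F"
    and int: "\<And>x y. (\<integral>t. F t * indicator {x<..<y} t \<partial>lborel) = 0"
    and tot: "(\<integral>t. F t \<partial>lborel) = 0"
  shows "AE t in lborel. F t = 0"
proof (rule density_unique_real)
  have borel: "sets (borel :: real measure) = sigma_sets UNIV (range (\<lambda>(a, b). {a<..<b}))"
    using arg_cong[OF borel_eq_box[where 'a = real], of sets] by (simp add: box_real sets_measure_of)
  fix A :: "real set" assume "A \<in> sets lborel"
  hence A: "A \<in> sigma_sets UNIV (range (\<lambda>(a, b). {a<..<b}))"
    by (simp add: borel)
  have Fi: "integrable lborel (\<lambda>t. indicator B t * F t)" if "B \<in> sets borel" for B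
    using integrable_mult_indicator[OF _ F, of B] that by simp
  have sets: "B \<in> sets borel" if "B \<in> sigma_sets UNIV (range (\<lambda>(a, b). {a<..<b::real}))" for B
    using that by (simp add: borel)
  have "(LBINT x:A. F x) = 0"
  proof (rule sigma_sets_induct_disjoint[OF _ _ A, where P = "\<lambda>A. (LBINT x:A. F x) = 0"])
    show "Int_stable (range (\<lambda>(a, b). {a<..<b::real}))"
    proof (rule Int_stableI, clarify)
      fix a b c d :: real
      have "{a<..<b} \<inter> {c<..<d} = {max a c<..<min b d}" by auto
      thus "{a<..<b} \<inter> {c<..<d} \<in> range (\<lambda>(a, b). {a<..<b})" by auto
    qed
    show "(LBINT x:UNIV - A. F x) = 0" if "A \<in> sigma_sets UNIV (range (\<lambda>(a, b). {a<..<b}))" "(LBINT x:A. F x) = 0" for A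
    proof -
      have "(LBINT x:UNIV - A. F x) = (\<integral>x. F x - indicator A x * F x \<partial>lborel)"
        unfolding set_lebesgue_integral_def by (rule Bochner_Integration.integral_cong) (auto simp: indicator_def)
      also have "\<dots> = 0"
        using that tot Fi[OF sets[OF that(1)]] F by (subst Bochner_Integration.integral_diff) (auto simp: set_lebesgue_integral_def)
      finally show ?thesis .
    qed
    show "(LBINT x:(\<Union>i. B i). F x) = 0"
      if "disjoint_family B" "range B \<subseteq> sigma_sets UNIV (range (\<lambda>(a, b). {a<..<b}))" "\<And>i. (LBINT x:B i. F x) = 0" for B :: "nat \<Rightarrow> real set"
    proof -
      have "set_integrable lborel (\<Union>i. B i) F" using Fi[of "\<Union>i. B i"] that(2) sets
        by (auto simp: set_integrable_def)
      hence "(LBINT x:(\<Union>i. B i). F x) = (\<Sum>i. (LBINT x:B i. F x))"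
        using that(1) subsetD[OF that(2)] by (intro lebesgue_integral_countable_add) (auto simp: disjoint_family_on_def intro!: sets)
      thus ?thesis using that by simp
    qed
  qed (use int in \<open>auto simp: set_lebesgue_integral_def mult.commute\<close>)
  thus "(LBINT x:A. F x) = (LBINT x:A. 0)" by (simp add: set_lebesgue_integral_def)
qed (use F in auto)

text \<open>\<open>f\<close> is only Lebesgue measurable, while the generator argument lives on
  Borel sets; extension by zero and a Borel representative reduce the claim to interval integrals on
  the line.\<close>

lemma AE_eq_0_of_test_fun:
  assumes f: "integrable (leb T) f" and T: "0 < T"
    and 0: "\<And>\<phi> \<phi>'. test_fun T \<phi> \<phi>' \<Longrightarrow> (\<integral>t. f t * \<phi> t \<partial>leb T) = 0"
  shows "AE t in leb T. f t = 0"
proof -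
  let ?I = "{0<..<T}"
  have I: "integrable lebesgue (\<lambda>t. indicator ?I t *\<^sub>R f t)"
    using f by (subst (asm) integrable_restrict_space) auto
  define h where "h = (\<lambda>t. indicator ?I t *\<^sub>R f t)"
  have h: "integrable lebesgue h" using I by (simp add: h_def)
  have "h \<in> borel_measurable (completion lborel)" using h by auto
  then obtain F where F: "F \<in> borel_measurable lborel" "AE t in lborel. h t = F t"
    using completion_ex_borel_measurable_real by blast
  have ae: "AE t in lebesgue. h t = F t" using F(2) by (rule AE_completion)
  have Fleb: "F \<in> borel_measurable lebesgue" using F(1) by (rule measurable_completion)
  have "integrable lebesgue F"
    using h ae Fleb by (subst integrable_cong_AE[of _ _ h]) auto
  hence Fint: "integrable lborel F" using F(1) by (subst (asm) integrable_completion) auto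
  have eq: "(\<integral>t. F t * indicator A t \<partial>lborel) = (\<integral>t. f t * indicator A t \<partial>lebesgue_on ?I)"
    if A: "A \<in> sets borel" for A
  proof -
    have "(\<integral>t. F t * indicator A t \<partial>lborel) = (\<integral>t. F t * indicator A t \<partial>lebesgue)"
      using F(1) A by (subst integral_completion) auto
    also have "\<dots> = (\<integral>t. h t * indicator A t \<partial>lebesgue)"
    proof (rule integral_cong_AE)
      have "indicat_real A \<in> borel_measurable lebesgue"
        using A by (intro borel_measurable_indicator) auto
      thus "(\<lambda>t. F t * indicat_real A t) \<in> borel_measurable lebesgue"
        "(\<lambda>t. h t * indicat_real A t) \<in> borel_measurable lebesgue"
        using Fleb borel_measurable_integrable[OF h] by (auto intro!: borel_measurable_times)
    qed (use ae in auto)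
    also have "\<dots> = (\<integral>t. f t * indicator A t \<partial>lebesgue_on ?I)"
      by (subst integral_restrict_space) (auto simp: h_def mult.assoc)
    finally show ?thesis .
  qed
  have int: "(\<integral>t. F t * indicator {x<..<y} t \<partial>lborel) = 0" for x y
  proof -
    have "(\<integral>t. F t * indicator {x<..<y} t \<partial>lborel) = (\<integral>t. f t * indicator {x<..<y} t \<partial>lebesgue_on ?I)"
      by (rule eq) simp
    also have "\<dots> = (\<integral>t. f t * indicator {max 0 x<..<min T y} t \<partial>lebesgue_on ?I)"
      by (rule Bochner_Integration.integral_cong) (auto simp: indicator_def)
    also have "\<dots> = 0"
    proof (cases "max 0 x < min T y")
      case True
      show ?thesis by (rule integral_subinterval_eq_0_of_test_fun[OF f 0]) (use True in auto)
    next
      case False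
      hence "{max 0 x<..<min T y} = {}" by auto
      thus ?thesis by simp
    qed
    finally show ?thesis .
  qed
  have "(\<integral>t. F t \<partial>lborel) = (\<integral>t. f t * indicator {0<..<T} t \<partial>lebesgue_on ?I)"
    using eq[of UNIV] by (auto intro!: Bochner_Integration.integral_cong)
  also have "\<dots> = 0" by (rule integral_subinterval_eq_0_of_test_fun[OF f 0]) (use T in auto)
  finally have "(\<integral>t. F t \<partial>lborel) = 0" .
  hence "AE t in lborel. F t = 0" by (intro AE_eq_0_of_interval_integrals Fint int)
  hence "AE t in lebesgue. F t = 0" by (rule AE_completion)
  hence "AE t in lebesgue. h t = 0" using ae by eventually_elim simp
  thus ?thesis by (subst AE_restrict_space_iff) (auto simp: h_def)
qed

lemma test_fun_support:
  assumes "test_fun T \<phi> \<phi>'" "0 < T"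
  obtains k l where "0 < k" "k \<le> l" "l < T" "\<And>t. t \<notin> {k..l} \<Longrightarrow> \<phi> t = 0"
proof (cases "{t. \<phi> t \<noteq> 0} = {}")
  case True
  \<comment> \<open>For \<phi> = 0 the support is empty and its \<open>Inf\<close> and
    \<open>Sup\<close> carry no information; any interior interval serves.\<close>
  thus ?thesis using that[of "T/2" "T/2"] assms(2) by auto
next
  case False
  define K where "K = closure {t. \<phi> t \<noteq> 0}"
  have sub: "K \<subseteq> {0<..<T}" using assms(1) by (simp add: test_fun_def K_def)
  have bd: "bdd_below K" "bdd_above K"
    using bdd_below_mono[OF bdd_below_Ioo sub] bdd_above_mono[OF bdd_above_Ioo sub] .
  have K: "K \<noteq> {}" "closed K" using False by (auto simp: K_def)
  have mem: "Inf K \<in> K" "Sup K \<in> K"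
    using closed_contains_Inf[OF K(1) bd(1) K(2)] closed_contains_Sup[OF K(1) bd(2) K(2)] .
  show ?thesis
  proof (rule that)
    show "0 < Inf K" "Sup K < T" using mem sub by auto
    show "Inf K \<le> Sup K" using bd K(1) by (simp add: cInf_le_cSup)
    fix t assume t: "t \<notin> {Inf K..Sup K}"
    show "\<phi> t = 0"
    proof (rule ccontr)
      assume "\<phi> t \<noteq> 0"
      hence "t \<in> K" using closure_subset[of "{t. \<phi> t \<noteq> 0}"] unfolding K_def by blast
      hence "Inf K \<le> t" "t \<le> Sup K" using cInf_lower[OF _ bd(1)] cSup_upper[OF _ bd(2)] by auto
      thus False using t by auto
    qed
  qed
qed

lemma integrable_lebesgue_on_Ioo:
  fixes f :: "real \<Rightarrow> real"
  assumes "continuous_on {l..h} f"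
  shows "integrable (lebesgue_on {l<..<h}) f"
proof -
  have "f absolutely_integrable_on {l..h}"
    using assms by (rule absolutely_integrable_continuous_real)
  hence "f absolutely_integrable_on {l<..<h}"
    by (rule set_integrable_subset) auto
  thus ?thesis by (simp add: set_integrable_def integrable_restrict_space)
qed

lemma lebesgue_integral_Ioo_eq_integral:
  fixes f :: "real \<Rightarrow> real"
  assumes "integrable (lebesgue_on {l<..<h}) f"
  shows "(\<integral>t. f t \<partial>lebesgue_on {l<..<h}) = integral {l..h} f"
  using assms by (subst lebesgue_integral_eq_integral) (auto simp: integral_open_interval_real)

text \<open>Upgrades almost everywhere identities of continuous functions to the closed interval,
  endpoints included; boundary values depend on this.\<close>

lemma AE_Ioo_eq_0_imp_eq_0:
  fixes f :: "real \<Rightarrow> real"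
  assumes "0 < T" and f: "continuous_on {0..T} f" and ae: "AE t in leb T. f t = 0" and t: "t \<in> {0..T}"
  shows "f t = 0"
proof -
  have "integral {0..T} (\<lambda>t. \<bar>f t\<bar>) = (\<integral>t. \<bar>f t\<bar> \<partial>leb T)"
    by (intro lebesgue_integral_Ioo_eq_integral[symmetric] integrable_lebesgue_on_Ioo continuous_intros f)
  also have "\<dots> = 0"
    using ae by (intro integral_eq_zero_AE) auto
  finally show ?thesis
    using assms by (subst (asm) integral_eq_0_iff) (auto intro!: continuous_intros)
qed

text \<open>A test function with zero integral is the derivative of a test function. Subtracting
  from an arbitrary \<psi> a multiple of one fixed \<eta> with nonzero integral produces such a
  function, so \<open>h - c\<close>, with \<open>c\<close> the \<eta>-weighted mean of
  \<open>h\<close>, is orthogonal to every \<psi>.\<close>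

lemma du_bois_reymond:
  assumes h: "integrable (leb T) h" and T: "0 < T"
    and 0: "\<And>\<phi> \<phi>'. test_fun T \<phi> \<phi>' \<Longrightarrow> (\<integral>t. h t * \<phi>' t \<partial>leb T) = 0"
  shows "\<exists>c. AE t in leb T. h t = c"
proof -
  let ?M = "leb T"
  \<comment> \<open>If every test function had integral zero, the fundamental lemma would make the
    constant 1 vanish; so \<eta> exists without computing one.\<close>
  have "\<exists>\<eta> \<eta>'. test_fun T \<eta> \<eta>' \<and> (\<integral>t. \<eta> t \<partial>?M) \<noteq> 0"
  proof (rule ccontr)
    assume "\<not> ?thesis"
    hence "AE t in ?M. (1::real) = 0"
      by (intro AE_eq_0_of_test_fun T) (auto intro: integrable_lebesgue_on_Ioo)
    thus False using AE_Ioo_eq_0_imp_eq_0[OF T, of "\<lambda>_. 1" 0] T by simp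
  qed
  then obtain \<eta> \<eta>' where \<eta>: "test_fun T \<eta> \<eta>'" and m: "(\<integral>t. \<eta> t \<partial>?M) \<noteq> 0" by blast
  define m where "m = (\<integral>t. \<eta> t \<partial>?M)"
  define c where "c = (\<integral>t. h t * \<eta> t \<partial>?M) / m"
  have m0: "m \<noteq> 0" using m by (simp add: m_def)
  have int1: "integrable ?M \<psi>" if "test_fun T \<psi> \<psi>'" for \<psi> \<psi>'
    by (rule integrable_lebesgue_on_Ioo[OF test_fun_cont(1)[OF that]])
  have main: "(\<integral>t. (h t - c) * \<psi> t \<partial>?M) = 0" if \<psi>: "test_fun T \<psi> \<psi>'" for \<psi> \<psi>'
  proof -
    define k where "k = (\<integral>t. \<psi> t \<partial>?M) / m"
    define \<xi> where "\<xi> = (\<lambda>t. \<psi> t - k * \<eta> t)"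
    have \<xi>cont: "continuous_on S \<xi>" for S
      unfolding \<xi>_def by (intro continuous_intros test_fun_cont[OF \<psi>] test_fun_cont[OF \<eta>])
    have \<xi>int: "(\<integral>t. \<xi> t \<partial>?M) = 0"
      unfolding \<xi>_def using int1[OF \<psi>] int1[OF \<eta>] m0
      by (simp add: k_def m_def)
    obtain F where F: "\<And>t. (F has_vector_derivative \<xi> t) (at t)"
      using einterval_antiderivative[of "-\<infinity>" "\<infinity>" \<xi>] \<xi>cont[of UNIV]
      by (auto simp: continuous_on_eq_continuous_at)
    hence F': "(F has_real_derivative \<xi> t) (at t)" for t
      by (simp add: has_real_derivative_iff_has_vector_derivative)
    obtain k1 l1 where kl1: "0 < k1" "k1 \<le> l1" "l1 < T" "\<And>t. t \<notin> {k1..l1} \<Longrightarrow> \<psi> t = 0"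
      using test_fun_support[OF \<psi> T] by blast
    obtain k2 l2 where kl2: "0 < k2" "k2 \<le> l2" "l2 < T" "\<And>t. t \<notin> {k2..l2} \<Longrightarrow> \<eta> t = 0"
      using test_fun_support[OF \<eta> T] by blast
    define k' where "k' = min k1 k2"
    define l' where "l' = max l1 l2"
    have kl: "0 < k'" "k' \<le> l'" "l' < T" "\<And>t. t < k' \<Longrightarrow> \<xi> t = 0" "\<And>t. l' < t \<Longrightarrow> \<xi> t = 0"
      using kl1 kl2 by (auto simp: k'_def l'_def \<xi>_def)
    have "(\<xi> has_integral (F T - F 0)) {0..T}"
      by (rule fundamental_theorem_of_calculus) (use T F in \<open>auto intro: has_vector_derivative_at_within\<close>)
    \<comment> \<open>The zero integral of \<xi> makes the antiderivative return to its initial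
      value, so \<open>F t - F 0\<close> vanishes on both sides of the support of \<xi>.\<close>
    hence FT: "F T = F 0"
      using \<xi>int lebesgue_integral_Ioo_eq_integral[OF integrable_lebesgue_on_Ioo[OF \<xi>cont], of 0 T]
      by (simp add: integral_unique)
    have left: "F t = F 0" if "t \<le> k'" for t
    proof -
      have "\<exists>z. min t 0 < z \<and> z < max t 0 \<and> F (max t 0) - F (min t 0) = (max t 0 - min t 0) * \<xi> z" if "t \<noteq> 0"
        using MVT2[of "min t 0" "max t 0" F \<xi>] F' that by auto
      thus ?thesis using kl that by (cases "t = 0") (auto simp: max_def min_def split: if_splits)
    qed
    have right: "F t = F 0" if "l' \<le> t" for t
    proof -
      have "\<exists>z. min t T < z \<and> z < max t T \<and> F (max t T) - F (min t T) = (max t T - min t T) * \<xi> z" if "t \<noteq> T"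
        using MVT2[of "min t T" "max t T" F \<xi>] F' that by auto
      thus ?thesis using kl that FT by (cases "t = T") (auto simp: max_def min_def split: if_splits)
    qed
    have "test_fun T (\<lambda>t. F t - F 0) \<xi>"
      unfolding test_fun_def
    proof (intro conjI allI \<xi>cont)
      show "((\<lambda>t. F t - F 0) has_real_derivative \<xi> t) (at t)" for t
        using F'[of t] by (auto intro!: derivative_eq_intros)
      have "{t. F t - F 0 \<noteq> 0} \<subseteq> {k'..l'}" using left right
        by (metis (mono_tags, lifting) atLeastAtMost_iff linorder_le_cases mem_Collect_eq right_minus_eq subsetI)
      hence "closure {t. F t - F 0 \<noteq> 0} \<subseteq> {k'..l'}"
        using closure_minimal closed_atLeastAtMost by blast
      thus "closure {t. F t - F 0 \<noteq> 0} \<subseteq> {0<..<T}" using kl by auto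
    qed
    from 0[OF this] have "(\<integral>t. h t * \<psi> t - k * (h t * \<eta> t) \<partial>?M) = 0"
      by (simp add: \<xi>_def algebra_simps)
    hence "(\<integral>t. h t * \<psi> t \<partial>?M) = k * (c * m)"
      using integrable_mult_test_fun(1)[OF h \<psi>] integrable_mult_test_fun(1)[OF h \<eta>] m0
      by (simp add: c_def)
    hence "(\<integral>t. h t * \<psi> t \<partial>?M) = c * (\<integral>t. \<psi> t \<partial>?M)"
      using m0 by (simp add: k_def)
    thus ?thesis
      using integrable_mult_test_fun(1)[OF h \<psi>] int1[OF \<psi>] by (simp add: left_diff_distrib)
  qed
  have "AE t in ?M. h t - c = 0"
    by (rule AE_eq_0_of_test_fun[OF _ T main])
       (use h integrable_lebesgue_on_Ioo[of 0 T "\<lambda>_. c"] in auto)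
  thus ?thesis by auto
qed

section \<open>Uniqueness of weak derivatives; piecewise C1 functions\<close>

lemma integrable_of_L2_fun:
  assumes "L2_fun {0<..<T} v"
  shows "integrable (leb T) v"
proof (rule Bochner_Integration.integrable_bound[of _ "\<lambda>t. 1 + (v t)\<^sup>2"])
  show "integrable (leb T) (\<lambda>t. 1 + (v t)\<^sup>2)"
    using assms by (intro Bochner_Integration.integrable_add integrable_lebesgue_on_Ioo[of 0 T "\<lambda>_. 1"])
      (auto simp: L2_fun_def)
  show "AE t in leb T. norm (v t) \<le> norm (1 + (v t)\<^sup>2)"
  proof (rule AE_I2)
    fix t
    have "0 \<le> (\<bar>v t\<bar> - 1)\<^sup>2" "0 \<le> (v t)\<^sup>2" by simp_all
    hence "2 * \<bar>v t\<bar> \<le> 1 + (v t)\<^sup>2" by (simp add: power2_diff)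
    thus "norm (v t) \<le> norm (1 + (v t)\<^sup>2)" by simp
  qed
qed (use assms in \<open>auto simp: L2_fun_def\<close>)

lemma weak_deriv_unique:
  assumes "is_weak_deriv {0<..<T} v g" "is_weak_deriv {0<..<T} v g'" "0 < T"
    "integrable (leb T) g" "integrable (leb T) g'"
  shows "AE t in leb T. g t = g' t"
proof -
  have "AE t in leb T. g t - g' t = 0"
  proof (rule AE_eq_0_of_test_fun[OF Bochner_Integration.integrable_diff[OF assms(4,5)] assms(3)])
    fix \<phi> \<phi>' assume \<phi>: "test_fun T \<phi> \<phi>'"
    have "(\<integral>t. g t * \<phi> t \<partial>leb T) = (\<integral>t. g' t * \<phi> t \<partial>leb T)"
      using assms(1,2)[unfolded is_weak_deriv_iff_test_fun, rule_format, OF \<phi>] by linarith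
    thus "(\<integral>t. (g t - g' t) * \<phi> t \<partial>leb T) = 0"
      using integrable_mult_test_fun(1)[OF assms(4) \<phi>] integrable_mult_test_fun(1)[OF assms(5) \<phi>]
      by (simp add: left_diff_distrib)
  qed
  thus ?thesis by simp
qed

lemma weak_deriv_spec:
  assumes "H1_fun I v"
  shows "L2_fun I (weak_deriv I v)" "is_weak_deriv I v (weak_deriv I v)"
  using assms someI_ex[of "\<lambda>g. L2_fun I g \<and> is_weak_deriv I v g"]
  unfolding H1_fun_def weak_deriv_def by auto

text \<open>\<open>weak_deriv\<close> is an arbitrary choice; this replaces it in integrals by
  whichever weak derivative is at hand.\<close>

lemma weak_deriv_AE:
  assumes "L2_fun {0<..<T} v" "L2_fun {0<..<T} g" "is_weak_deriv {0<..<T} v g" "0 < T"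
  shows "AE t in leb T. weak_deriv {0<..<T} v t = g t"
proof -
  have "H1_fun {0<..<T} v" using assms by (auto simp: H1_fun_def)
  from weak_deriv_spec[OF this] show ?thesis
    using assms by (intro weak_deriv_unique integrable_of_L2_fun)
qed

text \<open>The class of competitors. Finitely many kinks permit gluing, boundedness of
  \<open>g\<close> makes it square integrable, and continuity off the kinks makes it measurable
  whatever its values there.\<close>

definition pw_deriv :: "real \<Rightarrow> real \<Rightarrow> (real \<Rightarrow> real) \<Rightarrow> (real \<Rightarrow> real) \<Rightarrow> bool" where
  "pw_deriv l h u g \<longleftrightarrow> continuous_on {l..h} u \<and> bounded (g ` {l<..<h}) \<and>
     (\<exists>S. finite S \<and> (\<forall>t\<in>{l<..<h} - S. (u has_real_derivative g t) (at t) \<and> isCont g t))"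

lemma pw_deriv_measurable:
  assumes "pw_deriv l h u g"
  shows "g \<in> borel_measurable (lebesgue_on {l<..<h})"
proof -
  obtain S where S: "finite S" "\<forall>t\<in>{l<..<h} - S. isCont g t"
    using assms by (auto simp: pw_deriv_def)
  let ?U = "{l<..<h} - S"
  have U: "open ?U" using S(1) by (intro open_Diff finite_imp_closed) auto
  have "continuous_on ?U g" using S(2) by (simp add: continuous_at_imp_continuous_on)
  hence "(\<lambda>x. indicator ?U x *\<^sub>R g x) \<in> borel_measurable borel"
    using U by (intro borel_measurable_continuous_on_indicator) auto
  hence "(\<lambda>x. indicator ?U x *\<^sub>R g x) \<in> borel_measurable (lebesgue_on {l<..<h})"
    by (intro measurable_restrict_space1 measurable_completion) simp
  thus ?thesis
  proof (rule measurable_discrete_difference[where X = "S \<inter> {l<..<h}"])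
    show "countable (S \<inter> {l<..<h})" using S(1) by (simp add: countable_finite)
    show "{x} \<in> sets (lebesgue_on {l<..<h})" if "x \<in> S \<inter> {l<..<h}" for x
      using that by (subst sets_restrict_space_iff) auto
  qed (auto simp: indicator_def)
qed

lemma pw_deriv_bounded_integrable:
  assumes "pw_deriv l h u g"
  shows "integrable (lebesgue_on {l<..<h}) (\<lambda>t. (g t)\<^sup>2)" "integrable (lebesgue_on {l<..<h}) g"
proof -
  obtain B where B: "\<And>t. t \<in> {l<..<h} \<Longrightarrow> \<bar>g t\<bar> \<le> B"
    using assms unfolding pw_deriv_def bounded_iff by (metis imageI real_norm_def)
  have 1: "integrable (lebesgue_on {l<..<h}) (\<lambda>t. 1 * g t)"
    by (rule integrable_lebesgue_on_mult_bounded[OF _ pw_deriv_measurable[OF assms] B])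
       (auto intro: integrable_lebesgue_on_Ioo)
  have "integrable (lebesgue_on {l<..<h}) (\<lambda>t. (1 * g t) * g t)"
    by (rule integrable_lebesgue_on_mult_bounded[OF 1 pw_deriv_measurable[OF assms] B]) auto
  thus "integrable (lebesgue_on {l<..<h}) (\<lambda>t. (g t)\<^sup>2)" by (simp add: power2_eq_square)
  show "integrable (lebesgue_on {l<..<h}) g" using 1 by simp
qed

lemma L2_fun_continuous:
  assumes "continuous_on {0..T} u"
  shows "L2_fun {0<..<T} u"
  unfolding L2_fun_def
  using integrable_lebesgue_on_Ioo[OF assms] integrable_lebesgue_on_Ioo[of 0 T "\<lambda>t. (u t)\<^sup>2"] assms
  by (auto intro!: continuous_intros)

lemma pw_deriv_weak:
  assumes u: "pw_deriv 0 T u g" and T: "0 < T"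
  shows "L2_fun {0<..<T} u" "L2_fun {0<..<T} g" "is_weak_deriv {0<..<T} u g"
proof -
  have cont: "continuous_on {0..T} u" using u by (simp add: pw_deriv_def)
  show "L2_fun {0<..<T} u" by (rule L2_fun_continuous[OF cont])
  show "L2_fun {0<..<T} g"
    using pw_deriv_bounded_integrable[OF u] by (auto simp: L2_fun_def)
  show "is_weak_deriv {0<..<T} u g"
    unfolding is_weak_deriv_iff_test_fun
  proof (intro allI impI)
    fix \<phi> \<phi>' assume \<phi>: "test_fun T \<phi> \<phi>'"
    obtain S where S: "finite S" "\<forall>t\<in>{0<..<T} - S. (u has_real_derivative g t) (at t)"
      using u by (auto simp: pw_deriv_def)
    have "((\<lambda>t. u t * \<phi>' t + g t * \<phi> t) has_integral (u T * \<phi> T - u 0 * \<phi> 0)) {0..T}"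
    proof (rule fundamental_theorem_of_calculus_interior_strong[OF S(1)])
      fix t assume t: "t \<in> {0<..<T} - S"
      have "(\<phi> has_real_derivative \<phi>' t) (at t)" using \<phi> by (simp add: test_fun_def)
      with S(2) t have "((\<lambda>t. u t * \<phi> t) has_real_derivative (u t * \<phi>' t + g t * \<phi> t)) (at t)"
        by (auto intro!: derivative_eq_intros)
      thus "((\<lambda>t. u t * \<phi> t) has_vector_derivative (u t * \<phi>' t + g t * \<phi> t)) (at t)"
        by (simp add: has_real_derivative_iff_has_vector_derivative)
    qed (use T in \<open>auto intro!: continuous_intros cont test_fun_cont[OF \<phi>]\<close>)
    moreover have "\<phi> T = 0" "\<phi> 0 = 0" using test_fun_zero[OF \<phi>] by auto
    ultimately have 0: "integral {0..T} (\<lambda>t. u t * \<phi>' t + g t * \<phi> t) = 0"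
      by (auto simp: integral_unique)
    have i: "integrable (leb T) (\<lambda>t. u t * \<phi>' t)" "integrable (leb T) (\<lambda>t. g t * \<phi> t)"
      using integrable_mult_test_fun[OF _ \<phi>] integrable_lebesgue_on_Ioo[OF cont] pw_deriv_bounded_integrable[OF u] by auto
    have "(\<integral>t. u t * \<phi>' t + g t * \<phi> t \<partial>leb T) = 0"
      using 0 i by (subst lebesgue_integral_Ioo_eq_integral) auto
    thus "(\<integral>t. u t * \<phi>' t \<partial>leb T) = - (\<integral>t. g t * \<phi> t \<partial>leb T)"
      using i by simp
  qed
qed

lemma G_fun_eq_nn_integral:
  assumes "L2_fun {0<..<T} v" "L2_fun {0<..<T} g" "is_weak_deriv {0<..<T} v g" "0 < T"
    "boundary_values T v \<alpha> \<beta>"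
  shows "G_fun W T \<omega> \<alpha> \<beta> \<epsilon> v =
    (\<integral>\<^sup>+t. ennreal ((W (v t) + \<epsilon>\<^sup>2 * (g t)\<^sup>2) * \<omega> t) \<partial>leb T)"
proof -
  have "H1_fun {0<..<T} v" using assms by (auto simp: H1_fun_def)
  thus ?thesis unfolding G_fun_def using assms(5)
    by (auto intro!: nn_integral_cong_AE intro: AE_mp[OF weak_deriv_AE[OF assms(1-4)]])
qed

section \<open>Regularity of minimizers\<close>

text \<open>Only continuity of \<open>dW\<close> is required: the second derivative of the potential
  blows up at the wells, so regularity has to come from the first variation alone.\<close>

locale weighted_energy =
  fixes W dW :: "real \<Rightarrow> real" and T :: real and \<omega> :: "real \<Rightarrow> real" and \<epsilon> :: real
  assumes W_deriv: "\<And>x. (W has_real_derivative dW x) (at x)"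
    and dW_cont: "continuous_on UNIV dW"
    and W_ge_0: "\<And>x. 0 \<le> W x"
    and T_pos: "0 < T"
    and \<omega>_cont: "continuous_on {0..T} \<omega>"
    and \<omega>_pos: "\<And>t. t \<in> {0..T} \<Longrightarrow> 0 < \<omega> t"
    and \<epsilon>_pos: "0 < \<epsilon>"
begin

lemma continuous_on_W [continuous_intros]: "continuous_on S f \<Longrightarrow> continuous_on S (\<lambda>x. W (f x))"
proof (rule continuous_on_compose2[of UNIV W])
  show "continuous_on UNIV W"
    using W_deriv DERIV_isCont by (blast intro: continuous_at_imp_continuous_on)
qed auto

lemma continuous_on_dW [continuous_intros]: "continuous_on S f \<Longrightarrow> continuous_on S (\<lambda>x. dW (f x))"
  using continuous_on_compose2[OF dW_cont] by auto

definition density :: "(real \<Rightarrow> real) \<Rightarrow> (real \<Rightarrow> real) \<Rightarrow> real \<Rightarrow> real" where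
  "density u g t = (W (u t) + \<epsilon>\<^sup>2 * (g t)\<^sup>2) * \<omega> t"

lemma density_nonneg: "t \<in> {0..T} \<Longrightarrow> 0 \<le> density u g t"
  using W_ge_0[of "u t"] \<omega>_pos[of t] by (auto simp: density_def intro!: mult_nonneg_nonneg)

lemma integrable_mult_weight:
  fixes f w :: "real \<Rightarrow> real"
  assumes "integrable (leb T) f" "continuous_on {0..T} w"
  shows "integrable (leb T) (\<lambda>t. f t * w t)"
proof -
  have "bounded (w ` {0..T})" by (intro compact_imp_bounded compact_continuous_image assms compact_Icc)
  then obtain B where B: "\<forall>t\<in>{0..T}. \<bar>w t\<bar> \<le> B" by (auto simp: bounded_iff)
  have "continuous_on {0<..<T} w" by (rule continuous_on_subset[OF assms(2)]) auto
  hence "w \<in> borel_measurable (leb T)"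
    by (intro continuous_imp_measurable_on_sets_lebesgue) auto
  thus ?thesis
    using B by (intro integrable_lebesgue_on_mult_bounded[OF assms(1)]) auto
qed

lemma integrable_density:
  assumes "continuous_on {0..T} u" "integrable (leb T) (\<lambda>t. (g t)\<^sup>2)"
  shows "integrable (leb T) (density u g)"
proof -
  have "integrable (leb T) (\<lambda>t. W (u t) + \<epsilon>\<^sup>2 * (g t)\<^sup>2)"
    using assms(2) integrable_lebesgue_on_Ioo[OF continuous_on_W[OF assms(1)]]
    by (intro Bochner_Integration.integrable_add) auto
  from integrable_mult_weight[OF this \<omega>_cont] show ?thesis by (simp add: density_def[abs_def])
qed

lemma G_fun_eq_integral:
  assumes u: "continuous_on {0..T} u" and g: "L2_fun {0<..<T} g" and w: "is_weak_deriv {0<..<T} u g"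
    and bv: "u 0 = \<alpha>" "u T = \<beta>"
  shows "G_fun W T \<omega> \<alpha> \<beta> \<epsilon> u = ennreal (\<integral>t. density u g t \<partial>leb T)"
proof -
  have "boundary_values T u \<alpha> \<beta>" using u bv unfolding boundary_values_def by blast
  hence "G_fun W T \<omega> \<alpha> \<beta> \<epsilon> u = (\<integral>\<^sup>+t. ennreal (density u g t) \<partial>leb T)"
    unfolding density_def by (intro G_fun_eq_nn_integral L2_fun_continuous u g w T_pos)
  also have "\<dots> = ennreal (\<integral>t. density u g t \<partial>leb T)"
    using g by (intro nn_integral_eq_integral integrable_density u AE_I2 density_nonneg)
      (auto simp: L2_fun_def)
  finally show ?thesis .
qed

lemma integral_density_nonneg: "0 \<le> (\<integral>t. density u g t \<partial>leb T)"
  by (rule Bochner_Integration.integral_nonneg_AE, rule AE_I2, rule density_nonneg) auto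

lemma pw_deriv_C1:
  assumes "\<And>t. t \<in> {l..h} \<Longrightarrow> (u has_real_derivative g t) (at t within {l..h})" "continuous_on {l..h} g"
  shows "pw_deriv l h u g"
proof -
  have "bounded (g ` {l..h})" by (intro compact_imp_bounded compact_continuous_image assms compact_Icc)
  hence "bounded (g ` {l<..<h})" by (rule bounded_subset) auto
  moreover have "(u has_real_derivative g t) (at t) \<and> isCont g t" if "t \<in> {l<..<h}" for t
  proof
    show "(u has_real_derivative g t) (at t)"
      using assms(1)[of t] that by (simp add: at_within_Icc_at)
    show "isCont g t"
      using assms(2) that by (simp add: continuous_on_interior)
  qed
  moreover have "continuous_on {l..h} u" using assms(1) by (rule DERIV_continuous_on)
  ultimately show ?thesis unfolding pw_deriv_def by (intro conjI exI[of _ "{}"]) auto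
qed

lemma pw_deriv_integral:
  assumes "continuous_on {0..T} f"
  shows "pw_deriv 0 T (\<lambda>t. integral {0..t} f) f"
  using assms by (intro pw_deriv_C1 integral_has_real_derivative)

section \<open>First variation and regularity of a minimizer\<close>

context
  fixes v \<alpha> \<beta> assumes min: "G_minimizer W T \<omega> \<alpha> \<beta> \<epsilon> v"
begin

lemma minimizer_cont: "continuous_on {0..T} v"
  using min by (simp add: G_minimizer_def)

lemma minimizer_le:
  assumes "continuous_on {0..T} u"
  shows "G_fun W T \<omega> \<alpha> \<beta> \<epsilon> v \<le> G_fun W T \<omega> \<alpha> \<beta> \<epsilon> u"
  using min integrable_lebesgue_on_Ioo[OF assms] unfolding G_minimizer_def is_arg_min_def
  by (auto simp: not_less)

text \<open>The linear interpolation has finite energy, so the minimum is finite and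
  \<open>v\<close> obeys the side conditions built into \<open>G_fun\<close>. Being continuous,
  \<open>v\<close> coincides everywhere with the representative that carries the boundary
  values.\<close>

lemma minimizer_H1: "H1_fun {0<..<T} v" "v 0 = \<alpha>" "v T = \<beta>"
proof -
  define u where "u = (\<lambda>t. \<alpha> + (\<beta> - \<alpha>) * t / T)"
  have u: "pw_deriv 0 T u (\<lambda>_. (\<beta> - \<alpha>) / T)"
    unfolding u_def using T_pos by (intro pw_deriv_C1) (auto intro!: derivative_eq_intros)
  have "G_fun W T \<omega> \<alpha> \<beta> \<epsilon> u < \<infinity>"
    using pw_deriv_weak[OF u T_pos] u T_pos
    by (subst G_fun_eq_integral[of _ "\<lambda>_. (\<beta> - \<alpha>) / T"]) (auto simp: pw_deriv_def u_def)
  moreover have "G_fun W T \<omega> \<alpha> \<beta> \<epsilon> v \<le> G_fun W T \<omega> \<alpha> \<beta> \<epsilon> u"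
    by (rule minimizer_le) (use u in \<open>simp add: pw_deriv_def\<close>)
  ultimately have *: "H1_fun {0<..<T} v \<and> boundary_values T v \<alpha> \<beta>"
    by (auto simp: G_fun_def split: if_splits)
  thus "H1_fun {0<..<T} v" by simp
  from * obtain w where w: "continuous_on {0..T} w" "AE t in leb T. v t = w t" "w 0 = \<alpha>" "w T = \<beta>"
    by (auto simp: boundary_values_def)
  have "v t - w t = 0" if "t \<in> {0..T}" for t
    using w(2) by (intro AE_Ioo_eq_0_imp_eq_0[OF T_pos _ _ that, of "\<lambda>t. v t - w t"] continuous_intros minimizer_cont w) auto
  from this[of 0] this[of T] w show "v 0 = \<alpha>" "v T = \<beta>" using T_pos by auto
qed

lemma minimizer_integral_le:
  assumes "L2_fun {0<..<T} g" "is_weak_deriv {0<..<T} v g"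
    "continuous_on {0..T} u" "L2_fun {0<..<T} h" "is_weak_deriv {0<..<T} u h" "u 0 = \<alpha>" "u T = \<beta>"
  shows "(\<integral>t. density v g t \<partial>leb T) \<le> (\<integral>t. density u h t \<partial>leb T)"
  using minimizer_le[OF assms(3)] G_fun_eq_integral[OF minimizer_cont assms(1,2) minimizer_H1(2,3)]
    G_fun_eq_integral[OF assms(3-7)] integral_density_nonneg[of u h]
  by (simp add: ennreal_le_iff)

text \<open>Along \<open>v + \<tau> \<phi>\<close> the kinetic energy is a quadratic polynomial in
  \<tau>, so only the potential part \<open>A\<close> has to be differentiated under the integral
  sign; the sum is minimal at \<tau> = 0.\<close>

lemma euler_lagrange_weak:
  assumes g: "L2_fun {0<..<T} g" "is_weak_deriv {0<..<T} v g" and \<phi>: "test_fun T \<phi> \<phi>'"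
  shows "2 * \<epsilon>\<^sup>2 * (\<integral>t. g t * \<omega> t * \<phi>' t \<partial>leb T) = - integral {0..T} (\<lambda>t. dW (v t) * \<omega> t * \<phi> t)"
proof -
  let ?M = "leb T"
  define A where "A = (\<lambda>\<tau>. integral {0..T} (\<lambda>t. W (v t + \<tau> * \<phi> t) * \<omega> t))"
  define B where "B = (\<integral>t. (g t)\<^sup>2 * \<omega> t \<partial>?M)"
  define C where "C = (\<integral>t. g t * \<omega> t * \<phi>' t \<partial>?M)"
  define D where "D = (\<integral>t. (\<phi>' t)\<^sup>2 * \<omega> t \<partial>?M)"
  note \<phi>c = test_fun_cont[OF \<phi>]
  have gi: "integrable ?M g" "integrable ?M (\<lambda>t. (g t)\<^sup>2)"
    using integrable_of_L2_fun[OF g(1)] g(1) by (simp_all add: L2_fun_def)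
  have i1: "integrable ?M (\<lambda>t. (g t)\<^sup>2 * \<omega> t)" by (rule integrable_mult_weight[OF gi(2) \<omega>_cont])
  have i2: "integrable ?M (\<lambda>t. g t * \<omega> t * \<phi>' t)"
    using integrable_mult_test_fun(2)[OF integrable_mult_weight[OF gi(1) \<omega>_cont] \<phi>] .
  have i3: "integrable ?M (\<lambda>t. (\<phi>' t)\<^sup>2 * \<omega> t)"
    by (intro integrable_lebesgue_on_Ioo continuous_intros \<phi>c \<omega>_cont)
  have i4: "integrable ?M (\<lambda>t. W (v t + \<tau> * \<phi> t) * \<omega> t)" for \<tau>
    by (intro integrable_lebesgue_on_Ioo continuous_intros \<phi>c \<omega>_cont minimizer_cont)
  have g\<phi>: "integrable ?M (\<lambda>t. g t * \<phi>' t)" by (rule integrable_mult_test_fun(2)[OF gi(1) \<phi>])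
  have weak: "L2_fun {0<..<T} (\<lambda>t. g t + \<tau> * \<phi>' t)" "is_weak_deriv {0<..<T} (\<lambda>t. v t + \<tau> * \<phi> t) (\<lambda>t. g t + \<tau> * \<phi>' t)" for \<tau>
  proof -
    have "integrable ?M (\<lambda>t. (g t)\<^sup>2 + (2 * \<tau> * (g t * \<phi>' t) + \<tau>\<^sup>2 * (\<phi>' t)\<^sup>2))"
      using gi(2) g\<phi> by (intro Bochner_Integration.integrable_add integrable_mult_right
          integrable_lebesgue_on_Ioo[of 0 T "\<lambda>t. (\<phi>' t)\<^sup>2"]) (auto intro!: continuous_intros \<phi>c)
    moreover have "(\<lambda>t. (g t)\<^sup>2 + (2 * \<tau> * (g t * \<phi>' t) + \<tau>\<^sup>2 * (\<phi>' t)\<^sup>2)) = (\<lambda>t. (g t + \<tau> * \<phi>' t)\<^sup>2)"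
      by (auto simp: power2_eq_square algebra_simps)
    ultimately show "L2_fun {0<..<T} (\<lambda>t. g t + \<tau> * \<phi>' t)"
      using borel_measurable_integrable[OF gi(1)]
        borel_measurable_integrable[OF integrable_lebesgue_on_Ioo[OF \<phi>c(2)]] unfolding L2_fun_def by auto
    have w\<phi>: "is_weak_deriv {0<..<T} \<phi> \<phi>'"
      using pw_deriv_weak(3)[OF pw_deriv_C1 T_pos, of \<phi> \<phi>'] \<phi> \<phi>c
      by (auto simp: test_fun_def intro: has_field_derivative_at_within)
    show "is_weak_deriv {0<..<T} (\<lambda>t. v t + \<tau> * \<phi> t) (\<lambda>t. g t + \<tau> * \<phi>' t)"
      unfolding is_weak_deriv_iff_test_fun
    proof (intro allI impI)
      fix \<psi> \<psi>' assume \<psi>: "test_fun T \<psi> \<psi>'"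
      have int: "integrable ?M (\<lambda>t. v t * \<psi>' t)" "integrable ?M (\<lambda>t. \<phi> t * \<psi>' t)"
        "integrable ?M (\<lambda>t. g t * \<psi> t)" "integrable ?M (\<lambda>t. \<phi>' t * \<psi> t)"
        using integrable_mult_test_fun[OF _ \<psi>] gi integrable_lebesgue_on_Ioo[OF minimizer_cont]
          integrable_lebesgue_on_Ioo[OF \<phi>c(1)] integrable_lebesgue_on_Ioo[OF \<phi>c(2)] by auto
      have "(\<integral>t. (v t + \<tau> * \<phi> t) * \<psi>' t \<partial>?M) = (\<integral>t. v t * \<psi>' t \<partial>?M) + \<tau> * (\<integral>t. \<phi> t * \<psi>' t \<partial>?M)"
        using int by (simp add: distrib_right mult.assoc)
      also have "\<dots> = - (\<integral>t. g t * \<psi> t \<partial>?M) - \<tau> * (\<integral>t. \<phi>' t * \<psi> t \<partial>?M)"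
        using g(2) w\<phi> \<psi> by (simp add: is_weak_deriv_iff_test_fun)
      also have "\<dots> = - (\<integral>t. (g t + \<tau> * \<phi>' t) * \<psi> t \<partial>?M)"
        using int by (simp add: distrib_right mult.assoc)
      finally show "(\<integral>t. (v t + \<tau> * \<phi> t) * \<psi>' t \<partial>?M) = - (\<integral>t. (g t + \<tau> * \<phi>' t) * \<psi> t \<partial>?M)" .
    qed
  qed
  have dens: "(\<integral>t. density (\<lambda>t. v t + \<tau> * \<phi> t) (\<lambda>t. g t + \<tau> * \<phi>' t) t \<partial>?M)
      = A \<tau> + \<epsilon>\<^sup>2 * (B + 2 * \<tau> * C + \<tau>\<^sup>2 * D)" for \<tau>
  proof -
    have "(\<lambda>t. density (\<lambda>t. v t + \<tau> * \<phi> t) (\<lambda>t. g t + \<tau> * \<phi>' t) t) =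
      (\<lambda>t. W (v t + \<tau> * \<phi> t) * \<omega> t + \<epsilon>\<^sup>2 * ((g t)\<^sup>2 * \<omega> t + (2 * \<tau>) * (g t * \<omega> t * \<phi>' t) + \<tau>\<^sup>2 * ((\<phi>' t)\<^sup>2 * \<omega> t)))"
      by (auto simp: density_def power2_eq_square algebra_simps)
    thus ?thesis
      using i1 i2 i3 i4[of \<tau>] lebesgue_integral_Ioo_eq_integral[OF i4[of \<tau>]]
      by (simp add: A_def B_def C_def D_def)
  qed
  have A': "(A has_real_derivative integral {0..T} (\<lambda>t. dW (v t) * \<omega> t * \<phi> t)) (at 0)"
  proof -
    have "((\<lambda>\<tau>. integral (cbox 0 T) (\<lambda>t. W (v t + \<tau> * \<phi> t) * \<omega> t)) has_field_derivative
      integral (cbox 0 T) (\<lambda>t. dW (v t + 0 * \<phi> t) * \<phi> t * \<omega> t)) (at 0 within UNIV)"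
    proof (rule leibniz_rule_field_derivative)
      show "((\<lambda>\<tau>. W (v t + \<tau> * \<phi> t) * \<omega> t) has_real_derivative dW (v t + \<tau> * \<phi> t) * \<phi> t * \<omega> t) (at \<tau> within UNIV)" for \<tau> t
      proof -
        have "((\<lambda>\<tau>. W (v t + \<tau> * \<phi> t)) has_real_derivative dW (v t + \<tau> * \<phi> t) * \<phi> t) (at \<tau>)"
          by (rule DERIV_chain2[OF W_deriv]) (auto intro!: derivative_eq_intros)
        thus ?thesis by (auto intro!: derivative_eq_intros)
      qed
      show "(\<lambda>t. W (v t + \<tau> * \<phi> t) * \<omega> t) integrable_on cbox 0 T" for \<tau>
        unfolding cbox_interval by (intro integrable_continuous_real continuous_intros \<phi>c \<omega>_cont minimizer_cont)
      have c: "continuous_on (UNIV \<times> cbox 0 T) (\<lambda>x. v (snd x))" "continuous_on (UNIV \<times> cbox 0 T) (\<lambda>x. \<phi> (snd x))"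
        "continuous_on (UNIV \<times> cbox 0 T) (\<lambda>x. \<omega> (snd x))"
        by (rule continuous_on_compose2[OF minimizer_cont] continuous_on_compose2[OF \<omega>_cont] continuous_on_compose2[OF \<phi>c(1)[of UNIV]];
            auto intro!: continuous_intros)+
      show "continuous_on (UNIV \<times> cbox 0 T) (\<lambda>(\<tau>, t). dW (v t + \<tau> * \<phi> t) * \<phi> t * \<omega> t)"
        unfolding case_prod_unfold by (intro continuous_intros c)
    qed auto
    moreover have "(\<lambda>t. dW (v t + 0 * \<phi> t) * \<phi> t * \<omega> t) = (\<lambda>t. dW (v t) * \<omega> t * \<phi> t)" by auto
    ultimately show ?thesis by (simp add: A_def)
  qed
  have "((\<lambda>\<tau>. A \<tau> + \<epsilon>\<^sup>2 * (B + 2 * \<tau> * C + \<tau>\<^sup>2 * D)) has_real_derivative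
      integral {0..T} (\<lambda>t. dW (v t) * \<omega> t * \<phi> t) + \<epsilon>\<^sup>2 * (2 * C)) (at 0)"
    by (auto intro!: derivative_eq_intros A')
  moreover have "A 0 + \<epsilon>\<^sup>2 * (B + 2 * 0 * C + 0\<^sup>2 * D) \<le> A \<tau> + \<epsilon>\<^sup>2 * (B + 2 * \<tau> * C + \<tau>\<^sup>2 * D)" for \<tau>
  proof -
    have "(\<integral>t. density v g t \<partial>?M) \<le> (\<integral>t. density (\<lambda>t. v t + \<tau> * \<phi> t) (\<lambda>t. g t + \<tau> * \<phi>' t) t \<partial>?M)"
      using test_fun_zero[OF \<phi>] minimizer_H1 weak
      by (intro minimizer_integral_le[OF g]) (auto intro!: continuous_intros minimizer_cont \<phi>c)
    thus ?thesis using dens[of 0] dens[of \<tau>] by simp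
  qed
  ultimately have "integral {0..T} (\<lambda>t. dW (v t) * \<omega> t * \<phi> t) + \<epsilon>\<^sup>2 * (2 * C) = 0"
    by (intro DERIV_local_min[where x = 0 and d = 1]) auto
  thus ?thesis by (simp add: C_def)
qed

text \<open>The du Bois-Reymond lemma is used twice: on the momentum minus a primitive of the force,
  which identifies the weak derivative with a continuous \<open>v'\<close>, and on \<open>v\<close>
  minus a primitive of \<open>v'\<close>, which makes \<open>v'\<close> the classical derivative.
  The last conclusion restates minimality for piecewise C1 competitors with gauge integrals, the
  form in which it is used afterwards.\<close>

theorem minimizer_regular:
  obtains v' where "\<And>t. t \<in> {0..T} \<Longrightarrow> (v has_real_derivative v' t) (at t within {0..T})"
    "continuous_on {0..T} v'"
    "\<And>t. t \<in> {0..T} \<Longrightarrow> ((\<lambda>t. \<omega> t * v' t) has_real_derivative dW (v t) * \<omega> t / (2 * \<epsilon>\<^sup>2)) (at t within {0..T})"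
    "v 0 = \<alpha>" "v T = \<beta>"
    "\<And>u g. pw_deriv 0 T u g \<Longrightarrow> u 0 = \<alpha> \<Longrightarrow> u T = \<beta> \<Longrightarrow>
       integral {0..T} (density v v') \<le> integral {0..T} (density u g)"
proof -
  let ?M = "leb T"
  define g where "g = weak_deriv {0<..<T} v"
  have g: "L2_fun {0<..<T} g" "is_weak_deriv {0<..<T} v g"
    using weak_deriv_spec[OF minimizer_H1(1)] by (auto simp: g_def)
  have gi: "integrable ?M g" by (rule integrable_of_L2_fun[OF g(1)])
  define f where "f = (\<lambda>t. dW (v t) * \<omega> t)"
  have f: "continuous_on {0..T} f" unfolding f_def by (intro continuous_intros minimizer_cont \<omega>_cont)
  define P where "P = (\<lambda>t. integral {0..t} f)"
  have P: "pw_deriv 0 T P f" unfolding P_def by (rule pw_deriv_integral[OF f])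
  have Pc: "continuous_on {0..T} P" using P by (simp add: pw_deriv_def)
  have i: "integrable ?M (\<lambda>t. 2 * \<epsilon>\<^sup>2 * (g t * \<omega> t))"
    using integrable_mult_weight[OF gi \<omega>_cont] by simp
  have "\<exists>c. AE t in ?M. 2 * \<epsilon>\<^sup>2 * (g t * \<omega> t) - P t = c"
  proof (rule du_bois_reymond[OF _ T_pos])
    show "integrable ?M (\<lambda>t. 2 * \<epsilon>\<^sup>2 * (g t * \<omega> t) - P t)"
      using i integrable_lebesgue_on_Ioo[OF Pc] by simp
    fix \<phi> \<phi>' assume \<phi>: "test_fun T \<phi> \<phi>'"
    have "(\<integral>t. P t * \<phi>' t \<partial>?M) = - (\<integral>t. f t * \<phi> t \<partial>?M)"
      using pw_deriv_weak(3)[OF P T_pos] \<phi> by (simp add: is_weak_deriv_iff_test_fun)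
    also have "(\<integral>t. f t * \<phi> t \<partial>?M) = integral {0..T} (\<lambda>t. f t * \<phi> t)"
      by (intro lebesgue_integral_Ioo_eq_integral integrable_lebesgue_on_Ioo continuous_intros f test_fun_cont[OF \<phi>])
    finally have "(\<integral>t. P t * \<phi>' t \<partial>?M) = 2 * \<epsilon>\<^sup>2 * (\<integral>t. g t * \<omega> t * \<phi>' t \<partial>?M)"
      using euler_lagrange_weak[OF g \<phi>] by (simp add: f_def)
    also have "\<dots> = (\<integral>t. 2 * \<epsilon>\<^sup>2 * (g t * \<omega> t) * \<phi>' t \<partial>?M)"
      by (simp add: mult.assoc)
    finally show "(\<integral>t. (2 * \<epsilon>\<^sup>2 * (g t * \<omega> t) - P t) * \<phi>' t \<partial>?M) = 0"
      using integrable_mult_test_fun(2)[OF i \<phi>] integrable_mult_test_fun(2)[OF integrable_lebesgue_on_Ioo[OF Pc] \<phi>]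
      by (simp add: left_diff_distrib)
  qed
  then obtain c where c: "AE t in ?M. 2 * \<epsilon>\<^sup>2 * (g t * \<omega> t) - P t = c" by blast
  define v' where "v' = (\<lambda>t. (c + P t) / (2 * \<epsilon>\<^sup>2) / \<omega> t)"
  have \<omega>0: "\<omega> t \<noteq> 0" if "t \<in> {0..T}" for t using \<omega>_pos[OF that] by simp
  have v'c: "continuous_on {0..T} v'"
    unfolding v'_def using \<omega>0 \<epsilon>_pos by (intro continuous_intros Pc \<omega>_cont) auto
  have ae: "AE t in ?M. g t = v' t"
    using c
  proof (rule AE_mp, intro AE_I2 impI)
    fix t assume "t \<in> space ?M" "2 * \<epsilon>\<^sup>2 * (g t * \<omega> t) - P t = c"
    thus "g t = v' t" using \<omega>0[of t] \<epsilon>_pos by (simp add: v'_def field_simps)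
  qed
  define Q where "Q = (\<lambda>t. integral {0..t} v')"
  have Q': "(Q has_real_derivative v' t) (at t within {0..T})" if "t \<in> {0..T}" for t
    unfolding Q_def by (rule integral_has_real_derivative[OF v'c that])
  have Q: "pw_deriv 0 T Q v'" unfolding Q_def by (rule pw_deriv_integral[OF v'c])
  have Qc: "continuous_on {0..T} Q" using Q by (simp add: pw_deriv_def)
  have "\<exists>k. AE t in ?M. v t - Q t = k"
  proof (rule du_bois_reymond[OF _ T_pos])
    show "integrable ?M (\<lambda>t. v t - Q t)"
      by (intro integrable_lebesgue_on_Ioo continuous_intros minimizer_cont Qc)
    fix \<phi> \<phi>' assume \<phi>: "test_fun T \<phi> \<phi>'"
    have "(\<integral>t. Q t * \<phi>' t \<partial>?M) = - (\<integral>t. v' t * \<phi> t \<partial>?M)"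
      using pw_deriv_weak(3)[OF Q T_pos] \<phi> by (simp add: is_weak_deriv_iff_test_fun)
    also have "(\<integral>t. v' t * \<phi> t \<partial>?M) = (\<integral>t. g t * \<phi> t \<partial>?M)"
      using integrable_mult_test_fun(1)[OF integrable_lebesgue_on_Ioo[OF v'c] \<phi>]
        integrable_mult_test_fun(1)[OF gi \<phi>] ae
      by (intro integral_cong_AE) auto
    also have "- \<dots> = (\<integral>t. v t * \<phi>' t \<partial>?M)"
      using g(2) \<phi> by (simp add: is_weak_deriv_iff_test_fun)
    finally show "(\<integral>t. (v t - Q t) * \<phi>' t \<partial>?M) = 0"
      using integrable_mult_test_fun(2)[OF integrable_lebesgue_on_Ioo[OF minimizer_cont] \<phi>]
        integrable_mult_test_fun(2)[OF integrable_lebesgue_on_Ioo[OF Qc] \<phi>]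
      by (simp add: left_diff_distrib)
  qed
  then obtain k where k: "AE t in ?M. v t - Q t = k" by blast
  have vQ: "v t = Q t + k" if "t \<in> {0..T}" for t
  proof -
    have "v t - Q t - k = 0"
      by (rule AE_Ioo_eq_0_imp_eq_0[OF T_pos _ _ that, of "\<lambda>t. v t - Q t - k"])
         (use k in \<open>auto intro!: continuous_intros minimizer_cont Qc\<close>)
    thus ?thesis by simp
  qed
  have vd: "(v has_real_derivative v' t) (at t within {0..T})" if "t \<in> {0..T}" for t
  proof -
    have "((\<lambda>t. Q t + k) has_real_derivative v' t) (at t within {0..T})"
      using Q'[OF that] by (auto intro!: derivative_eq_intros)
    thus ?thesis
      by (rule has_field_derivative_transform_within[OF _ zero_less_one that]) (use vQ in auto)
  qed
  show ?thesis
  proof (rule that)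
    show "(v has_real_derivative v' t) (at t within {0..T})" if "t \<in> {0..T}" for t using vd[OF that] .
    show "continuous_on {0..T} v'" by (rule v'c)
    show "v 0 = \<alpha>" "v T = \<beta>" by (rule minimizer_H1)+
    show "((\<lambda>t. \<omega> t * v' t) has_real_derivative dW (v t) * \<omega> t / (2 * \<epsilon>\<^sup>2)) (at t within {0..T})" if t: "t \<in> {0..T}" for t
    proof -
      have "(P has_real_derivative f t) (at t within {0..T})"
        unfolding P_def by (rule integral_has_real_derivative[OF f t])
      hence "((\<lambda>t. (c + P t) / (2 * \<epsilon>\<^sup>2)) has_real_derivative dW (v t) * \<omega> t / (2 * \<epsilon>\<^sup>2)) (at t within {0..T})"
        using DERIV_cdivide[OF DERIV_add[OF DERIV_const[of c]]] by (fastforce simp: f_def)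
      thus ?thesis
        by (rule has_field_derivative_transform_within[OF _ zero_less_one t]) (use \<omega>0 in \<open>auto simp: v'_def\<close>)
    qed
    show "integral {0..T} (density v v') \<le> integral {0..T} (density u h)"
      if u: "pw_deriv 0 T u h" and bv: "u 0 = \<alpha>" "u T = \<beta>" for u h
    proof -
      have v': "pw_deriv 0 T v v'" by (rule pw_deriv_C1[OF vd v'c])
      have "(\<integral>t. density v v' t \<partial>?M) \<le> (\<integral>t. density u h t \<partial>?M)"
        using pw_deriv_weak[OF v' T_pos] pw_deriv_weak[OF u T_pos] bv u
        by (intro minimizer_integral_le) (auto simp: pw_deriv_def)
      moreover have "(\<integral>t. density w k t \<partial>?M) = integral {0..T} (density w k)"
        if "pw_deriv 0 T w k" for w k
        using that pw_deriv_bounded_integrable(1)[OF that]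
        by (intro lebesgue_integral_Ioo_eq_integral integrable_density) (simp_all add: pw_deriv_def)
      ultimately show ?thesis using u v' by simp
    qed
  qed
qed

end
end

section \<open>The potential near its wells\<close>

lemma MVT_real_derivative:
  fixes f f' :: "real \<Rightarrow> real"
  assumes "x < y" "continuous_on {x..y} f"
    and f': "\<And>z. x < z \<Longrightarrow> z < y \<Longrightarrow> (f has_real_derivative f' z) (at z)"
  obtains z where "x < z" "z < y" "f y - f x = (y - x) * f' z"
proof (rule mvt[OF assms(1,2), of "\<lambda>z h. f' z * h"])
  show "(f has_derivative (*) (f' z)) (at z)" if "x < z" "z < y" for z
    using f'[OF that] by (simp add: has_field_derivative_def)
qed (use that in \<open>auto simp: mult.commute\<close>)

text \<open>As \<open>V'\<close> is nondecreasing, its value at \<open>h\<close> lies between the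
  mean slopes on [0, h] and on [h, 2h]. Power bounds on a convex function thus pass to its
  derivative without integrating the second derivative.\<close>

lemma convex_deriv_bounds:
  fixes V V' V'' :: "real \<Rightarrow> real"
  assumes cont: "continuous_on {0..<r} V" and V0: "V 0 = 0" and nonneg: "\<And>h. 0 \<le> V h"
    and V': "\<And>h. 0 < h \<Longrightarrow> h < r \<Longrightarrow> (V has_real_derivative V' h) (at h)"
    and V'': "\<And>h. 0 < h \<Longrightarrow> h < r \<Longrightarrow> (V' has_real_derivative V'' h) (at h)"
    and pos: "\<And>h. 0 < h \<Longrightarrow> h < r \<Longrightarrow> 0 < V'' h"
    and h: "0 < h" "2 * h < r"
  shows "V h \<le> h * V' h" "h * V' h \<le> V (2 * h)"
proof -
  have mono: "V' x \<le> V' y" if "0 < x" "x \<le> y" "y < r" for x y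
  proof (rule DERIV_nonneg_imp_nondecreasing[OF that(2)])
    fix z assume "x \<le> z" "z \<le> y"
    hence "0 < z" "z < r" using that by auto
    thus "\<exists>d. (V' has_real_derivative d) (at z) \<and> 0 \<le> d" using V'' pos less_imp_le by blast
  qed
  obtain z where z: "0 < z" "z < h" "V h - V 0 = (h - 0) * V' z"
    by (rule MVT_real_derivative[of 0 h V V'])
       (use h V' in \<open>auto intro: continuous_on_subset[OF cont]\<close>)
  have "h * V' z \<le> h * V' h" using mono[of z h] z h by (intro mult_left_mono) auto
  thus "V h \<le> h * V' h" using z V0 by simp
  obtain z where z: "h < z" "z < 2 * h" "V (2 * h) - V h = (2 * h - h) * V' z"
    by (rule MVT_real_derivative[of h "2 * h" V V'])
       (use h V' in \<open>auto intro: continuous_on_subset[OF cont]\<close>)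
  have "h * V' h \<le> h * V' z" using mono[of h z] z h by (intro mult_left_mono) auto
  moreover have "V (2 * h) - V h = h * V' z" using z(3) by simp
  ultimately show "h * V' h \<le> V (2 * h)" using nonneg[of h] by linarith
qed

lemma integrable_powr_dist:
  fixes x y :: real
  assumes "x \<le> y" "0 < e"
  shows "(\<lambda>s. (s - x) powr (e - 1)) integrable_on {x..y}" "(\<lambda>s. (y - s) powr (e - 1)) integrable_on {x..y}"
proof -
  have "((\<lambda>s. (s - x) powr (e - 1)) has_integral ((y - x) powr e / e - (x - x) powr e / e)) {x..y}"
  proof (rule fundamental_theorem_of_calculus_interior[OF assms(1)])
    show "continuous_on {x..y} (\<lambda>s. (s - x) powr e / e)"
      using assms by (intro continuous_intros continuous_on_powr') auto
    show "((\<lambda>s. (s - x) powr e / e) has_vector_derivative (s - x) powr (e - 1)) (at s)" if "s \<in> {x<..<y}" for s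
      using that assms unfolding has_real_derivative_iff_has_vector_derivative[symmetric]
      by (auto intro!: derivative_eq_intros)
  qed
  thus "(\<lambda>s. (s - x) powr (e - 1)) integrable_on {x..y}" by blast
  have "((\<lambda>s. (y - s) powr (e - 1)) has_integral (- ((y - y) powr e / e) - (- ((y - x) powr e / e)))) {x..y}"
  proof (rule fundamental_theorem_of_calculus_interior[OF assms(1)])
    show "continuous_on {x..y} (\<lambda>s. - ((y - s) powr e / e))"
      using assms by (intro continuous_intros continuous_on_powr') auto
    show "((\<lambda>s. - ((y - s) powr e / e)) has_vector_derivative (y - s) powr (e - 1)) (at s)" if "s \<in> {x<..<y}" for s
      using that assms unfolding has_real_derivative_iff_has_vector_derivative[symmetric]
      by (auto intro!: derivative_eq_intros)
  qed
  thus "(\<lambda>s. (y - s) powr (e - 1)) integrable_on {x..y}" by blast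
qed

section \<open>C1 regularity of the potential and the travel time integral\<close>

context double_well
begin

lemma W_a_b [simp]: "W a = 0" "W b = 0"
  using W_zeros by auto

lemma W_pos: "x \<notin> {a, b} \<Longrightarrow> 0 < W x"
  using W_zeros W_nonneg[of x] by (metis less_le vimage_singleton_eq)

lemma deriv_W_away:
  assumes "x \<notin> {a, b}"
  shows "(W has_real_derivative deriv W x) (at x)" "(deriv W has_real_derivative deriv (deriv W) x) (at x)"
  using W_C2(1,2)[OF assms] by (auto simp: DERIV_deriv_iff_real_differentiable)

text \<open>The positive limit makes the second derivative positive near \<open>p\<close>, so
  \<open>W\<close> is convex on either side of the well and \<open>convex_deriv_bounds\<close>
  carries its growth over to \<open>deriv W\<close>. The sign \<sigma> treats both sides at once; a
  radius of at most \<open>b - a\<close> keeps the other well away.\<close>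

lemma W_near_well:
  assumes p: "p \<in> {a, b}"
  obtains r c c' where "0 < r" "0 < c" "0 < c'" "r \<le> b - a"
    "\<And>x. 0 < \<bar>x - p\<bar> \<Longrightarrow> \<bar>x - p\<bar> < r \<Longrightarrow> c * \<bar>x - p\<bar> powr (1 + q) \<le> W x \<and> W x \<le> c' * \<bar>x - p\<bar> powr (1 + q)"
    "\<And>x. 0 < \<bar>x - p\<bar> \<Longrightarrow> \<bar>x - p\<bar> < r \<Longrightarrow> c * \<bar>x - p\<bar> powr q \<le> sgn (x - p) * deriv W x \<and>
        sgn (x - p) * deriv W x \<le> c' * \<bar>x - p\<bar> powr q"
proof -
  obtain l where l: "0 < l" "((\<lambda>s. deriv (deriv W) s * \<bar>s - p\<bar> powr (1 - q)) \<longlongrightarrow> l) (at p)"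
    using W_deriv2_lim[OF p] by blast
  obtain c c' where c: "0 < c" "0 < c'"
    "\<forall>\<^sub>F x in at p. c * \<bar>x - p\<bar> powr (1 + q) \<le> W x \<and> W x \<le> c' * \<bar>x - p\<bar> powr (1 + q)"
    using W_growth[OF p] by blast
  have "\<forall>\<^sub>F x in at p. 0 < deriv (deriv W) x * \<bar>x - p\<bar> powr (1 - q)"
    using order_tendstoD(1)[OF l(2) l(1)] .
  with c(3) have "\<forall>\<^sub>F x in at p. (c * \<bar>x - p\<bar> powr (1 + q) \<le> W x \<and> W x \<le> c' * \<bar>x - p\<bar> powr (1 + q))
      \<and> 0 < deriv (deriv W) x * \<bar>x - p\<bar> powr (1 - q)"
    by (rule eventually_conj)
  then obtain d where d: "0 < d" "\<And>x. x \<noteq> p \<Longrightarrow> dist x p < d \<Longrightarrow>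
      (c * \<bar>x - p\<bar> powr (1 + q) \<le> W x \<and> W x \<le> c' * \<bar>x - p\<bar> powr (1 + q))
      \<and> 0 < deriv (deriv W) x * \<bar>x - p\<bar> powr (1 - q)"
    unfolding eventually_at by (auto simp: dist_commute)
  define R where "R = min d (b - a)"
  have R: "0 < R" "R \<le> b - a" using d a_less_b by (auto simp: R_def)
  have bnd: "c * \<bar>x - p\<bar> powr (1 + q) \<le> W x" "W x \<le> c' * \<bar>x - p\<bar> powr (1 + q)" "0 < deriv (deriv W) x"
    if "0 < \<bar>x - p\<bar>" "\<bar>x - p\<bar> < R" for x
    using d(2)[of x] that by (auto simp: R_def dist_real_def zero_less_mult_iff)
  have notin: "x \<notin> {a, b}" if "0 < \<bar>x - p\<bar>" "\<bar>x - p\<bar> < R" for x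
    using that p R by auto
  have Wc: "continuous_on S (\<lambda>h. W (f h))" if "continuous_on S f" for S f
    using continuous_on_compose2[OF W_cont that] by auto
  have D: "V h \<le> h * V' h" "h * V' h \<le> V (2 * h)"
    if V: "V = (\<lambda>h. W (p + \<sigma> * h))" "V' = (\<lambda>h. \<sigma> * deriv W (p + \<sigma> * h))" and \<sigma>: "\<sigma> \<in> {1, -1}" and h: "0 < h" "2 * h < R"
    for h \<sigma> V V'
  proof -
    have abs: "\<bar>p + \<sigma> * h - p\<bar> = h" if "0 < h" for h using that \<sigma> by auto
    have ni: "p + \<sigma> * h \<notin> {a, b}" if "0 < h" "h < R" for h
      by (rule notin) (use abs[OF that(1)] that in auto)
    have V1: "(V has_real_derivative V' h) (at h)" if "0 < h" "h < R" for h
    proof -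
      have "((\<lambda>h. W (p + \<sigma> * h)) has_real_derivative deriv W (p + \<sigma> * h) * \<sigma>) (at h)"
        by (rule DERIV_chain2[where f = W and g = "\<lambda>h. p + \<sigma> * h", OF deriv_W_away(1)[OF ni[OF that]]]) (auto intro!: derivative_eq_intros)
      thus ?thesis by (simp add: V mult.commute)
    qed
    have V2: "(V' has_real_derivative \<sigma> * (deriv (deriv W) (p + \<sigma> * h) * \<sigma>)) (at h)" if "0 < h" "h < R" for h
    proof -
      have "((\<lambda>h. deriv W (p + \<sigma> * h)) has_real_derivative deriv (deriv W) (p + \<sigma> * h) * \<sigma>) (at h)"
        by (rule DERIV_chain2[where f = "deriv W" and g = "\<lambda>h. p + \<sigma> * h", OF deriv_W_away(2)[OF ni[OF that]]]) (auto intro!: derivative_eq_intros)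
      thus ?thesis unfolding V by (rule DERIV_cmult)
    qed
    have V3: "0 < \<sigma> * (deriv (deriv W) (p + \<sigma> * h) * \<sigma>)" if "0 < h" "h < R" for h
      using bnd(3)[of "p + \<sigma> * h"] abs[OF that(1)] that \<sigma> by auto
    have V4: "continuous_on {0..<R} V" unfolding V by (intro Wc continuous_intros)
    have V5: "V 0 = 0" using p by (auto simp: V)
    show "V h \<le> h * V' h" "h * V' h \<le> V (2 * h)"
      by (rule convex_deriv_bounds[OF V4 V5 _ V1 V2 V3 h]; simp add: V W_nonneg)+
  qed
  show ?thesis
  \<comment> \<open>Half the radius, because the upper bound on the derivative evaluates
    \<open>W\<close> at distance 2h from the well; this is also the source of the factor
    \<open>2 powr (1 + q)\<close>.\<close>
  proof (rule that[of "R / 2" "min c 1" "c' * 2 powr (1 + q)"])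
    have "1 \<le> (2::real) powr (1 + q)" using q_range by (simp add: ge_one_powr_ge_zero)
    hence c'': "c' \<le> c' * 2 powr (1 + q)" using c by simp
    show "0 < R / 2" "0 < min c 1" "0 < c' * 2 powr (1 + q)" "R / 2 \<le> b - a" using R c by auto
    fix x assume x: "0 < \<bar>x - p\<bar>" "\<bar>x - p\<bar> < R / 2"
    define h where "h = \<bar>x - p\<bar>"
    define \<sigma> where "\<sigma> = sgn (x - p)"
    have \<sigma>: "\<sigma> \<in> {1, -1}" "x = p + \<sigma> * h" using x by (auto simp: \<sigma>_def h_def sgn_if)
    have h: "0 < h" "2 * h < R" using x by (auto simp: h_def)
    have p1: "h powr (1 + q) = h * h powr q" using h by (simp add: powr_add)
    have b1: "c * h powr (1 + q) \<le> W x" "W x \<le> c' * h powr (1 + q)" using bnd[of x] x by (auto simp: h_def)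
    have b2: "min c 1 * y \<le> c * y" "c' * y \<le> c' * 2 powr (1 + q) * y" if "0 \<le> y" for y
      using that mult_right_mono[OF _ that, of "min c 1" c] mult_right_mono[OF c'' that] by auto
    show "min c 1 * \<bar>x - p\<bar> powr (1 + q) \<le> W x \<and> W x \<le> c' * 2 powr (1 + q) * \<bar>x - p\<bar> powr (1 + q)"
      using b1 b2[of "h powr (1 + q)"] unfolding h_def[symmetric] by auto
    have "W x \<le> h * (\<sigma> * deriv W x)"
      using D(1)[OF refl refl \<sigma>(1) h] \<sigma>(2) by simp
    with b1(1) have "h * (c * h powr q) \<le> h * (\<sigma> * deriv W x)" by (simp add: p1 mult.left_commute)
    hence l: "c * h powr q \<le> \<sigma> * deriv W x" using h by simp
    have "h * (\<sigma> * deriv W x) \<le> W (p + \<sigma> * (2 * h))"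
      using D(2)[OF refl refl \<sigma>(1) h] \<sigma>(2) by simp
    also have "\<dots> \<le> c' * \<bar>p + \<sigma> * (2 * h) - p\<bar> powr (1 + q)"
      by (rule bnd(2)) (use \<sigma> h in auto)
    also have "\<bar>p + \<sigma> * (2 * h) - p\<bar> = 2 * h" using \<sigma> h by auto
    also have "c' * (2 * h) powr (1 + q) = h * (c' * 2 powr (1 + q) * h powr q)"
      using h by (simp add: powr_mult p1)
    finally have u: "\<sigma> * deriv W x \<le> c' * 2 powr (1 + q) * h powr q" using h by simp
    show "min c 1 * \<bar>x - p\<bar> powr q \<le> sgn (x - p) * deriv W x \<and> sgn (x - p) * deriv W x \<le> c' * 2 powr (1 + q) * \<bar>x - p\<bar> powr q"
      using l u b2(1)[of "h powr q"] unfolding h_def[symmetric] \<sigma>_def[symmetric] by auto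
  qed
qed

lemma tendsto_abs_powr_0: "((\<lambda>x::real. c * \<bar>x - p\<bar> powr q) \<longlongrightarrow> 0) (at p)"
proof -
  have "((\<lambda>x. c * \<bar>x - p\<bar> powr q) \<longlongrightarrow> c * \<bar>p - p\<bar> powr q) (at p)"
    using q_range by (intro tendsto_intros tendsto_powr') auto
  thus ?thesis using q_range by simp
qed

text \<open>The C2 hypothesis stops short of the wells. Growth with exponent 1 + q > 1 gives
  derivative zero there, and the bound of \<open>deriv W\<close> by the power q gives continuity, so
  \<open>W\<close> is C1 on the whole line.\<close>

lemma W_deriv_well:
  assumes p: "p \<in> {a, b}"
  shows "(W has_real_derivative 0) (at p)" "isCont (deriv W) p"
proof -
  obtain r c c' where r: "0 < r" "0 < c" "0 < c'" "r \<le> b - a"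
    "\<And>x. 0 < \<bar>x - p\<bar> \<Longrightarrow> \<bar>x - p\<bar> < r \<Longrightarrow> c * \<bar>x - p\<bar> powr (1 + q) \<le> W x \<and> W x \<le> c' * \<bar>x - p\<bar> powr (1 + q)"
    "\<And>x. 0 < \<bar>x - p\<bar> \<Longrightarrow> \<bar>x - p\<bar> < r \<Longrightarrow> c * \<bar>x - p\<bar> powr q \<le> sgn (x - p) * deriv W x \<and>
        sgn (x - p) * deriv W x \<le> c' * \<bar>x - p\<bar> powr q"
    using W_near_well[OF p] by metis
  have ev: "\<forall>\<^sub>F x in at p. 0 < \<bar>x - p\<bar> \<and> \<bar>x - p\<bar> < r"
    unfolding eventually_at using r(1) by (auto simp: dist_real_def)
  have "((\<lambda>x. (W x - W p) / (x - p)) \<longlongrightarrow> 0) (at p)"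
  proof (rule Lim_null_comparison[OF _ tendsto_abs_powr_0[of c' p]])
    show "\<forall>\<^sub>F x in at p. norm ((W x - W p) / (x - p)) \<le> c' * \<bar>x - p\<bar> powr q"
      using ev
    proof eventually_elim
      case (elim x)
      have "W p = 0" using p by auto
      hence "norm ((W x - W p) / (x - p)) = W x / \<bar>x - p\<bar>" using W_nonneg[of x] by simp
      also have "\<dots> \<le> c' * \<bar>x - p\<bar> powr (1 + q) / \<bar>x - p\<bar>"
        using r(5)[of x] elim by (intro divide_right_mono) auto
      also have "\<dots> = c' * \<bar>x - p\<bar> powr q" using elim by (simp add: powr_add)
      finally show ?case .
    qed
  qed
  thus *: "(W has_real_derivative 0) (at p)" by (simp add: has_field_derivative_iff)
  have "(deriv W \<longlongrightarrow> 0) (at p)"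
  proof (rule Lim_null_comparison[OF _ tendsto_abs_powr_0[of c' p]])
    show "\<forall>\<^sub>F x in at p. norm (deriv W x) \<le> c' * \<bar>x - p\<bar> powr q"
      using ev
    proof eventually_elim
      case (elim x)
      have "0 \<le> c * \<bar>x - p\<bar> powr q" using r by simp
      hence "norm (deriv W x) = sgn (x - p) * deriv W x" using r(6)[of x] elim by (auto simp: sgn_if split: if_splits)
      thus ?case using r(6)[of x] elim by simp
    qed
  qed
  moreover have "deriv W p = 0" using * by (rule DERIV_imp_deriv)
  ultimately show "isCont (deriv W) p" by (simp add: isCont_def)
qed

lemma W_has_deriv: "(W has_real_derivative deriv W x) (at x)"
  using deriv_W_away(1)[of x] W_deriv_well(1)[of x] DERIV_imp_deriv[of W 0 x] by (cases "x \<in> {a, b}") auto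

lemma continuous_on_deriv_W: "continuous_on S (deriv W)"
proof (rule continuous_at_imp_continuous_on, rule ballI)
  fix x show "isCont (deriv W) x"
    using deriv_W_away(2)[of x] W_deriv_well(2)[of x] DERIV_isCont by (cases "x \<in> {a, b}") auto
qed

lemma W_lower_near_well:
  assumes "p \<in> {a, b}"
  shows "\<exists>r c. 0 < r \<and> 0 < c \<and> r \<le> b - a \<and>
    (\<forall>x. 0 < \<bar>x - p\<bar> \<longrightarrow> \<bar>x - p\<bar> < r \<longrightarrow> c * \<bar>x - p\<bar> powr (1 + q) \<le> W x)"
proof (rule W_near_well[OF assms])
  fix r c c' :: real
  assume "0 < r" "0 < c" "r \<le> b - a"
    "\<And>x. 0 < \<bar>x - p\<bar> \<Longrightarrow> \<bar>x - p\<bar> < r \<Longrightarrow> c * \<bar>x - p\<bar> powr (1 + q) \<le> W x \<and> W x \<le> c' * \<bar>x - p\<bar> powr (1 + q)"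
  thus ?thesis by (intro exI[of _ r] exI[of _ c]) simp
qed

text \<open>For the difference u = b - v this is the absorption term of order u^q that creates the
  dead core. The radius is halved to turn a strict bound on the distance into a closed interval; at
  \<open>x = b\<close> both sides are 0.\<close>

lemma deriv_W_near_b:
  "\<exists>r c. 0 < r \<and> 0 < c \<and> r < b - a \<and> (\<forall>x. b - r \<le> x \<longrightarrow> x \<le> b \<longrightarrow> deriv W x \<le> - c * (b - x) powr q)"
proof (rule W_near_well[of b])
  fix r c c' :: real
  assume r: "0 < r" "0 < c" "r \<le> b - a"
    "\<And>x. 0 < \<bar>x - b\<bar> \<Longrightarrow> \<bar>x - b\<bar> < r \<Longrightarrow> c * \<bar>x - b\<bar> powr q \<le> sgn (x - b) * deriv W x \<and>
        sgn (x - b) * deriv W x \<le> c' * \<bar>x - b\<bar> powr q"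
  have "deriv W x \<le> - c * (b - x) powr q" if x: "b - r/2 \<le> x" "x \<le> b" for x
  proof (cases "x = b")
    case True
    thus ?thesis using W_deriv_well(1)[of b] by (simp add: DERIV_imp_deriv)
  next
    case False
    thus ?thesis using r(1) r(4)[of x] x by (auto simp: sgn_if)
  qed
  thus ?thesis using r by (intro exI[of _ "r/2"] exI[of _ c]) auto
qed simp

text \<open>Reciprocal of the equipartition speed sqrt W. As a power it has the value 0 at the
  wells, so integrals need no exceptional points.\<close>

definition slowness :: "real \<Rightarrow> real" where
  "slowness s = W s powr (- 1 / 2)"

lemma slowness_nonneg: "0 \<le> slowness s" by (simp add: slowness_def)

lemma slowness_pos_eq: "x \<notin> {a, b} \<Longrightarrow> slowness x = 1 / sqrt (W x)"
  using W_pos[of x] by (simp add: slowness_def powr_minus_divide powr_half_sqrt)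

lemma isCont_slowness: "x \<notin> {a, b} \<Longrightarrow> isCont slowness x"
  unfolding slowness_def[abs_def] using W_pos[of x] DERIV_isCont[OF W_has_deriv[of x]]
  by (intro continuous_intros) auto

text \<open>Near a well \<open>p\<close> the integrand is at most a multiple of |x - p|^(e - 1) with
  e = (1 - q) / 2, which is positive because q < 1.\<close>

lemma slowness_integrable: "slowness integrable_on {a..b}"
proof -
  define e where "e = (1 - q) / 2"
  have e: "0 < e" using q_range by (simp add: e_def)
  have meas: "slowness \<in> borel_measurable (lebesgue_on S)" for S
  proof -
    have "W \<in> borel_measurable borel" using W_cont by (rule borel_measurable_continuous_onI)
    hence "slowness \<in> borel_measurable borel" unfolding slowness_def[abs_def] by measurable
    thus ?thesis by (intro measurable_restrict_space1 measurable_completion) simp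
  qed
  have bound: "slowness x \<le> c powr (- 1 / 2) * \<bar>x - p\<bar> powr (e - 1)"
    if "0 < c" "c * \<bar>x - p\<bar> powr (1 + q) \<le> W x" "0 < \<bar>x - p\<bar>" for c x p
  proof -
    have "W x powr (- 1 / 2) \<le> (c * \<bar>x - p\<bar> powr (1 + q)) powr (- 1 / 2)"
      using that by (intro powr_mono2') auto
    also have "\<dots> = c powr (- 1 / 2) * (\<bar>x - p\<bar> powr (1 + q)) powr (- 1 / 2)"
      using that by (simp add: powr_mult)
    also have "(\<bar>x - p\<bar> powr (1 + q)) powr (- 1 / 2) = \<bar>x - p\<bar> powr ((1 + q) * (- 1 / 2))"
      by (simp only: powr_powr)
    also have "(1 + q) * (- 1 / 2) = e - 1" by (simp add: e_def field_simps)
    finally show ?thesis by (simp add: slowness_def)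
  qed
  obtain r1 c1 where r1: "0 < r1" "0 < c1" "r1 \<le> b - a" "\<And>x. 0 < \<bar>x - a\<bar> \<Longrightarrow> \<bar>x - a\<bar> < r1 \<Longrightarrow> c1 * \<bar>x - a\<bar> powr (1 + q) \<le> W x"
    using W_lower_near_well[of a] by auto
  obtain r2 c2 where r2: "0 < r2" "0 < c2" "r2 \<le> b - a" "\<And>x. 0 < \<bar>x - b\<bar> \<Longrightarrow> \<bar>x - b\<bar> < r2 \<Longrightarrow> c2 * \<bar>x - b\<bar> powr (1 + q) \<le> W x"
    using W_lower_near_well[of b] by auto
  define r where "r = min r1 r2 / 3"
  have r: "0 < r" "r < r1" "r < r2" "a + r < b - r" using r1(1,3) r2(1,3) by (auto simp: r_def)
  have "(\<lambda>x. c1 powr (- 1 / 2) * (x - a) powr (e - 1)) integrable_on {a..a + r}"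
    using r by (intro integrable_on_mult_right integrable_powr_dist(1)[OF _ e]) auto
  hence 1: "slowness integrable_on {a..a + r}"
  proof (rule measurable_bounded_by_integrable_imp_integrable[OF meas])
    fix x assume x: "x \<in> {a..a + r}"
    show "norm (slowness x) \<le> c1 powr (- 1 / 2) * (x - a) powr (e - 1)"
    proof (cases "x = a")
      case False
      thus ?thesis using bound[OF r1(2) r1(4), of x] x r slowness_nonneg[of x] by auto
    qed (simp add: slowness_def)
  qed auto
  have "(\<lambda>x. c2 powr (- 1 / 2) * (b - x) powr (e - 1)) integrable_on {b - r..b}"
    using r by (intro integrable_on_mult_right integrable_powr_dist(2)[OF _ e]) auto
  hence 2: "slowness integrable_on {b - r..b}"
  proof (rule measurable_bounded_by_integrable_imp_integrable[OF meas])
    fix x assume x: "x \<in> {b - r..b}"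
    show "norm (slowness x) \<le> c2 powr (- 1 / 2) * (b - x) powr (e - 1)"
    proof (cases "x = b")
      case False
      thus ?thesis using bound[OF r2(2) r2(4), of x] x r slowness_nonneg[of x] by auto
    qed (simp add: slowness_def)
  qed auto
  have 3: "slowness integrable_on {a + r..b - r}"
    using r by (intro integrable_continuous_real continuous_at_imp_continuous_on) (auto intro: isCont_slowness)
  have 4: "slowness integrable_on {a + r..b}"
    by (rule Henstock_Kurzweil_Integration.integrable_combine[OF _ _ 3 2]) (use r in auto)
  show ?thesis by (rule Henstock_Kurzweil_Integration.integrable_combine[OF _ _ 1 4]) (use r in auto)
qed

lemma slowness_integrable_sub: "a \<le> x \<Longrightarrow> y \<le> b \<Longrightarrow> slowness integrable_on {x..y}"
  by (rule integrable_on_subinterval[OF slowness_integrable]) auto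

text \<open>A solution of \<epsilon> v' = sqrt (W v) climbs from \<open>x\<close> to
  \<open>y\<close> in time \<epsilon> times \<open>travel y - travel x\<close>; composing
  \<open>travel\<close> with a path turns speed bounds into time bounds.\<close>

definition travel :: "real \<Rightarrow> real" where
  "travel x = integral {a..x} slowness"

lemma continuous_on_travel: "continuous_on {a..b} travel"
  unfolding travel_def[abs_def] by (rule indefinite_integral_continuous_1[OF slowness_integrable])

lemma travel_mono: "a \<le> x \<Longrightarrow> x \<le> y \<Longrightarrow> y \<le> b \<Longrightarrow> travel x \<le> travel y"
  unfolding travel_def
  by (intro integral_subset_le slowness_integrable_sub) (auto simp: slowness_nonneg)

lemma travel_a [simp]: "travel a = 0"
  by (simp add: travel_def)

lemma travel_deriv:
  assumes "a < x" "x < b"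
  shows "(travel has_real_derivative 1 / sqrt (W x)) (at x)"
proof -
  have "((\<lambda>u. integral {a..u} slowness) has_vector_derivative slowness x) (at x within {a..b} - {})"
    by (rule integral_has_vector_derivative_continuous_at[OF slowness_integrable])
       (use assms isCont_slowness[of x] in \<open>auto intro: continuous_at_imp_continuous_at_within\<close>)
  thus ?thesis using assms slowness_pos_eq[of x]
    by (simp add: travel_def[abs_def] at_within_Icc_at has_real_derivative_iff_has_vector_derivative)
qed

lemma transition_length_eq:
  assumes "a \<le> \<alpha>" "\<alpha> \<le> b"
  shows "transition_length W b \<alpha> = travel b - travel \<alpha>"
proof -
  have "slowness absolutely_integrable_on {\<alpha>..b}"
    by (rule nonnegative_absolutely_integrable_1[OF slowness_integrable_sub]) (use assms in \<open>auto simp: slowness_nonneg\<close>)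
  moreover have "slowness \<in> borel_measurable borel"
  proof -
    have "W \<in> borel_measurable borel" using W_cont by (rule borel_measurable_continuous_onI)
    thus ?thesis unfolding slowness_def[abs_def] by measurable
  qed
  ultimately have "set_integrable lborel {\<alpha>..b} slowness"
    unfolding set_integrable_def by (subst (asm) integrable_completion) auto
  hence "transition_length W b \<alpha> = integral {\<alpha>..b} slowness"
    unfolding transition_length_def using assms
    by (subst interval_integral_eq_integral) (auto simp: slowness_def[abs_def])
  also have "\<dots> = travel b - travel \<alpha>"
    unfolding travel_def
    using Henstock_Kurzweil_Integration.integral_combine[OF assms slowness_integrable] by simp
  finally show ?thesis .
qed

end

section \<open>Competitors and energy bounds\<close>

lemma pw_deriv_cong:
  assumes "pw_deriv l h u g" and u: "\<And>t. t \<in> {l..h} \<Longrightarrow> u' t = u t" and g: "\<And>t. t \<in> {l<..<h} \<Longrightarrow> g' t = g t"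
  shows "pw_deriv l h u' g'"
proof -
  obtain S where S: "finite S" "\<And>t. t \<in> {l<..<h} - S \<Longrightarrow> (u has_real_derivative g t) (at t) \<and> isCont g t"
    using assms(1) by (auto simp: pw_deriv_def)
  have "(u' has_real_derivative g' t) (at t) \<and> isCont g' t" if t: "t \<in> {l<..<h} - S" for t
  proof
    have "(u' has_real_derivative g t) (at t)"
      by (rule has_field_derivative_transform_within_open[of u _ _ "{l<..<h}"]) (use S(2)[OF t] t u in auto)
    thus "(u' has_real_derivative g' t) (at t)" using g[of t] t by simp
    have "\<forall>\<^sub>F x in nhds t. g' x = g x"
      by (rule eventually_nhds_in_open[of "{l<..<h}", THEN eventually_mono]) (use t g in auto)
    thus "isCont g' t" using S(2)[OF t] by (simp add: isCont_cong)
  qed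
  moreover have "continuous_on {l..h} u'"
    using assms(1) u continuous_on_cong[of "{l..h}" "{l..h}" u u'] by (simp add: pw_deriv_def)
  moreover have "g' ` {l<..<h} = g ` {l<..<h}" using g by (intro image_cong) auto
  ultimately show ?thesis using assms(1) S(1) unfolding pw_deriv_def by auto
qed

lemma pw_deriv_join:
  assumes 1: "pw_deriv l m u g" and 2: "pw_deriv m h u g" and "l \<le> m" "m \<le> h"
  shows "pw_deriv l h u g"
proof -
  obtain S1 where S1: "finite S1" "\<And>t. t \<in> {l<..<m} - S1 \<Longrightarrow> (u has_real_derivative g t) (at t) \<and> isCont g t"
    using 1 by (auto simp: pw_deriv_def)
  obtain S2 where S2: "finite S2" "\<And>t. t \<in> {m<..<h} - S2 \<Longrightarrow> (u has_real_derivative g t) (at t) \<and> isCont g t"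
    using 2 by (auto simp: pw_deriv_def)
  have "continuous_on ({l..m} \<union> {m..h}) u"
    using 1 2 by (intro continuous_on_closed_Un) (auto simp: pw_deriv_def)
  moreover have "{l..m} \<union> {m..h} = {l..h}" using assms by auto
  moreover have "bounded (g ` {l<..<h})"
  proof (rule bounded_subset)
    show "bounded (g ` {l<..<m} \<union> g ` {m<..<h} \<union> {g m})"
      using 1 2 by (auto simp: pw_deriv_def)
    show "g ` {l<..<h} \<subseteq> g ` {l<..<m} \<union> g ` {m<..<h} \<union> {g m}"
    proof
      fix y assume "y \<in> g ` {l<..<h}"
      then obtain t where "t \<in> {l<..<h}" "y = g t" by auto
      thus "y \<in> g ` {l<..<m} \<union> g ` {m<..<h} \<union> {g m}" by (cases t m rule: linorder_cases) auto
    qed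
  qed
  moreover have "\<forall>t\<in>{l<..<h} - (S1 \<union> S2 \<union> {m}). (u has_real_derivative g t) (at t) \<and> isCont g t"
  proof
    fix t assume t: "t \<in> {l<..<h} - (S1 \<union> S2 \<union> {m})"
    thus "(u has_real_derivative g t) (at t) \<and> isCont g t"
      using S1(2)[of t] S2(2)[of t] by (cases t m rule: linorder_cases) auto
  qed
  ultimately show ?thesis using S1(1) S2(1) unfolding pw_deriv_def by (metis finite.simps finite_UnI)
qed

lemma integrable_on_Icc_of_Ioo:
  fixes f :: "real \<Rightarrow> real"
  assumes "integrable (lebesgue_on {l<..<h}) f"
  shows "f integrable_on {l..h}"
proof -
  have "f integrable_on {l<..<h}"
    using has_integral_integral_lebesgue_on[OF assms] by auto
  thus ?thesis by (simp add: integrable_on_open_interval_real)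
qed

section \<open>Cost of glued competitors\<close>

context weighted_energy
begin

lemma density_integrable_on:
  assumes "pw_deriv l h u g" "0 \<le> l" "h \<le> T"
  shows "density u g integrable_on {l..h}"
proof -
  have sub: "{l..h} \<subseteq> {0..T}" using assms by auto
  have "bounded (\<omega> ` {0..T})" by (intro compact_imp_bounded compact_continuous_image \<omega>_cont compact_Icc)
  then obtain B where B: "\<forall>t\<in>{0..T}. \<bar>\<omega> t\<bar> \<le> B" by (auto simp: bounded_iff)
  have "continuous_on {l<..<h} \<omega>" by (rule continuous_on_subset[OF \<omega>_cont]) (use assms in auto)
  hence m: "\<omega> \<in> borel_measurable (lebesgue_on {l<..<h})"
    by (intro continuous_imp_measurable_on_sets_lebesgue) auto
  have uc: "continuous_on {l..h} u" using assms(1) by (simp add: pw_deriv_def)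
  have "integrable (lebesgue_on {l<..<h}) (\<lambda>t. W (u t) + \<epsilon>\<^sup>2 * (g t)\<^sup>2)"
    using pw_deriv_bounded_integrable(1)[OF assms(1)] integrable_lebesgue_on_Ioo[OF continuous_on_W[OF uc]]
    by (intro Bochner_Integration.integrable_add) auto
  hence "integrable (lebesgue_on {l<..<h}) (\<lambda>t. (W (u t) + \<epsilon>\<^sup>2 * (g t)\<^sup>2) * \<omega> t)"
    by (rule integrable_lebesgue_on_mult_bounded[OF _ m, where B = B]) (use B sub in auto)
  thus ?thesis using integrable_on_Icc_of_Ioo by (simp add: density_def[abs_def])
qed

text \<open>Such budgets add under concatenation, so competitors are assembled with
  \<open>reach_trans\<close> from segments and waiting times and never written down as functions on
  the whole interval.\<close>

definition reach :: "real \<Rightarrow> real \<Rightarrow> real \<Rightarrow> real \<Rightarrow> real \<Rightarrow> bool" where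
  "reach l h x y c \<longleftrightarrow> (\<exists>u g. pw_deriv l h u g \<and> u l = x \<and> u h = y \<and> integral {l..h} (density u g) \<le> c)"

lemma reachI: "pw_deriv l h u g \<Longrightarrow> u l = x \<Longrightarrow> u h = y \<Longrightarrow> integral {l..h} (density u g) \<le> c \<Longrightarrow> reach l h x y c"
  unfolding reach_def by blast

lemma reach_mono: "reach l h x y c \<Longrightarrow> c \<le> d \<Longrightarrow> reach l h x y d"
  unfolding reach_def using order.trans by blast

lemma reach_trans:
  assumes 1: "reach l m x y c" and 2: "reach m h y z d" and "0 \<le> l" "l \<le> m" "m \<le> h" "h \<le> T"
  shows "reach l h x z (c + d)"
proof -
  obtain u1 g1 where 1: "pw_deriv l m u1 g1" "u1 l = x" "u1 m = y" "integral {l..m} (density u1 g1) \<le> c"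
    using 1 by (auto simp: reach_def)
  obtain u2 g2 where 2: "pw_deriv m h u2 g2" "u2 m = y" "u2 h = z" "integral {m..h} (density u2 g2) \<le> d"
    using 2 by (auto simp: reach_def)
  define u where "u = (\<lambda>t. if t \<le> m then u1 t else u2 t)"
  define g where "g = (\<lambda>t. if t \<le> m then g1 t else g2 t)"
  have p1: "pw_deriv l m u g" by (rule pw_deriv_cong[OF 1(1)]) (auto simp: u_def g_def)
  have p2: "pw_deriv m h u g" by (rule pw_deriv_cong[OF 2(1)]) (use 1 2 in \<open>auto simp: u_def g_def\<close>)
  have p: "pw_deriv l h u g" by (rule pw_deriv_join[OF p1 p2]) (use assms in auto)
  have "integral {l..h} (density u g) = integral {l..m} (density u g) + integral {m..h} (density u g)"
    by (rule Henstock_Kurzweil_Integration.integral_combine[symmetric])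
       (use assms density_integrable_on[OF p] in auto)
  also have "integral {l..m} (density u g) = integral {l..m} (density u1 g1)"
    by (rule integral_cong) (auto simp: density_def u_def g_def)
  \<comment> \<open>At the joint \<open>g\<close> has the value of the left piece, so the two
    densities need agree only off one point.\<close>
  also have "integral {m..h} (density u g) = integral {m..h} (density u2 g2)"
    by (rule integral_spike[of "{m}"]) (auto simp: density_def u_def g_def)
  finally have "integral {l..h} (density u g) \<le> c + d" using 1(4) 2(4) by linarith
  thus ?thesis using p 1 2 assms by (intro reachI[OF p]) (auto simp: u_def)
qed

lemma reach_linear:
  assumes "0 \<le> l" "l < h" "h \<le> T" and \<omega>: "\<And>t. t \<in> {0..T} \<Longrightarrow> \<omega> t \<le> 2"
    and xy: "x \<in> {c..d}" "y \<in> {c..d}" and m: "\<And>s. s \<in> {c..d} \<Longrightarrow> W s \<le> m"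
  shows "reach l h x y (2 * ((h - l) * m + \<epsilon>\<^sup>2 * (y - x)\<^sup>2 / (h - l)))"
proof -
  define k where "k = (y - x) / (h - l)"
  define u where "u = (\<lambda>t. x + k * (t - l))"
  have p: "pw_deriv l h u (\<lambda>_. k)"
    unfolding u_def by (intro pw_deriv_C1) (auto intro!: derivative_eq_intros)
  have "u t \<in> {c..d}" if t: "t \<in> {l..h}" for t
  proof -
    define k1 where "k1 = (t - l) / (h - l)"
    have k1: "0 \<le> k1" "k1 \<le> 1" using t assms by (auto simp: k1_def)
    have "k * (t - l) = (y - x) * k1" by (simp add: k_def k1_def)
    hence u: "u t = (1 - k1) * x + k1 * y" by (simp add: u_def algebra_simps)
    have "(1 - k1) * x + k1 * y \<in> {c..d}"
      using k1 xy convex_bound_le[of x d y "1 - k1" k1] convex_bound_le[of "-x" "-c" "-y" "1 - k1" k1] by auto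
    thus ?thesis by (simp add: u)
  qed
  hence "density u (\<lambda>_. k) t \<le> 2 * (m + \<epsilon>\<^sup>2 * k\<^sup>2)" if "t \<in> {l..h}" for t
  proof -
    have "t \<in> {0..T}" using that assms by auto
    hence "density u (\<lambda>_. k) t \<le> (m + \<epsilon>\<^sup>2 * k\<^sup>2) * 2"
      unfolding density_def using m[of "u t"] \<omega>[of t] \<omega>_pos[of t] W_ge_0[of "u t"] \<open>t \<in> {l..h} \<Longrightarrow> u t \<in> {c..d}\<close> that
      by (intro mult_mono) (auto intro: order.trans add_nonneg_nonneg)
    thus ?thesis by simp
  qed
  hence "integral {l..h} (density u (\<lambda>_. k)) \<le> integral {l..h} (\<lambda>_. 2 * (m + \<epsilon>\<^sup>2 * k\<^sup>2))"
    using assms by (intro integral_le density_integrable_on[OF p] integrable_const_ivl) auto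
  also have "\<dots> = 2 * ((h - l) * m + \<epsilon>\<^sup>2 * (y - x)\<^sup>2 / (h - l))"
  proof -
    have "(h - l) * k\<^sup>2 = (y - x)\<^sup>2 / (h - l)"
      using assms(2) by (simp add: k_def power_divide power2_eq_square)
    moreover have "(h - l) * (2 * (m + \<epsilon>\<^sup>2 * k\<^sup>2)) = 2 * ((h - l) * m + \<epsilon>\<^sup>2 * ((h - l) * k\<^sup>2))"
      by (simp add: algebra_simps)
    ultimately show ?thesis using assms(2) by simp
  qed
  finally show ?thesis
    using assms(2) by (intro reachI[OF p]) (auto simp: u_def k_def)
qed

lemma reach_stay:
  assumes "0 \<le> l" "l < h" "h \<le> T" and \<omega>: "\<And>t. t \<in> {0..T} \<Longrightarrow> \<omega> t \<le> 2"
  shows "reach l h x x (2 * (h - l) * W x)"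
proof -
  have eq: "2 * (h - l) * W x = 2 * ((h - l) * W x + \<epsilon>\<^sup>2 * (x - x)\<^sup>2 / (h - l))" by simp
  show ?thesis unfolding eq by (rule reach_linear[OF assms, of x x x x]) auto
qed

end

text \<open>Collects what is used of a minimizer and its weight. The weight enters later estimates
  through its size between 1/2 and 2, the bound \<open>N\<close> on its slope and the bound
  \<open>D\<close> on its oscillation, so that thresholds built from these do not depend on
  \<open>T\<close>.\<close>

locale layer = double_well W a b q + weighted_energy W "deriv W" T \<omega> \<epsilon>
  for W :: "real \<Rightarrow> real" and a b q T :: real and \<omega> :: "real \<Rightarrow> real" and \<epsilon> :: real +
  fixes \<omega>' v v' :: "real \<Rightarrow> real" and \<alpha> \<beta> N D Wm :: real
  assumes \<omega>_has_deriv: "\<And>t. t \<in> {0..T} \<Longrightarrow> (\<omega> has_real_derivative \<omega>' t) (at t within {0..T})"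
    and \<omega>'_bound: "\<And>t. t \<in> {0..T} \<Longrightarrow> \<bar>\<omega>' t\<bar> \<le> N"
    and \<omega>_bounds: "\<And>t. t \<in> {0..T} \<Longrightarrow> 1 / 2 \<le> \<omega> t" "\<And>t. t \<in> {0..T} \<Longrightarrow> \<omega> t \<le> 2"
    and \<omega>_osc: "\<And>s t. s \<in> {0..T} \<Longrightarrow> t \<in> {0..T} \<Longrightarrow> \<bar>\<omega> s - \<omega> t\<bar> \<le> D"
    and Wm: "\<And>x. x \<in> {a..b} \<Longrightarrow> W x \<le> Wm"
    and \<alpha>\<beta>: "\<alpha> \<in> {a..b}" "\<beta> \<in> {a..b}"
    and v_deriv: "\<And>t. t \<in> {0..T} \<Longrightarrow> (v has_real_derivative v' t) (at t within {0..T})"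
    and v'_cont: "continuous_on {0..T} v'"
    and momentum_deriv: "\<And>t. t \<in> {0..T} \<Longrightarrow>
      ((\<lambda>t. \<omega> t * v' t) has_real_derivative deriv W (v t) * \<omega> t / (2 * \<epsilon>\<^sup>2)) (at t within {0..T})"
    and v_0: "v 0 = \<alpha>" and v_T: "v T = \<beta>"
    and v_min: "\<And>u g. pw_deriv 0 T u g \<Longrightarrow> u 0 = \<alpha> \<Longrightarrow> u T = \<beta> \<Longrightarrow>
      integral {0..T} (density v v') \<le> integral {0..T} (density u g)"
begin

section \<open>A priori bounds on range and energy\<close>

abbreviation "energy \<equiv> integral {0..T} (density v v')"

lemma energy_le_reach: "reach 0 T \<alpha> \<beta> c \<Longrightarrow> energy \<le> c"
  unfolding reach_def using v_min order.trans by blast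

lemma v_cont: "continuous_on {0..T} v"
  using v_deriv by (rule DERIV_continuous_on)

lemma v_cont_sub: "0 \<le> l \<Longrightarrow> h \<le> T \<Longrightarrow> continuous_on {l..h} v"
  by (rule continuous_on_subset[OF v_cont]) auto

lemma density_v_cont: "continuous_on {0..T} (density v v')"
  unfolding density_def[abs_def] by (intro continuous_intros v_cont v'_cont \<omega>_cont)

lemma density_v_integrable: "0 \<le> l \<Longrightarrow> h \<le> T \<Longrightarrow> density v v' integrable_on {l..h}"
  by (intro integrable_continuous_real continuous_on_subset[OF density_v_cont]) auto

lemma energy_split:
  assumes "0 \<le> s" "s \<le> t" "t \<le> T"
  shows "energy = integral {0..s} (density v v') + integral {s..t} (density v v') + integral {t..T} (density v v')"
proof -
  have "energy = integral {0..s} (density v v') + integral {s..T} (density v v')"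
    by (rule Henstock_Kurzweil_Integration.integral_combine[symmetric]) (use assms density_v_integrable[of 0 T] in auto)
  also have "integral {s..T} (density v v') = integral {s..t} (density v v') + integral {t..T} (density v v')"
    by (rule Henstock_Kurzweil_Integration.integral_combine[symmetric]) (use assms density_v_integrable[of s T] in auto)
  finally show ?thesis by simp
qed

lemma reach_v:
  assumes "0 \<le> l" "l \<le> h" "h \<le> T"
  shows "reach l h (v l) (v h) (integral {l..h} (density v v'))"
proof (rule reachI)
  have sub: "{l..h} \<subseteq> {0..T}" using assms by auto
  show "pw_deriv l h v v'"
    by (rule pw_deriv_C1) (use sub in \<open>auto intro: DERIV_subset[OF v_deriv] continuous_on_subset[OF v'_cont]\<close>)
qed auto

text \<open>Waiting in a well is free, so between two visits to the same well a minimizer has zero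
  energy, hence zero velocity.\<close>

lemma const_between_wells:
  assumes p: "p \<in> {a, b}" and st: "0 \<le> s" "s < t" "t \<le> T" "v s = p" "v t = p" and x: "x \<in> {s..t}"
  shows "v x = p"
proof -
  have Wp: "W p = 0" using p by auto
  have "reach 0 t \<alpha> p (integral {0..s} (density v v') + 2 * (t - s) * W p)"
    using reach_v[of 0 s] reach_stay[of s t p] st \<omega>_bounds v_0 by (intro reach_trans[of 0 s _ p _ t p]) auto
  hence "reach 0 T \<alpha> \<beta> (integral {0..s} (density v v') + 2 * (t - s) * W p + integral {t..T} (density v v'))"
    using reach_v[of t T] st v_T by (intro reach_trans[of 0 t _ p _ T \<beta>]) auto
  from energy_le_reach[OF this] have "integral {s..t} (density v v') \<le> 0"
    using energy_split[of s t] st Wp by simp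
  moreover have "0 \<le> integral {s..t} (density v v')"
    using st by (intro integral_nonneg density_v_integrable density_nonneg) auto
  ultimately have "integral {s..t} (density v v') = 0" by simp
  hence 0: "density v v' y = 0" if "y \<in> {s..t}" for y
    using that st by (subst (asm) integral_eq_0_iff) (auto intro!: continuous_on_subset[OF density_v_cont] density_nonneg)
  have v'0: "v' y = 0" if y: "y \<in> {s..t}" for y
  proof -
    have "y \<in> {0..T}" using y st by auto
    hence "W (v y) + \<epsilon>\<^sup>2 * (v' y)\<^sup>2 = 0" using 0[OF y] \<omega>_pos[of y] by (simp add: density_def)
    moreover have "0 \<le> W (v y)" "0 \<le> \<epsilon>\<^sup>2 * (v' y)\<^sup>2" using W_nonneg by auto
    ultimately have "\<epsilon>\<^sup>2 * (v' y)\<^sup>2 = 0" by linarith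
    thus ?thesis using \<epsilon>_pos by simp
  qed
  have "\<exists>c. \<forall>y\<in>{s..t}. v y = c"
  proof (rule has_field_derivative_zero_constant)
    show "(v has_real_derivative 0) (at y within {s..t})" if y: "y \<in> {s..t}" for y
    proof -
      have "y \<in> {0..T}" "{s..t} \<subseteq> {0..T}" using y st by auto
      from DERIV_subset[OF v_deriv[OF this(1)] this(2)] show ?thesis using v'0[OF y] by simp
    qed
  qed simp
  thus ?thesis using st x by force
qed

lemma v_ivt:
  assumes "0 \<le> s" "s \<le> t" "t \<le> T" "v s \<le> p \<and> p \<le> v t \<or> v t \<le> p \<and> p \<le> v s"
  shows "\<exists>x\<in>{s..t}. v x = p"
  using assms(4)
proof
  assume "v s \<le> p \<and> p \<le> v t"
  thus ?thesis using IVT'[of v s p t] assms v_cont_sub[of s t] by auto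
next
  assume "v t \<le> p \<and> p \<le> v s"
  thus ?thesis using IVT2'[of v t p s] assms v_cont_sub[of s t] by auto
qed

text \<open>A path that leaves the interval has to cross the exceeded well level both before and
  after \<open>t\<close>, since the boundary values lie inside; \<open>const_between_wells\<close>
  then pins it to that level.\<close>

lemma v_range:
  assumes t: "t \<in> {0..T}"
  shows "v t \<in> {a..b}"
proof -
  have ivt: "\<exists>s\<in>{0..t}. v s = p" "\<exists>s\<in>{t..T}. v s = p"
    if "v t > p \<and> \<alpha> \<le> p \<and> \<beta> \<le> p \<or> v t < p \<and> p \<le> \<alpha> \<and> p \<le> \<beta>" for p
    using that t v_0 v_T by (auto intro!: v_ivt)
  have False if pp: "v t > p \<and> \<alpha> \<le> p \<and> \<beta> \<le> p \<or> v t < p \<and> p \<le> \<alpha> \<and> p \<le> \<beta>" and p: "p \<in> {a, b}" for p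
  proof -
    obtain s u where s: "s \<in> {0..t}" "v s = p" "u \<in> {t..T}" "v u = p" using ivt[OF pp] by auto
    have "v t = p"
    proof (cases "s = u")
      case False
      hence "s < u" "0 \<le> s" "u \<le> T" "t \<in> {s..u}" using s(1,3) by auto
      thus ?thesis using const_between_wells[OF p, of s u t] s(2,4) by blast
    next
      case True
      hence "t = s" using s(1,3) by auto
      thus ?thesis using s(2) by simp
    qed
    thus False using pp by auto
  qed
  from this[of a] this[of b] show ?thesis using \<alpha>\<beta> by force
qed

lemma W_v_le: "t \<in> {0..T} \<Longrightarrow> W (v t) \<le> Wm"
  using Wm v_range by blast

lemma Wm_nonneg: "0 \<le> Wm"
  using Wm[of a] a_less_b by simp

lemma N_nonneg: "0 \<le> N"
  using \<omega>'_bound[of 0] T_pos by auto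

lemma D_nonneg: "0 \<le> D"
  using \<omega>_osc[of 0 0] T_pos by auto

lemma \<omega>_lipschitz:
  assumes "s \<in> {0..T}" "t \<in> {0..T}"
  shows "\<bar>\<omega> s - \<omega> t\<bar> \<le> N * \<bar>s - t\<bar>"
  using field_differentiable_bound[of "{0..T}" \<omega> \<omega>' N s t] \<omega>_has_deriv \<omega>'_bound assms by auto

text \<open>A third of \<epsilon> is spent on the way up to \<open>b\<close> and another third on
  the way to \<open>y\<close>; the wait in between is free. The cost is thus O(\<epsilon>) with a
  constant independent of the length of the interval.\<close>

lemma reach_via_b:
  assumes lh: "0 \<le> l" "l + \<epsilon> \<le> h" "h \<le> T" and x: "x \<in> {c..b}" "y \<in> {c..b}" and m: "\<And>s. s \<in> {c..b} \<Longrightarrow> W s \<le> m"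
  shows "reach l h x y (\<epsilon> * (2 * m + 12 * (b - c)\<^sup>2))"
proof -
  have d: "0 < \<epsilon> / 3" using \<epsilon>_pos by simp
  have c: "c \<le> b" using x by auto
  have sq: "(b - x)\<^sup>2 \<le> (b - c)\<^sup>2" "(y - b)\<^sup>2 \<le> (b - c)\<^sup>2"
    using x power_mono[of "b - x" "b - c" 2] power_mono[of "b - y" "b - c" 2] by (auto simp: power2_commute)
  have 0: "0 \<le> m" using m[of b] c by simp
  have e: "2 * (\<epsilon> / 3 * m + \<epsilon>\<^sup>2 * z / (\<epsilon> / 3)) = \<epsilon> * (2 / 3 * m + 6 * z)" for z
    using \<epsilon>_pos by (simp add: field_simps power2_eq_square)
  have 1: "reach l (l + \<epsilon> / 3) x b (\<epsilon> * (2 / 3 * m + 6 * (b - x)\<^sup>2))"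
    using reach_linear[of l "l + \<epsilon> / 3" x c b b m] lh d x c m \<omega>_bounds e by auto
  have 2: "reach (l + \<epsilon> / 3) (h - \<epsilon> / 3) b b (2 * (h - \<epsilon> / 3 - (l + \<epsilon> / 3)) * W b)"
    using lh d \<omega>_bounds \<epsilon>_pos by (intro reach_stay) auto
  have 3: "reach (h - \<epsilon> / 3) h b y (\<epsilon> * (2 / 3 * m + 6 * (y - b)\<^sup>2))"
    using reach_linear[of "h - \<epsilon> / 3" h b c b y m] lh d x c m \<omega>_bounds e by auto
  have "reach l h x y (\<epsilon> * (2 / 3 * m + 6 * (b - x)\<^sup>2) + 2 * (h - \<epsilon> / 3 - (l + \<epsilon> / 3)) * W b + \<epsilon> * (2 / 3 * m + 6 * (y - b)\<^sup>2))"
    by (rule reach_trans[OF reach_trans[OF 1 2] 3]) (use lh \<epsilon>_pos in auto)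
  thus ?thesis
  proof (rule reach_mono)
    have "2 / 3 * m + 6 * (b - x)\<^sup>2 + (2 / 3 * m + 6 * (y - b)\<^sup>2) \<le> 2 * m + 12 * (b - c)\<^sup>2"
      using sq 0 by linarith
    from mult_left_mono[OF this, of \<epsilon>]
    show "\<epsilon> * (2 / 3 * m + 6 * (b - x)\<^sup>2) + 2 * (h - \<epsilon> / 3 - (l + \<epsilon> / 3)) * W b + \<epsilon> * (2 / 3 * m + 6 * (y - b)\<^sup>2)
      \<le> \<epsilon> * (2 * m + 12 * (b - c)\<^sup>2)"
      using \<epsilon>_pos by (simp add: distrib_left)
  qed
qed

definition C0 :: real where "C0 = 2 * Wm + 12 * (b - a)\<^sup>2"

lemma C0_nonneg: "0 \<le> C0"
  using Wm_nonneg by (simp add: C0_def)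

lemma energy_long: "\<epsilon> \<le> T \<Longrightarrow> energy \<le> \<epsilon> * C0"
  unfolding C0_def using \<alpha>\<beta> Wm by (intro energy_le_reach reach_via_b) auto

lemma energy_short: "energy \<le> 2 * (T * Wm + \<epsilon>\<^sup>2 * (b - a)\<^sup>2 / T)"
proof -
  have sq: "(\<beta> - \<alpha>)\<^sup>2 \<le> (b - a)\<^sup>2"
    using \<alpha>\<beta> power_mono[of "\<bar>\<beta> - \<alpha>\<bar>" "b - a" 2] by auto
  have "energy \<le> 2 * ((T - 0) * Wm + \<epsilon>\<^sup>2 * (\<beta> - \<alpha>)\<^sup>2 / (T - 0))"
    using \<alpha>\<beta> T_pos Wm \<omega>_bounds by (intro energy_le_reach reach_linear[of 0 T \<alpha> a b \<beta>]) auto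
  also have "\<dots> \<le> 2 * (T * Wm + \<epsilon>\<^sup>2 * (b - a)\<^sup>2 / T)"
    using sq T_pos by (auto intro!: divide_right_mono mult_left_mono)
  finally show ?thesis .
qed

text \<open>For \<open>T\<close> < \<epsilon> the available bound on the energy contains
  \<epsilon>^2 / \<open>T\<close> and is useless here; the potential part is controlled directly by
  \<open>Wm\<close> and the short length of the interval.\<close>

lemma integral_W_le: "integral {0..T} (\<lambda>t. W (v t)) \<le> 2 * C0 * \<epsilon>"
proof (cases "\<epsilon> \<le> T")
  case True
  have "integral {0..T} (\<lambda>t. W (v t)) \<le> integral {0..T} (\<lambda>t. 2 * density v v' t)"
  proof (rule integral_le)
    fix t assume t: "t \<in> {0..T}"
    have "W (v t) * (1 / 2) \<le> (W (v t) + \<epsilon>\<^sup>2 * (v' t)\<^sup>2) * \<omega> t"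
      using \<omega>_bounds[OF t] W_nonneg[of "v t"] by (intro mult_mono) auto
    thus "W (v t) \<le> 2 * density v v' t" by (simp add: density_def)
  qed (auto intro!: integrable_continuous_real continuous_intros v_cont density_v_cont)
  also have "\<dots> = 2 * energy" by simp
  finally show ?thesis using energy_long[OF True] by (simp add: mult.commute)
next
  case False
  have "integral {0..T} (\<lambda>t. W (v t)) \<le> integral {0..T} (\<lambda>t. Wm)"
    by (rule integral_le) (auto intro!: integrable_continuous_real continuous_intros v_cont W_v_le)
  also have "\<dots> = T * Wm" using T_pos by simp
  also have "\<dots> \<le> \<epsilon> * Wm" using False Wm_nonneg by (intro mult_right_mono) auto
  also have "\<dots> \<le> \<epsilon> * (2 * C0)" using \<epsilon>_pos Wm_nonneg by (intro mult_left_mono) (auto simp: C0_def)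
  finally show ?thesis by (simp add: mult.commute)
qed

end

section \<open>Excision of loops and the Hamiltonian\<close>

text \<open>An exponent above 1 makes both functions differentiable at 0 as well. The second has the
  form of the derivative of the first, so together they differentiate the barrier twice.\<close>

lemma DERIV_abs_powr:
  fixes s m :: real
  assumes "1 < m"
  shows "((\<lambda>s. \<bar>s\<bar> powr m) has_real_derivative m * (sgn s * \<bar>s\<bar> powr (m - 1))) (at s)"
    "((\<lambda>s. sgn s * \<bar>s\<bar> powr m) has_real_derivative m * \<bar>s\<bar> powr (m - 1)) (at s)"
proof -
  have pos: "((\<lambda>s. s powr m) has_real_derivative m * s powr (m - 1)) (at s)" if "0 < s" for s :: real
    using that by (auto intro!: derivative_eq_intros)
  have neg: "((\<lambda>s. (- s) powr m) has_real_derivative - (m * (- s) powr (m - 1))) (at s)" if "s < 0" for s :: real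
    using that by (auto intro!: derivative_eq_intros)
  have lim: "((\<lambda>h::real. \<bar>h\<bar> powr (m - 1)) \<longlongrightarrow> 0) (at 0)"
  proof -
    have "((\<lambda>h::real. \<bar>h\<bar> powr (m - 1)) \<longlongrightarrow> \<bar>0\<bar> powr (m - 1)) (at 0)"
      using assms by (intro tendsto_intros tendsto_powr') auto
    thus ?thesis by simp
  qed
  have quot: "\<bar>h\<bar> powr m / \<bar>h\<bar> = \<bar>h\<bar> powr (m - 1)" if "h \<noteq> 0" for h :: real
    using that by (simp add: powr_diff)
  consider "s > 0" | "s < 0" | "s = 0" by linarith
  thus "((\<lambda>s. \<bar>s\<bar> powr m) has_real_derivative m * (sgn s * \<bar>s\<bar> powr (m - 1))) (at s)"
  proof cases
    case 1
    have "((\<lambda>s. \<bar>s\<bar> powr m) has_real_derivative m * s powr (m - 1)) (at s)"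
      by (rule has_field_derivative_transform_within_open[OF pos[OF 1], of "{0<..}"]) (use 1 in auto)
    thus ?thesis using 1 by simp
  next
    case 2
    have "((\<lambda>s. \<bar>s\<bar> powr m) has_real_derivative - (m * (- s) powr (m - 1))) (at s)"
      by (rule has_field_derivative_transform_within_open[OF neg[OF 2], of "{..<0}"]) (use 2 in auto)
    thus ?thesis using 2 by simp
  next
    case 3
    have "((\<lambda>h. \<bar>h\<bar> powr m / h) \<longlongrightarrow> 0) (at 0)"
    proof (rule Lim_null_comparison[OF _ lim])
      show "\<forall>\<^sub>F h in at 0. norm (\<bar>h\<bar> powr m / h) \<le> \<bar>h\<bar> powr (m - 1)"
        unfolding eventually_at using quot by (intro exI[of _ 1]) (auto simp: abs_divide)
    qed
    thus ?thesis using 3 by (simp add: has_field_derivative_iff)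
  qed
  consider "s > 0" | "s < 0" | "s = 0" by linarith
  thus "((\<lambda>s. sgn s * \<bar>s\<bar> powr m) has_real_derivative m * \<bar>s\<bar> powr (m - 1)) (at s)"
  proof cases
    case 1
    have "((\<lambda>s. sgn s * \<bar>s\<bar> powr m) has_real_derivative m * s powr (m - 1)) (at s)"
      by (rule has_field_derivative_transform_within_open[OF pos[OF 1], of "{0<..}"]) (use 1 in auto)
    thus ?thesis using 1 by simp
  next
    case 2
    have "((\<lambda>s. sgn s * \<bar>s\<bar> powr m) has_real_derivative - (- (m * (- s) powr (m - 1)))) (at s)"
      by (rule has_field_derivative_transform_within_open[OF DERIV_minus[OF neg[OF 2]], of "{..<0}"]) (use 2 in auto)
    thus ?thesis using 2 by simp
  next
    case 3
    have "((\<lambda>h. sgn h * \<bar>h\<bar> powr m / h) \<longlongrightarrow> 0) (at 0)"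
    proof (rule Lim_null_comparison[OF _ lim])
      show "\<forall>\<^sub>F h in at 0. norm (sgn h * \<bar>h\<bar> powr m / h) \<le> \<bar>h\<bar> powr (m - 1)"
        unfolding eventually_at using quot by (intro exI[of _ 1]) (auto simp: abs_divide abs_mult abs_sgn_eq)
    qed
    thus ?thesis using 3 assms by (simp add: has_field_derivative_iff)
  qed
qed

context layer
begin

text \<open>Fills the time that an excised loop leaves over. If at least \<epsilon> is left, the
  path can visit \<open>b\<close>; otherwise it stays at \<beta>. Both are cheap because
  \<open>W\<close> is at most \<sigma> between \<beta> and \<open>b\<close>.\<close>

lemma filler:
  assumes \<sigma>: "\<And>x. x \<in> {\<beta>..b} \<Longrightarrow> W x \<le> \<sigma>" and l: "0 \<le> l" "l < T"
  shows "reach l T \<beta> \<beta> (\<epsilon> * (2 * \<sigma> + 12 * (b - \<beta>)\<^sup>2))"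
proof (cases "l + \<epsilon> \<le> T")
  case True
  thus ?thesis using \<alpha>\<beta> \<sigma> l by (intro reach_via_b) auto
next
  case False
  have "reach l T \<beta> \<beta> (2 * (T - l) * W \<beta>)" using l \<omega>_bounds by (intro reach_stay) auto
  thus ?thesis
  proof (rule reach_mono)
    have "W \<beta> \<le> \<sigma>" using \<sigma> \<alpha>\<beta> by auto
    hence "(T - l) * W \<beta> \<le> \<epsilon> * \<sigma>" using False l W_nonneg \<epsilon>_pos by (intro mult_mono) auto
    moreover have "0 \<le> \<epsilon> * (12 * (b - \<beta>)\<^sup>2)" using \<epsilon>_pos by simp
    ultimately show "2 * (T - l) * W \<beta> \<le> \<epsilon> * (2 * \<sigma> + 12 * (b - \<beta>)\<^sup>2)"
      by (simp add: algebra_simps)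
  qed
qed

text \<open>A minimizer cannot afford an expensive loop: cutting it out, moving the rest of the path to the
  left and waiting near \<open>b\<close> at the end costs only the error terms on the right.\<close>

lemma loop_cost:
  assumes st: "0 \<le> s" "s < t" "t \<le> T" and loop: "v s = v t" and \<sigma>: "\<And>x. x \<in> {\<beta>..b} \<Longrightarrow> W x \<le> \<sigma>"
  shows "integral {s..t} (density v v') \<le> \<epsilon> * (2 * D * C0 + 4 * N * (Wm + (b - a)\<^sup>2) * \<epsilon> + 2 * \<sigma> + 12 * (b - \<beta>)\<^sup>2)"
proof -
  define k where "k = t - s"
  define F where "F = \<epsilon> * (2 * \<sigma> + 12 * (b - \<beta>)\<^sup>2)"
  \<comment> \<open>Two bounds on the oscillation of \<omega>: \<open>D\<close> is paired with
    \<open>energy_long\<close>, while for \<open>T\<close> < \<epsilon> the factor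
    \<open>N * T\<close> cancels the denominator \<open>T\<close> in
    \<open>energy_short\<close>.\<close>
  define d where "d = min D (N * T)"
  have k: "0 < k" "k \<le> T" "t = s + k" "s \<le> T - k" using st by (auto simp: k_def)
  have d: "0 \<le> d" using D_nonneg N_nonneg T_pos by (simp add: d_def)
  have osc: "\<bar>\<omega> x - \<omega> y\<bar> \<le> d" if "x \<in> {0..T}" "y \<in> {0..T}" for x y
  proof -
    have "N * \<bar>x - y\<bar> \<le> N * T" using that N_nonneg by (intro mult_left_mono) auto
    thus ?thesis using \<omega>_osc[OF that] \<omega>_lipschitz[OF that] by (simp add: d_def)
  qed
  let ?u = "\<lambda>x. v (x + k)" and ?g = "\<lambda>x. v' (x + k)"
  have img: "(\<lambda>x. x + k) ` {s..T - k} \<subseteq> {0..T}" using k st by auto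
  have p: "pw_deriv s (T - k) ?u ?g"
  proof (rule pw_deriv_C1)
    fix x assume x: "x \<in> {s..T - k}"
    have v: "(v has_real_derivative v' (x + k)) (at (x + k) within (\<lambda>x. x + k) ` {s..T - k})"
      by (rule DERIV_subset[OF v_deriv img]) (use img x in auto)
    have "((\<lambda>x. x + k) has_real_derivative 1) (at x within {s..T - k})"
      by (auto intro!: derivative_eq_intros)
    from DERIV_image_chain[OF v this] show "(?u has_real_derivative ?g x) (at x within {s..T - k})"
      by (simp add: o_def)
  next
    show "continuous_on {s..T - k} ?g"
      by (rule continuous_on_compose2[OF v'_cont]) (use img in \<open>auto intro!: continuous_intros\<close>)
  qed
  have cont: "continuous_on {s..T - k} (\<lambda>x. density v v' (x + k))"
    by (rule continuous_on_compose2[OF density_v_cont]) (use img in \<open>auto intro!: continuous_intros\<close>)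
  have "integral {s..T - k} (density ?u ?g) \<le> integral {s..T - k} (\<lambda>x. (1 + 2 * d) * density v v' (x + k))"
  proof (rule integral_le)
    show "density ?u ?g integrable_on {s..T - k}" by (rule density_integrable_on[OF p]) (use st k in auto)
    show "(\<lambda>x. (1 + 2 * d) * density v v' (x + k)) integrable_on {s..T - k}"
      by (intro integrable_continuous_real continuous_intros cont)
    fix x assume x: "x \<in> {s..T - k}"
    have xk: "x \<in> {0..T}" "x + k \<in> {0..T}" using x st k by auto
    \<comment> \<open>Weighting the shifted piece at other times costs a factor 1 + 2d, as \<omega>
      is at least 1/2.\<close>
    have "\<omega> x \<le> \<omega> (x + k) + d" using osc[OF xk] by linarith
    also have "\<dots> \<le> (1 + 2 * d) * \<omega> (x + k)"
      using mult_left_mono[OF \<omega>_bounds(1)[OF xk(2)], of "2 * d"] d by (simp add: distrib_right)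
    finally have "(W (?u x) + \<epsilon>\<^sup>2 * (?g x)\<^sup>2) * \<omega> x \<le> (W (?u x) + \<epsilon>\<^sup>2 * (?g x)\<^sup>2) * ((1 + 2 * d) * \<omega> (x + k))"
      using W_nonneg by (intro mult_left_mono) auto
    thus "density ?u ?g x \<le> (1 + 2 * d) * density v v' (x + k)" by (simp add: density_def mult_ac)
  qed
  also have "\<dots> = (1 + 2 * d) * integral {t..T} (density v v')"
  proof -
    have "continuous_on {s + k..T - k + k} (density v v')"
      by (rule continuous_on_subset[OF density_v_cont]) (use st k in auto)
    from integral_shift[OF this] show ?thesis using k by (simp add: o_def)
  qed
  finally have "reach s (T - k) (v t) (v T) ((1 + 2 * d) * integral {t..T} (density v v'))"
    using k by (intro reachI[OF p]) auto
  moreover have "reach 0 s \<alpha> (v t) (integral {0..s} (density v v'))"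
    using reach_v[of 0 s] st v_0 loop by simp
  ultimately have "reach 0 (T - k) \<alpha> \<beta> (integral {0..s} (density v v') + (1 + 2 * d) * integral {t..T} (density v v'))"
    using v_T k st by (intro reach_trans[of 0 s _ "v t"]) auto
  from reach_trans[OF this filler[OF \<sigma>, of "T - k"]] k
  have "reach 0 T \<alpha> \<beta> (integral {0..s} (density v v') + (1 + 2 * d) * integral {t..T} (density v v') + F)"
    by (auto simp: F_def)
  from energy_le_reach[OF this]
  have 1: "integral {s..t} (density v v') \<le> 2 * d * integral {t..T} (density v v') + F"
    using energy_split[of s t] st by (simp add: algebra_simps)
  have nn: "0 \<le> integral {x..y} (density v v')" if "0 \<le> x" "y \<le> T" for x y
    using that by (intro integral_nonneg density_v_integrable density_nonneg) auto
  have "integral {t..T} (density v v') \<le> energy"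
    using energy_split[of s t] nn[of 0 s] nn[of s t] st by simp
  hence "2 * d * integral {t..T} (density v v') \<le> 2 * d * energy" using d by (intro mult_left_mono) auto
  also have "\<dots> \<le> \<epsilon> * (2 * D * C0 + 4 * N * (Wm + (b - a)\<^sup>2) * \<epsilon>)"
  proof (cases "\<epsilon> \<le> T")
    case True
    have "2 * d * energy \<le> 2 * D * (\<epsilon> * C0)"
      using energy_long[OF True] d nn[of 0 T] D_nonneg by (intro mult_mono) (auto simp: d_def)
    moreover have "0 \<le> \<epsilon> * (4 * N * (Wm + (b - a)\<^sup>2) * \<epsilon>)"
      using \<epsilon>_pos N_nonneg Wm_nonneg by (intro mult_nonneg_nonneg add_nonneg_nonneg) auto
    ultimately show ?thesis by (simp add: algebra_simps)
  next
    case False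
    have "2 * d * energy \<le> 2 * (N * T) * (2 * (T * Wm + \<epsilon>\<^sup>2 * (b - a)\<^sup>2 / T))"
      using energy_short d nn[of 0 T] N_nonneg T_pos by (intro mult_mono) (auto simp: d_def)
    also have "\<dots> = 4 * N * (T\<^sup>2 * Wm + \<epsilon>\<^sup>2 * (b - a)\<^sup>2)"
      using T_pos by (simp add: field_simps power2_eq_square)
    also have "\<dots> \<le> 4 * N * (\<epsilon>\<^sup>2 * Wm + \<epsilon>\<^sup>2 * (b - a)\<^sup>2)"
      using False T_pos N_nonneg Wm_nonneg by (intro mult_left_mono add_right_mono mult_right_mono power_mono) auto
    also have "\<dots> = \<epsilon> * (4 * N * (Wm + (b - a)\<^sup>2) * \<epsilon>)"
      by (simp add: power2_eq_square algebra_simps)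
    also have "\<dots> \<le> \<epsilon> * (2 * D * C0 + 4 * N * (Wm + (b - a)\<^sup>2) * \<epsilon>)"
      using \<epsilon>_pos D_nonneg C0_nonneg by (intro mult_left_mono) auto
    finally show ?thesis .
  qed
  finally show ?thesis using 1 by (simp add: F_def distrib_left)
qed

text \<open>By 2 \<epsilon> sqrt W |v'| \<le> W + \<epsilon>^2 v'^2 the descent from
  \<open>m\<close> to the level \<open>a1\<close> costs at least \<epsilon> times the drop of
  \<Phi>; the factor 2 is used up by \<omega> \<ge> 1/2. The descent is part of a loop based at
  level \<open>m\<close>, for which \<open>loop_cost\<close> allows less.\<close>

lemma stays_above:
  assumes \<Phi>: "\<And>x. (\<Phi> has_real_derivative sqrt (W x)) (at x)"
    and m: "a1 < m" "m \<le> \<alpha>" "m \<le> \<beta>" and \<sigma>: "\<And>x. x \<in> {\<beta>..b} \<Longrightarrow> W x \<le> \<sigma>"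
    and small: "2 * D * C0 + 4 * N * (Wm + (b - a)\<^sup>2) * \<epsilon> + 2 * \<sigma> + 12 * (b - \<beta>)\<^sup>2 < \<Phi> m - \<Phi> a1"
    and t: "t \<in> {0..T}"
  shows "a1 < v t"
proof (rule ccontr)
  assume "\<not> a1 < v t"
  hence vt: "v t \<le> a1" by simp
  obtain s where s: "s \<in> {0..t}" "v s = m" using v_ivt[of 0 t m] t vt m v_0 by auto
  obtain u where u: "u \<in> {t..T}" "v u = m" using v_ivt[of t T m] t vt m v_T by auto
  have st: "s < t" using s vt m t by (cases "s = t") auto
  have mono: "\<Phi> x \<le> \<Phi> y" if "x \<le> y" for x y
    by (rule DERIV_nonneg_imp_nondecreasing[OF that]) (use \<Phi> W_nonneg in \<open>auto intro!: exI\<close>)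
  have "((\<lambda>x. sqrt (W (v x)) * v' x) has_integral (\<Phi> (v t) - \<Phi> (v s))) {s..t}"
  proof (rule fundamental_theorem_of_calculus)
    fix x assume x: "x \<in> {s..t}"
    have "(v has_real_derivative v' x) (at x within {s..t})"
      by (rule DERIV_subset[OF v_deriv]) (use x s t in auto)
    from DERIV_chain2[OF \<Phi> this] show "((\<lambda>x. \<Phi> (v x)) has_vector_derivative sqrt (W (v x)) * v' x) (at x within {s..t})"
      by (simp add: has_real_derivative_iff_has_vector_derivative)
  qed (use st in auto)
  from has_integral_mult_right[OF this, of "- \<epsilon>"]
  have hi: "((\<lambda>x. - \<epsilon> * (sqrt (W (v x)) * v' x)) has_integral (\<epsilon> * (\<Phi> m - \<Phi> (v t)))) {s..t}"
    using s(2) by (simp add: algebra_simps)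
  have "\<epsilon> * (\<Phi> m - \<Phi> a1) \<le> \<epsilon> * (\<Phi> m - \<Phi> (v t))"
    using mono[OF vt] \<epsilon>_pos by (intro mult_left_mono) auto
  also have "\<dots> \<le> integral {s..t} (density v v')"
  proof (rule has_integral_le[OF hi integrable_integral[OF density_v_integrable]])
    fix x assume x: "x \<in> {s..t}"
    hence xT: "x \<in> {0..T}" using s t by auto
    have "0 \<le> (sqrt (W (v x)) + \<epsilon> * v' x)\<^sup>2" by simp
    hence "- \<epsilon> * (sqrt (W (v x)) * v' x) \<le> (W (v x) + \<epsilon>\<^sup>2 * (v' x)\<^sup>2) * (1 / 2)"
      using W_nonneg[of "v x"] by (simp add: power2_sum power_mult_distrib algebra_simps)
    also have "\<dots> \<le> density v v' x" unfolding density_def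
      using \<omega>_bounds(1)[OF xT] W_nonneg[of "v x"] by (intro mult_left_mono) auto
    finally show "- \<epsilon> * (sqrt (W (v x)) * v' x) \<le> density v v' x" .
  qed (use s t in auto)
  also have "\<dots> \<le> integral {s..u} (density v v')"
    using s t u by (intro integral_subset_le density_v_integrable) (auto intro!: density_nonneg)
  also have "\<dots> \<le> \<epsilon> * (2 * D * C0 + 4 * N * (Wm + (b - a)\<^sup>2) * \<epsilon> + 2 * \<sigma> + 12 * (b - \<beta>)\<^sup>2)"
    using s u st by (intro loop_cost \<sigma>) auto
  finally show False using small \<epsilon>_pos by simp
qed

text \<open>Built from the momentum and scaled by \<omega>^2 so that the velocity cancels in its
  derivative by the Euler-Lagrange equation. Only a multiple of \<open>W (v t)\<close> is left, and
  its integral is O(\<epsilon>).\<close>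

definition ham :: "real \<Rightarrow> real" where
  "ham t = \<epsilon>\<^sup>2 * (\<omega> t * v' t)\<^sup>2 - (\<omega> t)\<^sup>2 * W (v t)"

lemma ham_deriv:
  assumes t: "t \<in> {0..T}"
  shows "(ham has_real_derivative - 2 * \<omega> t * \<omega>' t * W (v t)) (at t within {0..T})"
proof -
  note d1 = momentum_deriv[OF t] and d2 = \<omega>_has_deriv[OF t] and d3 = DERIV_chain2[OF W_deriv v_deriv[OF t]]
  have "(ham has_real_derivative \<epsilon>\<^sup>2 * (2 * (\<omega> t * v' t) * (deriv W (v t) * \<omega> t / (2 * \<epsilon>\<^sup>2))) -
     (2 * \<omega> t * \<omega>' t * W (v t) + (\<omega> t)\<^sup>2 * (deriv W (v t) * v' t))) (at t within {0..T})"
    unfolding ham_def[abs_def]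
    by (rule DERIV_cong[OF DERIV_diff[OF DERIV_cmult[OF DERIV_power[OF d1, of 2]] DERIV_mult[OF DERIV_power[OF d2, of 2] d3]]])
       (simp add: algebra_simps)
  thus ?thesis
    by (rule DERIV_cong) (use \<epsilon>_pos in \<open>simp add: field_simps power2_eq_square\<close>)
qed

lemma ham_diff:
  assumes "0 \<le> s" "s \<le> t" "t \<le> T"
  shows "\<bar>ham t - ham s\<bar> \<le> 8 * N * C0 * \<epsilon>"
proof -
  have hi: "((\<lambda>t. - 2 * \<omega> t * \<omega>' t * W (v t)) has_integral (ham t - ham s)) {s..t}"
  proof (rule fundamental_theorem_of_calculus)
    fix x assume x: "x \<in> {s..t}"
    show "(ham has_vector_derivative - 2 * \<omega> x * \<omega>' x * W (v x)) (at x within {s..t})"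
      unfolding has_real_derivative_iff_has_vector_derivative[symmetric]
      by (rule DERIV_subset[OF ham_deriv]) (use x assms in auto)
  qed (use assms in auto)
  have ci: "(\<lambda>t. 4 * N * W (v t)) integrable_on {x..y}" if "0 \<le> x" "y \<le> T" for x y
    using that by (intro integrable_continuous_real continuous_intros v_cont_sub)
  have "norm (integral {s..t} (\<lambda>t. - 2 * \<omega> t * \<omega>' t * W (v t))) \<le> integral {s..t} (\<lambda>t. 4 * N * W (v t))"
  proof (rule integral_norm_bound_integral)
    fix x assume x: "x \<in> {s..t}"
    hence xT: "x \<in> {0..T}" using assms by auto
    have "\<bar>\<omega> x\<bar> * \<bar>\<omega>' x\<bar> \<le> 2 * N"
      using \<omega>_bounds[OF xT] \<omega>'_bound[OF xT] by (intro mult_mono) auto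
    hence "2 * (\<bar>\<omega> x\<bar> * \<bar>\<omega>' x\<bar>) * W (v x) \<le> 2 * (2 * N) * W (v x)"
      using W_nonneg by (intro mult_right_mono) auto
    thus "norm (- 2 * \<omega> x * \<omega>' x * W (v x)) \<le> 4 * N * W (v x)"
      using W_nonneg[of "v x"] by (simp add: abs_mult mult_ac)
  qed (use hi ci assms in auto)
  also have "\<dots> \<le> integral {0..T} (\<lambda>t. 4 * N * W (v t))"
    using assms N_nonneg W_nonneg by (intro integral_subset_le ci) auto
  also have "\<dots> = 4 * N * integral {0..T} (\<lambda>t. W (v t))" by simp
  also have "\<dots> \<le> 4 * N * (2 * C0 * \<epsilon>)" using integral_W_le N_nonneg by (intro mult_left_mono) auto
  finally show ?thesis using integral_unique[OF hi] by simp
qed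

text \<open>Whatever the terminal velocity, \<open>ham T\<close> is at least -(\<omega> T)^2 W
  \<beta>. With the drift bound, the kinetic term at \<open>t\<close> falls short of the potential
  term by little, which the slack 1 - l^2 absorbs; the outer factor 4 compensates \<omega>^2 \<ge>
  1/4.\<close>

lemma speed_lower:
  assumes t: "t \<in> {0..T}" and \<sigma>: "W \<beta> \<le> \<sigma>" and l: "0 \<le> l" "4 * (4 * \<sigma> + 8 * N * C0 * \<epsilon>) \<le> (1 - l\<^sup>2) * W (v t)"
  shows "l * sqrt (W (v t)) \<le> \<epsilon> * \<bar>v' t\<bar>"
proof -
  define \<tau> where "\<tau> = 4 * \<sigma> + 8 * N * C0 * \<epsilon>"
  have T: "T \<in> {0..T}" using T_pos by auto
  have "(\<omega> T)\<^sup>2 * W \<beta> \<le> 2\<^sup>2 * \<sigma>"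
    using \<omega>_bounds[OF T] \<sigma> W_nonneg by (intro mult_mono power_mono) auto
  hence "(\<omega> T)\<^sup>2 * W (v T) \<le> 4 * \<sigma>" by (simp add: v_T)
  moreover have "0 \<le> \<epsilon>\<^sup>2 * (\<omega> T * v' T)\<^sup>2" by simp
  ultimately have "- (4 * \<sigma>) \<le> ham T" unfolding ham_def by linarith
  hence H: "- \<tau> \<le> ham t" using ham_diff[of t T] t by (simp add: \<tau>_def)
  have \<tau>0: "0 \<le> \<tau>" using \<sigma> W_nonneg[of \<beta>] N_nonneg C0_nonneg \<epsilon>_pos by (simp add: \<tau>_def)
  have w2: "(1 / 2)\<^sup>2 \<le> (\<omega> t)\<^sup>2" using \<omega>_bounds[OF t] by (intro power_mono) auto
  have "\<tau> \<le> (\<omega> t)\<^sup>2 * (4 * \<tau>)" using mult_right_mono[OF w2, of "4 * \<tau>"] \<tau>0 by (simp add: power2_eq_square)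
  also have "\<dots> \<le> (\<omega> t)\<^sup>2 * ((1 - l\<^sup>2) * W (v t))" using l by (intro mult_left_mono) (auto simp: \<tau>_def)
  finally have "(\<omega> t)\<^sup>2 * (l\<^sup>2 * W (v t)) \<le> (\<omega> t)\<^sup>2 * (\<epsilon>\<^sup>2 * (v' t)\<^sup>2)"
    using H by (simp add: ham_def power_mult_distrib algebra_simps)
  hence "l\<^sup>2 * W (v t) \<le> \<epsilon>\<^sup>2 * (v' t)\<^sup>2" using \<omega>_pos[OF t] by simp
  hence "(l * sqrt (W (v t)))\<^sup>2 \<le> (\<epsilon> * \<bar>v' t\<bar>)\<^sup>2" using W_nonneg by (simp add: power_mult_distrib)
  thus ?thesis by (rule power2_le_imp_le) (use \<epsilon>_pos in auto)
qed

text \<open>Counterpart of \<open>speed_lower\<close>, anchored at a time when the path rests at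
  \<open>b\<close>, where \<open>ham\<close> vanishes exactly.\<close>

lemma speed_upper:
  assumes t: "0 \<le> t" "t \<le> S" "S \<le> T" and S: "v' S = 0" "v S = b" and m: "0 \<le> m" "32 * N * C0 * \<epsilon> \<le> (m\<^sup>2 - 1) * W (v t)"
  shows "\<epsilon> * v' t \<le> m * sqrt (W (v t))"
proof -
  have tT: "t \<in> {0..T}" using t by auto
  have "ham S = 0" using S by (simp add: ham_def)
  hence H: "ham t \<le> 8 * N * C0 * \<epsilon>" using ham_diff[of t S] t by simp
  have 0: "0 \<le> 8 * N * C0 * \<epsilon>" using N_nonneg C0_nonneg \<epsilon>_pos by simp
  have w2: "(1 / 2)\<^sup>2 \<le> (\<omega> t)\<^sup>2" using \<omega>_bounds[OF tT] by (intro power_mono) auto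
  have "8 * N * C0 * \<epsilon> \<le> (\<omega> t)\<^sup>2 * (4 * (8 * N * C0 * \<epsilon>))"
    using mult_right_mono[OF w2, of "4 * (8 * N * C0 * \<epsilon>)"] 0 by (simp add: power2_eq_square)
  also have "\<dots> \<le> (\<omega> t)\<^sup>2 * ((m\<^sup>2 - 1) * W (v t))" using m by (intro mult_left_mono) auto
  finally have "(\<omega> t)\<^sup>2 * (\<epsilon>\<^sup>2 * (v' t)\<^sup>2) \<le> (\<omega> t)\<^sup>2 * (m\<^sup>2 * W (v t))"
    using H by (simp add: ham_def power_mult_distrib algebra_simps)
  hence "\<epsilon>\<^sup>2 * (v' t)\<^sup>2 \<le> m\<^sup>2 * W (v t)" using \<omega>_pos[OF tT] by simp
  hence "(\<epsilon> * v' t)\<^sup>2 \<le> (m * sqrt (W (v t)))\<^sup>2" using W_nonneg by (simp add: power_mult_distrib)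
  thus ?thesis by (rule power2_le_imp_le) (use m W_nonneg in auto)
qed

end

section \<open>Transition to the upper well\<close>

context double_well
begin

text \<open>The coefficient \<open>k\<close> solves \<open>2 * k * m * (m - 1) = c / 4 * k powr q\<close> for \<open>m = 2 / (1 - q)\<close>, and
  \<open>k * (barrier_time c r / 2) powr m = r\<close>; the factors 2 and 4 absorb \<open>1 / 2 \<le> \<omega> \<le> 2\<close>.\<close>

definition barrier_coeff :: "real \<Rightarrow> real" where
  "barrier_coeff c = (c * (1 - q)\<^sup>2 / (16 * (1 + q))) powr (1 / (1 - q))"

definition barrier_time :: "real \<Rightarrow> real \<Rightarrow> real" where
  "barrier_time c r = 2 * (r / barrier_coeff c) powr ((1 - q) / 2)"

end

text \<open>\<open>above\<close> and \<open>speed\<close> are the conclusions of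
  \<open>stays_above\<close> and \<open>speed_lower\<close>. Speed is controlled only up to the
  level \<open>b - r\<close>; beyond it the force bound \<open>near_b\<close> takes over.\<close>

locale layer_region = layer +
  fixes a1 r c l :: real
  assumes a1: "a < a1" and above: "\<And>t. t \<in> {0..T} \<Longrightarrow> a1 < v t"
    and r: "0 < r" and r_le: "r \<le> b - a" and c: "0 < c" and near_b: "\<And>x. b - r \<le> x \<Longrightarrow> x \<le> b \<Longrightarrow> deriv W x \<le> - c * (b - x) powr q"
    and \<beta>_near: "b - r < \<beta>"
    and l: "0 < l" and speed: "\<And>t. t \<in> {0..T} \<Longrightarrow> v t \<le> b - r \<Longrightarrow> l * sqrt (W (v t)) \<le> \<epsilon> * \<bar>v' t\<bar>"
begin

section \<open>Monotonicity up to a first hit\<close>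

lemma v_bounds: "t \<in> {0..T} \<Longrightarrow> a < v t \<and> v t \<le> b"
  using above[of t] a1 v_range[of t] by auto

lemma W_v_pos: "t \<in> {0..T} \<Longrightarrow> v t < b \<Longrightarrow> 0 < W (v t)"
  using v_bounds[of t] by (intro W_pos) auto

lemma v_deriv_at: "0 < t \<Longrightarrow> t < T \<Longrightarrow> (v has_real_derivative v' t) (at t)"
  using v_deriv[of t] by (simp add: at_within_Icc_at)

lemma no_low_interior_min:
  assumes "0 \<le> y" "y < m" "m < T" "v m < b - r" and min: "\<And>z. z \<in> {y..T} \<Longrightarrow> v m \<le> v z"
  shows False
proof -
  have "v' m = 0"
  proof (rule DERIV_local_min[OF v_deriv_at, of m "min (m - y) (T - m)"])
    show "\<forall>z. \<bar>m - z\<bar> < min (m - y) (T - m) \<longrightarrow> v m \<le> v z"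
    proof (intro allI impI min)
      fix z assume "\<bar>m - z\<bar> < min (m - y) (T - m)"
      thus "z \<in> {y..T}" by (simp add: abs_less_iff)
    qed
  qed (use assms in auto)
  hence "l * sqrt (W (v m)) \<le> 0" using speed[of m] assms by auto
  moreover have "0 < W (v m)" using assms r by (intro W_v_pos) auto
  ultimately show False using l by (auto simp: mult_le_0_iff)
qed

text \<open>The minimum of \<open>v\<close> over the interval from \<open>y\<close> to
  \<open>T\<close> is not at \<open>T\<close>, as \<beta> lies above \<open>b - r\<close>, and not
  at an interior point, where the speed would vanish; so it sits at \<open>y\<close>. Low levels are
  therefore never revisited.\<close>

lemma less_of_low:
  assumes "0 \<le> y" "y < x" "x \<le> T" "v x < b - r"
  shows "v y < v x"
proof -
  have xT: "x < T" using assms v_T \<beta>_near by (cases "x = T") auto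
  obtain m where m: "m \<in> {y..T}" "\<And>z. z \<in> {y..T} \<Longrightarrow> v m \<le> v z"
    using continuous_attains_inf[of "{y..T}" v] v_cont_sub[of y T] assms by auto
  have mx: "v m \<le> v x" using m(2)[of x] assms by auto
  hence "m \<noteq> T" using assms v_T \<beta>_near by auto
  hence "m = y" using no_low_interior_min[of y m] m mx assms by force
  hence "v y \<le> v x" using mx by simp
  moreover have "v y \<noteq> v x"
  proof
    assume "v y = v x"
    thus False using no_low_interior_min[of y x] m(2) \<open>m = y\<close> assms xT by auto
  qed
  ultimately show ?thesis by simp
qed

lemma momentum_antimono:
  assumes "0 \<le> s" "s \<le> t" "t \<le> T" and high: "\<And>y. y \<in> {s..t} \<Longrightarrow> b - r \<le> v y"
  shows "\<omega> t * v' t \<le> \<omega> s * v' s"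
proof -
  have cont: "continuous_on {s..t} (\<lambda>x. \<omega> x * v' x)"
    by (rule continuous_on_subset[of "{0..T}"]) (use assms in \<open>auto intro!: continuous_intros \<omega>_cont v'_cont\<close>)
  show ?thesis
  proof (rule DERIV_nonpos_imp_decreasing_open[OF assms(2) _ cont])
    fix x assume x: "s < x" "x < t"
    have xT: "x \<in> {0..T}" using x assms by auto
    have "((\<lambda>x. \<omega> x * v' x) has_real_derivative deriv W (v x) * \<omega> x / (2 * \<epsilon>\<^sup>2)) (at x)"
      using momentum_deriv[OF xT] x assms by (simp add: at_within_Icc_at)
    moreover have "deriv W (v x) \<le> 0"
      using near_b[of "v x"] high[of x] v_bounds[OF xT] x c order.trans[of _ "- c * (b - v x) powr q" 0] by auto
    hence "deriv W (v x) * \<omega> x / (2 * \<epsilon>\<^sup>2) \<le> 0"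
      using \<omega>_pos[OF xT] by (simp add: divide_nonpos_nonneg mult_nonpos_nonneg)
    ultimately show "\<exists>d. ((\<lambda>x. \<omega> x * v' x) has_real_derivative d) (at x) \<and> d \<le> 0" by blast
  qed
qed

text \<open>If \<open>v\<close> failed to increase from \<open>s\<close> to \<open>x\<close>, then
  by \<open>less_of_low\<close> it would stay at height at least \<open>b - r\<close> from
  \<open>s\<close> on. There the momentum decreases, so a nonpositive slope persists and the higher
  level \<open>v S\<close> is out of reach.\<close>

lemma strictly_increasing_to_first_hit:
  assumes S: "S \<in> {0..T}" and first: "\<And>t. 0 \<le> t \<Longrightarrow> t < S \<Longrightarrow> v t < v S" and sx: "0 \<le> s" "s < x" "x \<le> S"
  shows "v s < v x"
proof (rule ccontr)
  assume n: "\<not> v s < v x"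
  have hx: "b - r \<le> v x" using less_of_low[of s x] n sx S by (meson atLeastAtMost_iff linorder_not_le order.trans)
  have xS: "x < S" using first[of s] n sx by (cases "x = S") auto
  have high: "b - r \<le> v y" if "y \<in> {s..T}" for y
  proof (rule ccontr)
    assume y: "\<not> b - r \<le> v y"
    hence "s < y" using hx n that by (cases "y = s") auto
    hence "v s < v y" using less_of_low[of s y] y that sx by auto
    thus False using y n hx by auto
  qed
  obtain z where z: "s < z" "z < x" "v x - v s = (x - s) * v' z"
    by (rule MVT_real_derivative[of s x v v'])
       (use sx S v_cont_sub[of s x] in \<open>auto intro: v_deriv_at\<close>)
  have "v' z \<le> 0" using z n sx by (smt (verit) mult_pos_pos)
  hence pz: "\<omega> z * v' z \<le> 0" using \<omega>_pos[of z] z sx S by (auto simp: mult_le_0_iff)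
  obtain w where w: "x < w" "w < S" "v S - v x = (S - x) * v' w"
    by (rule MVT_real_derivative[of x S v v'])
       (use xS sx S v_cont_sub[of x S] in \<open>auto intro: v_deriv_at\<close>)
  have "\<omega> w * v' w \<le> \<omega> z * v' z"
    by (rule momentum_antimono) (use z w sx S high in auto)
  hence "v' w \<le> 0" using pz \<omega>_pos[of w] w sx S by (smt (verit) atLeastAtMost_iff mult_pos_pos)
  hence "v S \<le> v x" using w xS by (smt (verit) mult_pos_pos zero_less_mult_pos)
  thus False using first[of s] n sx by auto
qed

section \<open>Time needed to reach the upper well\<close>

lemma travel_bounds:
  assumes st: "0 \<le> s" "s < t" "t \<le> T" and low: "\<And>x. s < x \<Longrightarrow> x < t \<Longrightarrow> v x < b"
  shows "(\<And>x. s < x \<Longrightarrow> x < t \<Longrightarrow> k * sqrt (W (v x)) \<le> \<epsilon> * v' x) \<Longrightarrow> k * (t - s) \<le> \<epsilon> * (travel (v t) - travel (v s))"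
    and "(\<And>x. s < x \<Longrightarrow> x < t \<Longrightarrow> \<epsilon> * v' x \<le> k * sqrt (W (v x))) \<Longrightarrow> \<epsilon> * (travel (v t) - travel (v s)) \<le> k * (t - s)"
proof -
  have cont: "continuous_on {s..t} (\<lambda>x. travel (v x))"
    by (rule continuous_on_compose2[OF continuous_on_travel v_cont_sub]) (use st v_range in auto)
  obtain z where z: "s < z" "z < t" "travel (v t) - travel (v s) = (t - s) * (1 / sqrt (W (v z)) * v' z)"
  proof (rule MVT_real_derivative[OF st(2) cont])
    show "((\<lambda>x. travel (v x)) has_real_derivative 1 / sqrt (W (v x)) * v' x) (at x)" if x: "s < x" "x < t" for x
      by (rule DERIV_chain2[OF travel_deriv v_deriv_at]) (use x st low[of x] v_bounds[of x] in auto)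
  qed
  have Wz: "0 < sqrt (W (v z))" using z st low[of z] W_v_pos[of z] by auto
  have eq: "\<epsilon> * (travel (v t) - travel (v s)) = (t - s) * (\<epsilon> * v' z / sqrt (W (v z)))"
    using z(3) by simp
  show "k * (t - s) \<le> \<epsilon> * (travel (v t) - travel (v s))"
    \<comment> \<open>Only interior points matter, so \<open>t\<close> may be a time with
      \<open>v t = b\<close>, where 1 / sqrt W blows up but \<open>travel\<close> is still
      continuous.\<close>
    if "\<And>x. s < x \<Longrightarrow> x < t \<Longrightarrow> k * sqrt (W (v x)) \<le> \<epsilon> * v' x"
  proof -
    have "k \<le> \<epsilon> * v' z / sqrt (W (v z))" using that[OF z(1,2)] Wz by (simp add: pos_le_divide_eq)
    from mult_left_mono[OF this, of "t - s"] show ?thesis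
      unfolding eq using st by (simp only: mult.commute[of k])
  qed
  show "\<epsilon> * (travel (v t) - travel (v s)) \<le> k * (t - s)"
    if "\<And>x. s < x \<Longrightarrow> x < t \<Longrightarrow> \<epsilon> * v' x \<le> k * sqrt (W (v x))"
  proof -
    have "\<epsilon> * v' z / sqrt (W (v z)) \<le> k" using that[OF z(1,2)] Wz by (simp add: pos_divide_le_eq)
    from mult_left_mono[OF this, of "t - s"] show ?thesis
      unfolding eq using st by (simp only: mult.commute[of k])
  qed
qed

text \<open>Below \<open>b - r\<close> the path increases, so the speed bound holds without the
  absolute value and \<open>travel\<close> grows along it at rate at least \<open>l\<close> /
  \<epsilon>, with only \<open>travel b - travel \<alpha>\<close> to spend. The extra \<eta> makes
  the contradiction strict.\<close>

lemma reaches_near_b: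
  assumes \<eta>: "0 < \<eta>" and T: "((travel b - travel \<alpha>) / l + \<eta>) * \<epsilon> \<le> T"
  shows "\<exists>t\<in>{0..((travel b - travel \<alpha>) / l + \<eta>) * \<epsilon>}. b - r \<le> v t"
proof (rule ccontr)
  define t where "t = ((travel b - travel \<alpha>) / l + \<eta>) * \<epsilon>"
  assume "\<not> ?thesis"
  hence low: "v x < b - r" if "x \<in> {0..t}" for x using that by (force simp: t_def)
  have "0 \<le> travel b - travel \<alpha>" using travel_mono[of \<alpha> b] \<alpha>\<beta> by auto
  hence t: "0 < t" "t \<le> T" using l \<eta> \<epsilon>_pos T by (auto simp: t_def intro!: mult_pos_pos add_nonneg_pos)
  have "l * (t - 0) \<le> \<epsilon> * (travel (v t) - travel (v 0))"
  proof (rule travel_bounds(1))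
    fix x assume x: "0 < x" "x < t"
    have "mono_on {0..t} v"
    proof (rule mono_onI)
      fix y z assume "y \<in> {0..t}" "z \<in> {0..t}" "y \<le> z"
      thus "v y \<le> v z" using less_of_low[of y z] low[of z] t by (cases "y = z") auto
    qed
    hence "0 \<le> v' x" by (rule mono_on_imp_deriv_nonneg[OF _ v_deriv_at]) (use x t in auto)
    thus "l * sqrt (W (v x)) \<le> \<epsilon> * v' x" using speed[of x] low[of x] x t by auto
    show "v x < b" using low[of x] x r by auto
  qed (use t in auto)
  also have "\<dots> \<le> \<epsilon> * (travel b - travel \<alpha>)"
    using travel_mono[of "v t" b] v_range[of t] t v_0 \<epsilon>_pos by (intro mult_left_mono) auto
  finally have "l * t \<le> \<epsilon> * (travel b - travel \<alpha>)" by simp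
  moreover have "l * t = \<epsilon> * (travel b - travel \<alpha>) + l * \<eta> * \<epsilon>"
    using l by (simp add: t_def field_simps)
  moreover have "0 < l * \<eta> * \<epsilon>" using l \<eta> \<epsilon>_pos by simp
  ultimately show False by linarith
qed

lemma stays_near_b:
  assumes "0 \<le> t" "t \<le> y" "y \<le> T" "b - r \<le> v t"
  shows "b - r \<le> v y"
  using less_of_low[of t y] assms by (cases "t = y") force+

text \<open>Maximum principle for \<open>b - v\<close> against the barrier \<open>k * \<bar>s / \<epsilon>\<bar> powr m\<close> with \<open>m = 2 / (1 - q)\<close>, where
  \<open>s\<close> is the time measured with \<open>1 / \<omega>\<close>, centred at \<open>t0\<close>. The barrier vanishes at its centre, which
  forces \<open>v t0 = b\<close>.\<close>

lemma hits_b: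
  assumes t1: "0 \<le> t1" "b - r \<le> v t1" and t0: "t1 + barrier_time c r * \<epsilon> \<le> t0" "t0 + barrier_time c r * \<epsilon> \<le> T"
  shows "v t0 = b"
proof -
  define m where "m = 2 / (1 - q)"
  define k where "k = barrier_coeff c"
  define \<Lambda> where "\<Lambda> = barrier_time c r"
  have q1: "0 < 1 - q" using q_range by simp
  have m: "2 < m" "m - 2 = q * m" using q_range by (auto simp: m_def field_simps)
  have kpos: "0 < k" using c q_range by (auto simp: k_def barrier_coeff_def)
  have \<Lambda>pos: "0 < \<Lambda>" using r kpos by (simp add: \<Lambda>_def barrier_time_def k_def[symmetric])
  have k\<Lambda>: "k * (\<Lambda> / 2) powr m = r"
  proof -
    have "(\<Lambda> / 2) powr m = (r / k) powr ((1 - q) / 2 * m)"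
      by (simp add: \<Lambda>_def barrier_time_def k_def powr_powr)
    also have "(1 - q) / 2 * m = 1" using q1 by (simp add: m_def)
    finally show ?thesis using r kpos by simp
  qed
  have kq: "2 * k * m * (m - 1) = c / 4 * k powr q"
  proof -
    have "k powr (1 - q) = c * (1 - q)\<^sup>2 / (16 * (1 + q))"
      using q_range c by (simp add: k_def barrier_coeff_def powr_powr)
    moreover have "m * (m - 1) = 2 * (1 + q) / (1 - q)\<^sup>2"
      using q1 by (simp add: m_def field_simps power2_eq_square)
    moreover have "2 * (c * d\<^sup>2 / (16 * e)) * (2 * e / d\<^sup>2) = c / 4" if "d \<noteq> 0" "e \<noteq> 0" for d e :: real
      using that by (simp add: field_simps)
    from this[of "1 - q" "1 + q"] have "2 * (c * (1 - q)\<^sup>2 / (16 * (1 + q))) * (2 * (1 + q) / (1 - q)\<^sup>2) = c / 4"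
      using q_range by simp
    ultimately have "2 * (k powr (1 - q)) * (m * (m - 1)) = c / 4" by simp
    moreover have "k = k powr (1 - q) * k powr q" using kpos by (simp add: powr_add[symmetric])
    ultimately show ?thesis by (metis (no_types, opaque_lifting) mult.assoc mult.commute)
  qed
  define x1 where "x1 = t0 - \<Lambda> * \<epsilon>"
  define x2 where "x2 = t0 + \<Lambda> * \<epsilon>"
  have \<Lambda>\<epsilon>: "0 < \<Lambda> * \<epsilon>" using \<Lambda>pos \<epsilon>_pos by simp
  have x: "t1 \<le> x1" "x1 < t0" "t0 < x2" "x2 \<le> T" using t0 \<Lambda>\<epsilon> by (auto simp: x1_def x2_def \<Lambda>_def)
  have xT: "{x1..x2} \<subseteq> {0..T}" using x t1 by auto
  have \<omega>0: "\<omega> t \<noteq> 0" if "t \<in> {0..T}" for t using \<omega>_pos[OF that] by simp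
  have invc: "continuous_on {0..T} (\<lambda>t. 1 / \<omega> t)" using \<omega>0 by (intro continuous_intros \<omega>_cont) auto
  \<comment> \<open>Time with ds = dt / \<omega>, zero at \<open>t0\<close>. In it \<omega> v' is
    the derivative of \<open>v\<close>, and the equation becomes 2 \<epsilon>^2 v_ss = \<omega>^2
    W'(v), without a first-order term.\<close>
  define s where "s = (\<lambda>t. integral {0..t} (\<lambda>t. 1 / \<omega> t) - integral {0..t0} (\<lambda>t. 1 / \<omega> t))"
  have s': "(s has_real_derivative 1 / \<omega> t) (at t within {0..T})" if "t \<in> {0..T}" for t
    using integral_has_real_derivative[OF invc that] unfolding s_def by (auto intro!: derivative_eq_intros)
  have s_at: "(s has_real_derivative 1 / \<omega> t) (at t)" if "0 < t" "t < T" for t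
    using s'[of t] that by (simp add: at_within_Icc_at)
  have s_cont: "continuous_on {0..T} s" using s' by (rule DERIV_continuous_on)
  have s0: "s t0 = 0" by (simp add: s_def)
  have s_grow: "(y - z) / 2 \<le> s y - s z" if zy: "z < y" "0 \<le> z" "y \<le> T" for y z
  proof -
    obtain w where w: "z < w" "w < y" "s y - s z = (y - z) * (1 / \<omega> w)"
      by (rule MVT_real_derivative[of z y s "\<lambda>t. 1 / \<omega> t"])
         (use zy in \<open>auto intro!: s_at continuous_on_subset[OF s_cont]\<close>)
    have "1 / 2 \<le> 1 / \<omega> w" using \<omega>_bounds[of w] \<omega>_pos[of w] w that by (intro divide_left_mono) auto
    from mult_left_mono[OF this, of "y - z"] show ?thesis using w that by simp
  qed
  define B where "B = (\<lambda>t. k * \<bar>s t / \<epsilon>\<bar> powr m)"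
  \<comment> \<open>The derivative of \<open>B\<close> with respect to \<open>s\<close>, to be
    compared with \<omega> v'.\<close>
  define P where "P = (\<lambda>t. k * m / \<epsilon> * (sgn (s t / \<epsilon>) * \<bar>s t / \<epsilon>\<bar> powr (m - 1)))"
  have sd: "((\<lambda>t. s t / \<epsilon>) has_real_derivative 1 / \<omega> t / \<epsilon>) (at t)" if "0 < t" "t < T" for t
    using DERIV_cdivide[OF s_at[OF that]] .
  have B': "(B has_real_derivative P t / \<omega> t) (at t)" if "0 < t" "t < T" for t
  proof -
    have "1 < m" using m by simp
    have "(B has_real_derivative k * (m * (sgn (s t / \<epsilon>) * \<bar>s t / \<epsilon>\<bar> powr (m - 1)) * (1 / \<omega> t / \<epsilon>))) (at t)"
      unfolding B_def by (rule DERIV_cmult[OF DERIV_chain2[OF DERIV_abs_powr(1)[OF \<open>1 < m\<close>] sd[OF that]]])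
    thus ?thesis by (rule DERIV_cong) (simp add: P_def mult_ac)
  qed
  have P': "(P has_real_derivative k * m * (m - 1) * \<bar>s t / \<epsilon>\<bar> powr (m - 2) / (\<epsilon>\<^sup>2 * \<omega> t)) (at t)" if "0 < t" "t < T" for t
  proof -
    have "1 < m - 1" using m by simp
    have "(P has_real_derivative k * m / \<epsilon> * ((m - 1) * \<bar>s t / \<epsilon>\<bar> powr (m - 1 - 1) * (1 / \<omega> t / \<epsilon>))) (at t)"
      unfolding P_def by (rule DERIV_cmult[OF DERIV_chain2[OF DERIV_abs_powr(2)[OF \<open>1 < m - 1\<close>] sd[OF that]]])
    thus ?thesis by (rule DERIV_cong) (simp add: power2_eq_square mult_ac)
  qed
  define E where "E = (\<lambda>t. (b - v t) - B t)"
  have Bc: "continuous_on {x1..x2} B"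
    unfolding B_def using m xT \<epsilon>_pos
    by (intro continuous_intros continuous_on_powr' continuous_on_subset[OF s_cont]) auto
  have Ec: "continuous_on {x1..x2} E"
    unfolding E_def by (intro continuous_intros Bc continuous_on_subset[OF v_cont xT])
  obtain z where z: "z \<in> {x1..x2}" "\<And>y. y \<in> {x1..x2} \<Longrightarrow> E y \<le> E z"
    using continuous_attains_sup[OF compact_Icc _ Ec] x by auto
  have high: "b - r \<le> v y" if "y \<in> {x1..x2}" for y
    using stays_near_b[of t1 y] t1 x that by auto
  \<comment> \<open>At both edges the barrier is at least \<open>r\<close>, an upper bound for
    \<open>b - v\<close>, so a positive maximum of \<open>E\<close> is interior. The half lost in
    \<open>s_grow\<close> through \<omega> \<le> 2 is the one built into
    \<open>k\<Lambda>\<close>.\<close>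
  have edge: "r \<le> B y" if "y \<in> {x1, x2}" for y
  proof -
    have "\<Lambda> * \<epsilon> / 2 \<le> \<bar>s y\<bar>"
      using that s_grow[of x1 t0] s_grow[of t0 x2] x t1 s0 by (auto simp: x1_def x2_def)
    hence "\<Lambda> / 2 \<le> \<bar>s y / \<epsilon>\<bar>" using \<epsilon>_pos by (simp add: abs_divide pos_le_divide_eq)
    hence "(\<Lambda> / 2) powr m \<le> \<bar>s y / \<epsilon>\<bar> powr m" using \<Lambda>pos m by (intro powr_mono2) auto
    thus ?thesis using k\<Lambda> mult_left_mono[of "(\<Lambda> / 2) powr m" "\<bar>s y / \<epsilon>\<bar> powr m" k] kpos by (simp add: B_def)
  qed
  have "E z \<le> 0"
  proof (rule ccontr)
    assume "\<not> E z \<le> 0"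
    hence pos: "B z < b - v z" by (simp add: E_def)
    have "z \<noteq> x1" "z \<noteq> x2" using pos edge[of z] high[OF z(1)] by auto
    hence zi: "x1 < z" "z < x2" "0 < z" "z < T" using z x t1 by auto
    have Ed: "(E has_real_derivative - v' y - P y / \<omega> y) (at y)" if "x1 < y" "y < x2" for y
    proof -
      have y: "0 < y" "y < T" using that x t1 by auto
      show ?thesis unfolding E_def
        by (rule DERIV_cong[OF DERIV_diff[OF DERIV_diff[OF DERIV_const v_deriv_at[OF y]] B'[OF y]]]) simp
    qed
    have "- v' z - P z / \<omega> z = 0"
    proof (rule DERIV_local_max[OF Ed[OF zi(1,2)], of "min (z - x1) (x2 - z)"])
      show "\<forall>y. \<bar>z - y\<bar> < min (z - x1) (x2 - z) \<longrightarrow> E y \<le> E z"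
      proof (intro allI impI z(2))
        fix y assume "\<bar>z - y\<bar> < min (z - x1) (x2 - z)"
        thus "y \<in> {x1..x2}" by (simp add: abs_less_iff)
      qed
    qed (use zi in auto)
    hence F0: "- (\<omega> z * v' z) - P z = 0" using \<omega>0[of z] zi by (simp add: field_simps)
    \<comment> \<open>Derivative at \<open>z\<close> of the flux -(\<omega> v') - P, which equals
      \<omega> times the derivative of \<open>E\<close> and is zero at \<open>z\<close>. A positive
      value makes \<open>E\<close> increase just after \<open>z\<close>, against maximality.\<close>
    define F' where "F' = - (deriv W (v z) * \<omega> z / (2 * \<epsilon>\<^sup>2)) - k * m * (m - 1) * \<bar>s z / \<epsilon>\<bar> powr (m - 2) / (\<epsilon>\<^sup>2 * \<omega> z)"
    have zT: "z \<in> {0..T}" using zi by auto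
    have "((\<lambda>t. - (\<omega> t * v' t) - P t) has_real_derivative F') (at z)"
      unfolding F'_def using momentum_deriv[OF zT] P'[OF zi(3,4)] zi
      by (intro DERIV_diff DERIV_minus) (auto simp: at_within_Icc_at)
    moreover have "0 < F'"
    proof -
      have B0: "0 \<le> B z" using kpos by (simp add: B_def)
      have w: "1 / 2 \<le> \<omega> z" "0 < \<omega> z" using \<omega>_bounds[OF zT] \<omega>_pos[OF zT] by auto
      have "c * (b - v z) powr q \<le> - deriv W (v z)"
        using near_b[of "v z"] high[OF z(1)] v_bounds[OF zT] by simp
      \<comment> \<open>Positivity of \<open>E z\<close> enters here. By \<open>kq\<close> the
        barrier solves \<epsilon>^2 B_ss = (c / 8) B^q, and \<open>b - v\<close>, being larger,
        feels a strictly larger force.\<close>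
      moreover have "B z powr q < (b - v z) powr q"
        using pos B0 q_range by (intro powr_less_mono2) auto
      hence "c * B z powr q < c * (b - v z) powr q" using c by simp
      ultimately have 1: "c * B z powr q < - deriv W (v z)" by linarith
      have 2: "B z powr q = k powr q * \<bar>s z / \<epsilon>\<bar> powr (m - 2)"
        using kpos by (simp add: B_def powr_mult powr_powr m(2) mult.commute)
      have e: "0 < \<epsilon>\<^sup>2" using \<epsilon>_pos by simp
      have "k * m * (m - 1) * \<bar>s z / \<epsilon>\<bar> powr (m - 2) / (\<epsilon>\<^sup>2 * \<omega> z)
          = (k * m * (m - 1) * \<bar>s z / \<epsilon>\<bar> powr (m - 2) / \<epsilon>\<^sup>2) * (1 / \<omega> z)" by simp
      also have "\<dots> \<le> (k * m * (m - 1) * \<bar>s z / \<epsilon>\<bar> powr (m - 2) / \<epsilon>\<^sup>2) * 2"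
        using w kpos m by (intro mult_left_mono) (auto simp: divide_simps intro!: mult_nonneg_nonneg divide_nonneg_nonneg)
      also have "\<dots> = (2 * k * m * (m - 1)) * \<bar>s z / \<epsilon>\<bar> powr (m - 2) / \<epsilon>\<^sup>2" by simp
      also have "\<dots> = c * B z powr q / (4 * \<epsilon>\<^sup>2)" unfolding kq 2 by simp
      also have "\<dots> < - deriv W (v z) / (4 * \<epsilon>\<^sup>2)" using 1 e by (intro divide_strict_right_mono) auto
      also have "\<dots> = - deriv W (v z) * (1 / 2) / (2 * \<epsilon>\<^sup>2)" by simp
      also have "\<dots> \<le> - deriv W (v z) * \<omega> z / (2 * \<epsilon>\<^sup>2)"
      proof (intro divide_right_mono mult_left_mono w(1))
        have "0 \<le> c * B z powr q" using c by simp
        thus "0 \<le> - deriv W (v z)" using 1 by linarith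
      qed simp
      finally show ?thesis by (simp add: F'_def)
    qed
    ultimately obtain d where d: "0 < d" "\<And>h. 0 < h \<Longrightarrow> h < d \<Longrightarrow> - (\<omega> z * v' z) - P z < - (\<omega> (z + h) * v' (z + h)) - P (z + h)"
      using DERIV_pos_inc_right[of "\<lambda>t. - (\<omega> t * v' t) - P t" F' z] by blast
    define h where "h = min (d / 2) ((x2 - z) / 2)"
    have h: "0 < h" "h < d" "z + h < x2" using d(1) zi by (auto simp: h_def min_def field_simps)
    obtain y where y: "z < y" "y < z + h" "E (z + h) - E z = (z + h - z) * (- v' y - P y / \<omega> y)"
      by (rule MVT_real_derivative[of z "z + h" E "\<lambda>y. - v' y - P y / \<omega> y"])
         (use h zi in \<open>auto intro!: Ed continuous_on_subset[OF Ec]\<close>)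
    have "0 < - (\<omega> y * v' y) - P y" using d(2)[of "y - z"] F0 y h by auto
    moreover have wy: "0 < \<omega> y" using y h zi x by (intro \<omega>_pos) auto
    ultimately have "0 < (- (\<omega> y * v' y) - P y) / \<omega> y" by simp
    also have "\<dots> = - v' y - P y / \<omega> y" using wy by (simp add: field_simps)
    finally have "0 < E (z + h) - E z" using y(3) h by simp
    thus False using z(2)[of "z + h"] h zi by auto
  qed
  hence "E t0 \<le> 0" using z(2)[of t0] x by auto
  moreover have "B t0 = 0" using s0 m by (simp add: B_def)
  ultimately show ?thesis using v_range[of t0] x xT by (auto simp: E_def)
qed

text \<open>The barrier occupies \<open>barrier_time c r * \<epsilon>\<close> on either side of its
  centre, so twice that time must fit before \<open>T\<close>, while \<open>b\<close> is already
  attained at the centre.\<close>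

lemma hits_b_early:
  assumes \<eta>: "0 < \<eta>" and T: "((travel b - travel \<alpha>) / l + \<eta> + 2 * barrier_time c r) * \<epsilon> \<le> T"
  shows "\<exists>t\<in>{0..((travel b - travel \<alpha>) / l + \<eta> + barrier_time c r) * \<epsilon>}. v t = b"
proof -
  let ?L = "barrier_time c r" and ?A = "(travel b - travel \<alpha>) / l + \<eta>"
  have L: "0 \<le> ?L" by (simp add: barrier_time_def)
  hence L\<epsilon>: "0 \<le> ?L * \<epsilon>" using \<epsilon>_pos by simp
  have T': "?A * \<epsilon> + 2 * (?L * \<epsilon>) \<le> T" using T by (simp add: distrib_right mult.assoc)
  then obtain t where t: "t \<in> {0..?A * \<epsilon>}" "b - r \<le> v t"
    using reaches_near_b[OF \<eta>] L\<epsilon> by auto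
  have "v (?A * \<epsilon> + ?L * \<epsilon>) = b"
  proof (rule hits_b[OF _ t(2)])
    show "?A * \<epsilon> + ?L * \<epsilon> + ?L * \<epsilon> \<le> T" using T' by linarith
  qed (use t in auto)
  moreover have "0 \<le> ?A * \<epsilon>" using t by auto
  ultimately show ?thesis using L\<epsilon> by (intro bexI[of _ "?A * \<epsilon> + ?L * \<epsilon>"]) (auto simp: distrib_right)
qed

text \<open>\<open>S\<close> < \<open>T\<close> makes \<open>S\<close> an interior maximum once the
  path has to climb, so it rests at \<open>b\<close> there and \<open>speed_upper\<close> applies.
  Only the climb to \<open>b - r\<close> is timed, because the speed bound needs \<open>W\<close>
  bounded away from 0; a start at or above that level makes the claim trivial.\<close>

lemma hit_time_lower:
  assumes S: "0 \<le> S" "S < T" "v S = b" and inc: "strict_mono_on {0..S} v"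
    and m: "0 \<le> m" "\<And>x. a1 \<le> x \<Longrightarrow> x \<le> b - r \<Longrightarrow> 32 * N * C0 * \<epsilon> \<le> (m\<^sup>2 - 1) * W x"
  shows "\<epsilon> * (travel (b - r) - travel \<alpha>) \<le> m * S"
proof (cases "\<alpha> < b - r")
  case False
  have "a \<le> b - r" using r_le by simp
  hence "travel (b - r) \<le> travel \<alpha>" using False \<alpha>\<beta> by (intro travel_mono) auto
  hence "\<epsilon> * (travel (b - r) - travel \<alpha>) \<le> 0" using \<epsilon>_pos by (intro mult_nonneg_nonpos) auto
  also have "0 \<le> m * S" using m S by simp
  finally show ?thesis .
next
  case True
  obtain t where t: "t \<in> {0..S}" "v t = b - r" using v_ivt[of 0 S "b - r"] S True v_0 r by auto
  have t0: "0 < t" using t True v_0 by (cases "t = 0") auto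
  have S0: "0 < S" "t < S" using t t0 S r by (auto simp: less_le)
  have "v' S = 0"
  proof (rule DERIV_local_max[OF v_deriv_at[OF S0(1) S(2)], of "min S (T - S)"])
    show "\<forall>y. \<bar>S - y\<bar> < min S (T - S) \<longrightarrow> v y \<le> v S"
    proof (intro allI impI)
      fix y assume "\<bar>S - y\<bar> < min S (T - S)"
      hence "y \<in> {0..T}" by (simp add: abs_less_iff)
      thus "v y \<le> v S" using v_bounds[of y] S by simp
    qed
  qed (use S S0 in auto)
  have low: "v x < b - r" if "0 < x" "x < t" for x
    using strict_mono_onD[OF inc, of x t] that t by auto
  have "\<epsilon> * (travel (v t) - travel (v 0)) \<le> m * (t - 0)"
  proof (rule travel_bounds(2))
    fix x assume x: "0 < x" "x < t"
    show "v x < b" using low[OF x] r by simp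
    show "\<epsilon> * v' x \<le> m * sqrt (W (v x))"
    proof (rule speed_upper[where S = S])
      show "32 * N * C0 * \<epsilon> \<le> (m\<^sup>2 - 1) * W (v x)"
        using m(2)[of "v x"] low[OF x] above[of x] x S0 S by auto
    qed (use x S0 S m \<open>v' S = 0\<close> in auto)
  qed (use t0 S0 S in auto)
  also have "\<dots> \<le> m * S" using m S0 by (intro mult_left_mono) auto
  finally show ?thesis using t v_0 by simp
qed

lemma first_hit:
  assumes "t \<in> {0..T}" "v t = p"
  obtains S where "S \<in> {0..t}" "v S = p" "\<And>s. 0 \<le> s \<Longrightarrow> s < S \<Longrightarrow> v s \<noteq> p"
proof -
  define A where "A = {s \<in> {0..t}. v s = p}"
  have A: "closed A" unfolding A_def
    using continuous_closed_preimage_constant[OF v_cont_sub[of 0 t] closed_atLeastAtMost] assms by auto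
  have bd: "bdd_below A" by (rule bdd_belowI[of _ 0]) (auto simp: A_def)
  have ne: "A \<noteq> {}" using assms by (auto simp: A_def)
  have mem: "Inf A \<in> A" by (rule closed_contains_Inf[OF ne bd A])
  show ?thesis
  proof (rule that)
    show "Inf A \<in> {0..t}" "v (Inf A) = p" using mem by (auto simp: A_def)
    fix s assume s: "0 \<le> s" "s < Inf A"
    show "v s \<noteq> p"
    proof
      assume "v s = p"
      hence "s \<in> A" using s mem by (auto simp: A_def)
      thus False using cInf_lower[OF _ bd, of s] s by simp
    qed
  qed
qed

text \<open>Starting at or below \<open>p\<close>, the path lies strictly below \<open>p\<close>
  until its first hit by the intermediate value theorem, which is what
  \<open>strictly_increasing_to_first_hit\<close> needs.\<close>

lemma increasing_hit_exists:
  assumes t: "t \<in> {0..T}" "v t = p" and p: "\<alpha> \<le> p" "\<beta> \<le> p"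
  shows "\<exists>S\<in>{0..t}. increasing_hit T v p S"
proof -
  obtain S where S: "S \<in> {0..t}" "v S = p" "\<And>s. 0 \<le> s \<Longrightarrow> s < S \<Longrightarrow> v s \<noteq> p"
    using first_hit[OF t] by blast
  have below: "v s < p" if s: "0 \<le> s" "s < S" for s
  proof (rule ccontr)
    assume "\<not> v s < p"
    then obtain x where "x \<in> {0..s}" "v x = p" using v_ivt[of 0 s p] v_0 p s S t by auto
    thus False using S(3)[of x] s by auto
  qed
  have "strict_mono_on {0..S} v"
  proof (rule strict_mono_onI)
    fix x y assume "x \<in> {0..S}" "y \<in> {0..S}" "x < y"
    thus "v x < v y" using S t below by (intro strictly_increasing_to_first_hit[of S x y]) auto
  qed
  moreover have "S \<le> s" if "s \<in> {0..T}" "v s = p" for s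
    using S(3)[of s] that by force
  ultimately show ?thesis using S t by (intro bexI[of _ S]) (auto simp: increasing_hit_def)
qed

end

section \<open>Uniform constants\<close>

context double_well
begin

lemma Wm_exists: "\<exists>Wm. \<forall>x\<in>{a..b}. W x \<le> Wm"
proof -
  have "\<exists>x\<in>{a..b}. \<forall>y\<in>{a..b}. W y \<le> W x"
    by (rule continuous_attains_sup) (use a_less_b W_cont continuous_on_subset in auto)
  thus ?thesis by blast
qed

lemma W_lower_middle:
  assumes "a < x" "y < b"
  shows "\<exists>w>0. \<forall>z\<in>{x..y}. w \<le> W z"
proof (cases "x \<le> y")
  case True
  have "\<exists>u\<in>{x..y}. \<forall>z\<in>{x..y}. W u \<le> W z"
    by (rule continuous_attains_inf) (use True W_cont continuous_on_subset in auto)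
  then obtain u where "u \<in> {x..y}" "\<forall>z\<in>{x..y}. W u \<le> W z" by blast
  thus ?thesis using W_pos[of u] assms by (intro exI[of _ "W u"]) auto
qed (auto intro: exI[of _ 1])

lemma W_small_near_b:
  assumes "0 < \<sigma>"
  shows "\<exists>d>0. \<forall>x. \<bar>x - b\<bar> < d \<longrightarrow> W x \<le> \<sigma>"
proof -
  have "isCont W b" using W_has_deriv DERIV_isCont by blast
  then obtain d where "0 < d" "\<forall>x. \<bar>x - b\<bar> < d \<longrightarrow> \<bar>W x - W b\<bar> < \<sigma>"
    using assms unfolding continuous_at_real_range by (auto simp: real_norm_def)
  thus ?thesis using W_nonneg by (intro exI[of _ d]) auto
qed

text \<open>Serves the sharp limit: with \<open>c\<close> fixed and \<open>r\<close> shrinking, both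
  the time spent inside the barrier and the travel time above \<open>b - r\<close> disappear. The
  first relies on the exponent (1 - q) / 2 being positive.\<close>

lemma barrier_time_small:
  assumes "0 < c" "0 < e" "0 < r0"
  shows "\<exists>r>0. r \<le> r0 \<and> barrier_time c r < e \<and> travel b - travel (b - r) < e"
proof -
  have k: "0 < barrier_coeff c" using assms q_range by (auto simp: barrier_coeff_def)
  have "((\<lambda>r. 2 * (r / barrier_coeff c) powr ((1 - q) / 2)) \<longlongrightarrow> 2 * (0 / barrier_coeff c) powr ((1 - q) / 2)) (at_right 0)"
    using q_range k by (intro tendsto_intros tendsto_powr') (auto simp: eventually_at_right intro!: exI[of _ 1])
  hence "((\<lambda>r. barrier_time c r) \<longlongrightarrow> 0) (at_right 0)" by (simp add: barrier_time_def)
  hence 1: "\<forall>\<^sub>F r in at_right 0. barrier_time c r < e" using assms by (intro order_tendstoD) auto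
  have lim: "((\<lambda>r. b - r) \<longlongrightarrow> b) (at_right 0)" by (auto intro!: tendsto_eq_intros)
  have in_range: "\<forall>\<^sub>F r in at_right 0. b - r \<in> {a..b}"
    unfolding eventually_at_right_field using a_less_b by (intro exI[of _ "b - a"]) auto
  have "((\<lambda>r. travel (b - r)) \<longlongrightarrow> travel b) (at_right 0)"
    by (rule continuous_on_tendsto_compose[OF continuous_on_travel lim _ in_range]) (use a_less_b in auto)
  hence 2: "\<forall>\<^sub>F r in at_right 0. travel b - e < travel (b - r)" using assms by (intro order_tendstoD) auto
  have 3: "\<forall>\<^sub>F r in at_right 0. 0 < r \<and> r \<le> r0"
    unfolding eventually_at_right_field using assms by (intro exI[of _ r0]) auto
  from eventually_conj[OF 1 eventually_conj[OF 2 3]]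
  have "\<exists>r. barrier_time c r < e \<and> travel b - e < travel (b - r) \<and> 0 < r \<and> r \<le> r0"
    by (rule eventually_happens'[rotated]) simp
  thus ?thesis by (auto simp: algebra_simps)
qed

lemma layer_of_minimizer:
  assumes set: "layer_setting W a b q \<alpha>m \<kappa>\<^sub>0 T \<omega> \<omega>' \<alpha> \<beta> \<alpha>\<^sub>0"
    and osc: "(SUP t\<in>{0..T}. \<omega> t) - (INF t\<in>{0..T}. \<omega> t) < \<delta>" and \<delta>: "\<delta> \<le> 1 / 2"
    and Wm: "\<forall>x\<in>{a..b}. W x \<le> Wm"
    and \<epsilon>: "0 < \<epsilon>" and min: "G_minimizer W T \<omega> (\<alpha> \<epsilon>) (\<beta> \<epsilon>) \<epsilon> v"
  shows "\<exists>v'. layer W a b q T \<omega> \<epsilon> \<omega>' v v' (\<alpha> \<epsilon>) (\<beta> \<epsilon>) (C1_norm T \<omega> \<omega>') \<delta> Wm"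
proof -
  interpret s: layer_setting W a b q \<alpha>m \<kappa>\<^sub>0 T \<omega> \<omega>' \<alpha> \<beta> \<alpha>\<^sub>0 by (rule set)
  have \<omega>c: "continuous_on {0..T} \<omega>" using s.\<omega>_deriv by (rule DERIV_continuous_on)
  have bdd: "bdd_above (f ` {0..T})" "bdd_below (f ` {0..T})" if "continuous_on {0..T} f" for f :: "real \<Rightarrow> real"
    using compact_imp_bounded[OF compact_continuous_image[OF that compact_Icc]]
    by (auto intro: bounded_imp_bdd_above bounded_imp_bdd_below)
  have up: "f t \<le> (SUP t\<in>{0..T}. f t)" if "continuous_on {0..T} f" "t \<in> {0..T}" for f :: "real \<Rightarrow> real" and t
    by (rule cSUP_upper[OF that(2) bdd(1)[OF that(1)]])
  have low: "(INF t\<in>{0..T}. f t) \<le> f t" if "continuous_on {0..T} f" "t \<in> {0..T}" for f :: "real \<Rightarrow> real" and t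
    by (rule cINF_lower[OF bdd(2)[OF that(1)] that(2)])
  have osc': "\<bar>\<omega> x - \<omega> y\<bar> \<le> \<delta>" if "x \<in> {0..T}" "y \<in> {0..T}" for x y
    using up[OF \<omega>c that(1)] up[OF \<omega>c that(2)] low[OF \<omega>c that(1)] low[OF \<omega>c that(2)] osc by linarith
  have 0: "0 \<in> {0..T}" using s.T_range by simp
  \<comment> \<open>\<omega> starts at 1 and oscillates by at most \<delta> \<le> 1/2.\<close>
  have near1: "1 / 2 \<le> \<omega> t" "\<omega> t \<le> 2" if "t \<in> {0..T}" for t
    using osc'[OF that 0] s.\<omega>_0 \<delta> by linarith+
  have N: "\<bar>\<omega>' t\<bar> \<le> C1_norm T \<omega> \<omega>'" if t: "t \<in> {0..T}" for t
  proof -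
    have "\<bar>\<omega> t\<bar> \<le> (SUP t\<in>{0..T}. \<bar>\<omega> t\<bar>)" "\<bar>\<omega>' t\<bar> \<le> (SUP t\<in>{0..T}. \<bar>\<omega>' t\<bar>)"
      using t by (auto intro!: up continuous_intros \<omega>c s.\<omega>'_cont)
    thus ?thesis unfolding C1_norm_def using abs_ge_zero[of "\<omega> t"] by linarith
  qed
  interpret e: weighted_energy W "deriv W" T \<omega> \<epsilon>
    by unfold_locales (use W_has_deriv continuous_on_deriv_W W_nonneg s.T_range \<omega>c s.\<omega>_pos \<epsilon> in auto)
  obtain v' where v': "\<And>t. t \<in> {0..T} \<Longrightarrow> (v has_real_derivative v' t) (at t within {0..T})"
    "continuous_on {0..T} v'"
    "\<And>t. t \<in> {0..T} \<Longrightarrow> ((\<lambda>t. \<omega> t * v' t) has_real_derivative deriv W (v t) * \<omega> t / (2 * \<epsilon>\<^sup>2)) (at t within {0..T})"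
    "v 0 = \<alpha> \<epsilon>" "v T = \<beta> \<epsilon>"
    "\<And>u g. pw_deriv 0 T u g \<Longrightarrow> u 0 = \<alpha> \<epsilon> \<Longrightarrow> u T = \<beta> \<epsilon> \<Longrightarrow>
       integral {0..T} (e.density v v') \<le> integral {0..T} (e.density u g)"
    using e.minimizer_regular[OF min] by blast
  have "\<alpha> \<epsilon> \<in> {a..b}" "\<beta> \<epsilon> \<in> {a..b}" using s.\<alpha>_range[OF \<epsilon>] s.\<beta>_range[OF \<epsilon>] s.\<alpha>m_range by auto
  hence "layer_axioms W a b T \<omega> \<epsilon> \<omega>' v v' (\<alpha> \<epsilon>) (\<beta> \<epsilon>) (C1_norm T \<omega> \<omega>') \<delta> Wm"
    by (intro layer_axioms.intro v' s.\<omega>_deriv N near1 osc') (use Wm in auto)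
  hence "layer W a b q T \<omega> \<epsilon> \<omega>' v v' (\<alpha> \<epsilon>) (\<beta> \<epsilon>) (C1_norm T \<omega> \<omega>') \<delta> Wm"
    by (intro layer.intro double_well_axioms e.weighted_energy_axioms)
  thus ?thesis by blast
qed

text \<open>Interval, weight, boundary values and minimizer are quantified inside, so
  \<open>e\<close> is a threshold depending only on the listed constants; this is the uniformity
  required of the threshold for \<epsilon>.\<close>

definition region_below :: "real \<Rightarrow> real \<Rightarrow> real \<Rightarrow> real \<Rightarrow> real \<Rightarrow> real \<Rightarrow> real \<Rightarrow> real \<Rightarrow> bool" where
  "region_below e \<alpha>m N \<delta> Wm r c l \<longleftrightarrow> (\<forall>T \<omega> \<epsilon> \<omega>' v v' \<alpha> \<beta>. layer W a b q T \<omega> \<epsilon> \<omega>' v v' \<alpha> \<beta> N \<delta> Wm \<longrightarrow>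
     \<epsilon> < e \<longrightarrow> b - \<beta> < e \<longrightarrow> \<alpha>m \<le> \<alpha> \<longrightarrow> \<alpha>m \<le> \<beta> \<longrightarrow>
     layer_region W a b q T \<omega> \<epsilon> \<omega>' v v' \<alpha> \<beta> N \<delta> Wm ((a + \<alpha>m) / 2) r c l)"

lemma region_belowD:
  assumes "region_below e \<alpha>m N \<delta> Wm r c l" "layer W a b q T \<omega> \<epsilon> \<omega>' v v' \<alpha> \<beta> N \<delta> Wm"
    "\<epsilon> < e" "b - \<beta> < e" "\<alpha>m \<le> \<alpha>" "\<alpha>m \<le> \<beta>"
  shows "layer_region W a b q T \<omega> \<epsilon> \<omega>' v v' \<alpha> \<beta> N \<delta> Wm ((a + \<alpha>m) / 2) r c l"
  using assms unfolding region_below_def by blast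

lemma sqrt_W_antiderivative_less:
  assumes \<Phi>: "\<And>x. (\<Phi> has_real_derivative sqrt (W x)) (at x)" and xy: "a < x" "x < y" "y < b"
  shows "\<Phi> x < \<Phi> y"
proof (rule DERIV_pos_imp_increasing[OF xy(2)])
  fix z assume "x \<le> z" "z \<le> y"
  hence "0 < W z" using xy by (intro W_pos) auto
  thus "\<exists>d. (\<Phi> has_real_derivative d) (at z) \<and> 0 < d" using \<Phi> by (intro exI[of _ "sqrt (W z)"]) auto
qed

text \<open>The four error terms of \<open>stays_above\<close> have to fit below \<open>gap\<close>:
  the oscillation term takes one half, by the hypothesis on \<delta>, and the terms in \<epsilon>,
  \<sigma> and \<open>b - \<beta>\<close> take one eighth each. The speed bound shares (1 - l^2) w
  equally between its terms in \<sigma> and \<epsilon>.\<close>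

lemma region_params:
  assumes \<Phi>: "\<And>x. (\<Phi> has_real_derivative sqrt (W x)) (at x)"
    and \<alpha>m: "a < \<alpha>m" "\<alpha>m < b" and N: "0 \<le> N"
    and r: "0 < r" "r \<le> b - a" and c: "0 < c"
    and near: "\<And>x. b - r \<le> x \<Longrightarrow> x \<le> b \<Longrightarrow> deriv W x \<le> - c * (b - x) powr q"
    and l: "0 < l" "l < 1"
    and \<delta>: "2 * \<delta> * (2 * Wm + 12 * (b - a)\<^sup>2) \<le> (\<Phi> \<alpha>m - \<Phi> ((a + \<alpha>m) / 2)) / 2"
  shows "\<exists>e>0. region_below e \<alpha>m N \<delta> Wm r c l"
proof -
  define a1 where "a1 = (a + \<alpha>m) / 2"
  define gap where "gap = \<Phi> \<alpha>m - \<Phi> a1"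
  define C0 where "C0 = 2 * Wm + 12 * (b - a)\<^sup>2"
  have a1: "a < a1" "a1 < \<alpha>m" using \<alpha>m by (auto simp: a1_def)
  have "\<Phi> a1 < \<Phi> \<alpha>m" by (rule sqrt_W_antiderivative_less[OF \<Phi>]) (use a1 \<alpha>m in auto)
  hence gap: "0 < gap" by (simp add: gap_def)
  obtain w where w: "0 < w" "\<And>x. x \<in> {a1..b - r} \<Longrightarrow> w \<le> W x"
    using W_lower_middle[of a1 "b - r"] a1 r by auto
  have l2: "0 < 1 - l\<^sup>2" using l by (simp add: power_less_one_iff abs_square_less_1)
  define \<sigma> where "\<sigma> = min (gap / 16) ((1 - l\<^sup>2) * w / 32)"
  have \<sigma>: "0 < \<sigma>" "2 * \<sigma> \<le> gap / 8" "16 * \<sigma> \<le> (1 - l\<^sup>2) * w / 2"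
  proof -
    show "0 < \<sigma>" using gap w l2 by (simp add: \<sigma>_def)
    have "\<sigma> \<le> gap / 16" "\<sigma> \<le> (1 - l\<^sup>2) * w / 32" by (simp_all add: \<sigma>_def)
    thus "2 * \<sigma> \<le> gap / 8" "16 * \<sigma> \<le> (1 - l\<^sup>2) * w / 2" by linarith+
  qed
  obtain d where d: "0 < d" "\<And>x. \<bar>x - b\<bar> < d \<Longrightarrow> W x \<le> \<sigma>" using W_small_near_b[OF \<sigma>(1)] by blast
  define A where "A = 4 * N * (Wm + (b - a)\<^sup>2)"
  define B where "B = 32 * N * C0"
  have ex: "\<exists>e>0. e * \<bar>A\<bar> \<le> gap / 8 \<and> e * \<bar>B\<bar> \<le> (1 - l\<^sup>2) * w / 2 \<and> 12 * e\<^sup>2 \<le> gap / 8 \<and> e \<le> d \<and> e \<le> r"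
  proof -
    have lim: "((\<lambda>e. e * \<bar>A\<bar>) \<longlongrightarrow> 0) (at_right 0)" "((\<lambda>e. e * \<bar>B\<bar>) \<longlongrightarrow> 0) (at_right 0)"
      "((\<lambda>e::real. 12 * e\<^sup>2) \<longlongrightarrow> 0) (at_right 0)" "((\<lambda>e::real. e) \<longlongrightarrow> 0) (at_right 0)"
      by (auto intro!: tendsto_eq_intros)
    have "\<forall>\<^sub>F e in at_right 0. e * \<bar>A\<bar> < gap / 8" "\<forall>\<^sub>F e in at_right 0. e * \<bar>B\<bar> < (1 - l\<^sup>2) * w / 2"
      "\<forall>\<^sub>F e::real in at_right 0. 12 * e\<^sup>2 < gap / 8" "\<forall>\<^sub>F e::real in at_right 0. e < d" "\<forall>\<^sub>F e::real in at_right 0. e < r"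
      using order_tendstoD(2)[OF lim(1), of "gap / 8"] order_tendstoD(2)[OF lim(2), of "(1 - l\<^sup>2) * w / 2"]
        order_tendstoD(2)[OF lim(3), of "gap / 8"] order_tendstoD(2)[OF lim(4), of d] order_tendstoD(2)[OF lim(4), of r]
        gap l2 w d r by auto
    moreover have "\<forall>\<^sub>F e::real in at_right 0. 0 < e" by (simp add: eventually_at_right_less)
    ultimately have "\<forall>\<^sub>F e in at_right 0. 0 < e \<and> e * \<bar>A\<bar> \<le> gap / 8 \<and> e * \<bar>B\<bar> \<le> (1 - l\<^sup>2) * w / 2 \<and> 12 * e\<^sup>2 \<le> gap / 8 \<and> e \<le> d \<and> e \<le> r"
      by eventually_elim simp
    thus ?thesis by (rule eventually_happens'[rotated]) simp
  qed
  then obtain e where e: "0 < e" "e * \<bar>A\<bar> \<le> gap / 8" "e * \<bar>B\<bar> \<le> (1 - l\<^sup>2) * w / 2" "12 * e\<^sup>2 \<le> gap / 8" "e \<le> d" "e \<le> r"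
    by blast
  show ?thesis
    unfolding region_below_def
  proof (intro exI[of _ e] conjI allI impI e(1))
    fix T \<omega> \<epsilon> \<omega>' v v' \<alpha> \<beta>
    assume L: "layer W a b q T \<omega> \<epsilon> \<omega>' v v' \<alpha> \<beta> N \<delta> Wm" and \<epsilon>: "\<epsilon> < e" and \<beta>: "b - \<beta> < e" and am: "\<alpha>m \<le> \<alpha>" "\<alpha>m \<le> \<beta>"
    interpret L: layer W a b q T \<omega> \<epsilon> \<omega>' v v' \<alpha> \<beta> N \<delta> Wm by (rule L)
    have \<beta>b: "\<beta> \<le> b" using L.\<alpha>\<beta> by auto
    have W\<sigma>: "W x \<le> \<sigma>" if "x \<in> {\<beta>..b}" for x using d(2)[of x] that \<beta> e by auto
    have eA: "A * \<epsilon> \<le> gap / 8"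
    proof -
      have "A * \<epsilon> \<le> \<bar>A\<bar> * e" using L.\<epsilon>_pos \<epsilon> by (intro mult_mono) auto
      thus ?thesis using e(2) by (simp add: mult.commute)
    qed
    have eB: "B * \<epsilon> \<le> (1 - l\<^sup>2) * w / 2"
    proof -
      have "B * \<epsilon> \<le> \<bar>B\<bar> * e" using L.\<epsilon>_pos \<epsilon> by (intro mult_mono) auto
      thus ?thesis using e(3) by (simp add: mult.commute)
    qed
    have e\<beta>: "12 * (b - \<beta>)\<^sup>2 \<le> gap / 8"
    proof -
      have "(b - \<beta>)\<^sup>2 \<le> e\<^sup>2" using \<beta> \<beta>b by (intro power_mono) auto
      thus ?thesis using e(4) by linarith
    qed
    have C0: "L.C0 = C0" by (simp add: L.C0_def C0_def)
    have above: "a1 < v t" if "t \<in> {0..T}" for t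
    proof (rule L.stays_above[OF \<Phi> a1(2) am W\<sigma> _ that])
      have "2 * \<delta> * L.C0 \<le> gap / 2" using \<delta> by (simp add: C0 C0_def gap_def a1_def)
      thus "2 * \<delta> * L.C0 + 4 * N * (Wm + (b - a)\<^sup>2) * \<epsilon> + 2 * \<sigma> + 12 * (b - \<beta>)\<^sup>2 < \<Phi> \<alpha>m - \<Phi> a1"
        using eA e\<beta> \<sigma>(2) gap unfolding A_def[symmetric] gap_def[symmetric] by linarith
    qed
    show "layer_region W a b q T \<omega> \<epsilon> \<omega>' v v' \<alpha> \<beta> N \<delta> Wm ((a + \<alpha>m) / 2) r c l"
      unfolding a1_def[symmetric]
    proof (intro layer_region.intro layer_region_axioms.intro L near)
      show "a < a1" "0 < r" "r \<le> b - a" "0 < c" "0 < l" using a1 r c l by auto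
      show "a1 < v t" if "t \<in> {0..T}" for t by (rule above[OF that])
      show "b - r < \<beta>" using \<beta> e by auto
      show "l * sqrt (W (v t)) \<le> \<epsilon> * \<bar>v' t\<bar>" if t: "t \<in> {0..T}" "v t \<le> b - r" for t
      proof (rule L.speed_lower[OF t(1) W\<sigma>])
        have "(1 - l\<^sup>2) * w \<le> (1 - l\<^sup>2) * W (v t)" using above[OF t(1)] w(2)[of "v t"] t l2 by (intro mult_left_mono) auto
        moreover have "4 * (4 * \<sigma> + 8 * N * L.C0 * \<epsilon>) = 16 * \<sigma> + B * \<epsilon>" by (simp add: B_def C0)
        ultimately show "4 * (4 * \<sigma> + 8 * N * L.C0 * \<epsilon>) \<le> (1 - l\<^sup>2) * W (v t)" using \<sigma>(3) eB by linarith
      qed (use \<beta>b l in auto)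
    qed
  qed
qed

end

text \<open>A form of 1 / (1 + \<kappa>) \<ge> 1 - \<kappa> that also covers negative
  \<open>x\<close>: the loss is charged to the upper bound \<open>B\<close>.\<close>

lemma div_perturb:
  fixes x B \<kappa> y :: real
  assumes "x \<le> B" "0 \<le> B" "0 < \<kappa>"
  shows "x - \<kappa> * B \<le> x / (1 + \<kappa>)"
proof -
  have "(x - \<kappa> * B) * (1 + \<kappa>) = x - \<kappa> * (B - x) - \<kappa> * \<kappa> * B" by (simp add: algebra_simps)
  also have "\<dots> \<le> x"
    using assms by (smt (verit) mult_nonneg_nonneg)
  finally show ?thesis using assms(3) by (simp add: pos_le_divide_eq)
qed

context double_well
begin

text \<open>The hitting time rescaled by \<open>\<epsilon>\<close> is squeezed between \<open>travel (b - r) - travel \<alpha>\<close> and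
  \<open>travel b - travel \<alpha>\<close>, up to errors that vanish with \<open>r\<close> and \<open>\<kappa>\<close>.\<close>

lemma hit_time_limit:
  assumes \<alpha>m: "a < \<alpha>m" "\<alpha>m < b" and r0: "0 < r0" "r0 \<le> b - a" and c: "0 < c"
    and near: "\<And>x. b - r0 \<le> x \<Longrightarrow> x \<le> b \<Longrightarrow> deriv W x \<le> - c * (b - x) powr q"
    and \<Phi>: "\<And>x. (\<Phi> has_real_derivative sqrt (W x)) (at x)"
    and \<delta>: "2 * \<delta> * (2 * Wm + 12 * (b - a)\<^sup>2) \<le> (\<Phi> \<alpha>m - \<Phi> ((a + \<alpha>m) / 2)) / 2"
    and T: "0 < T" and N: "0 \<le> N"
    and \<alpha>: "\<And>\<epsilon>. 0 < \<epsilon> \<Longrightarrow> \<alpha> \<epsilon> \<in> {\<alpha>m..b}" and \<beta>: "\<And>\<epsilon>. 0 < \<epsilon> \<Longrightarrow> \<beta> \<epsilon> \<in> {\<alpha>m..b}"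
    and \<alpha>_lim: "(\<alpha> \<longlongrightarrow> \<alpha>\<^sub>0) (at_right 0)" and \<alpha>\<^sub>0: "\<alpha>\<^sub>0 \<in> {a..b}" and \<beta>_lim: "(\<beta> \<longlongrightarrow> b) (at_right 0)"
    and layer: "\<forall>\<^sub>F \<epsilon> in at_right 0. \<exists>v'. layer W a b q T \<omega> \<epsilon> \<omega>' (v \<epsilon>) v' (\<alpha> \<epsilon>) (\<beta> \<epsilon>) N \<delta> Wm"
    and hit: "\<forall>\<^sub>F \<epsilon> in at_right 0. increasing_hit T (v \<epsilon>) b (S \<epsilon>)"
  shows "((\<lambda>\<epsilon>. S \<epsilon> / \<epsilon>) \<longlongrightarrow> transition_length W b \<alpha>\<^sub>0) (at_right 0)"
proof (rule tendstoI)
  fix e :: real assume e: "0 < e"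
  define B where "B = travel b"
  have B: "0 \<le> B" using travel_mono[of a b] a_less_b by (simp add: B_def)
  \<comment> \<open>Relative error of both speed bounds, 1 / (1 + \<kappa>) from below and 1 +
    \<kappa> from above. As the travel times involved do not exceed \<open>B\<close>, the induced
    error is at most e / 8.\<close>
  define \<kappa> where "\<kappa> = e / (8 * (B + 1))"
  have \<kappa>: "0 < \<kappa>" "\<kappa> * B \<le> e / 8"
    using e B by (auto simp: \<kappa>_def field_simps)
  obtain r where r: "0 < r" "r \<le> r0" "barrier_time c r < e / 8" "travel b - travel (b - r) < e / 8"
    using barrier_time_small[OF c _ r0(1), of "e / 8"] e by auto
  define l where "l = 1 / (1 + \<kappa>)"
  have l: "0 < l" "l < 1" using \<kappa> by (auto simp: l_def)
  define a1 where "a1 = (a + \<alpha>m) / 2"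
  obtain w where w: "0 < w" "\<And>x. x \<in> {a1..b - r} \<Longrightarrow> w \<le> W x"
    using W_lower_middle[of a1 "b - r"] r \<alpha>m by (auto simp: a1_def)
  have "\<exists>e0>0. region_below e0 \<alpha>m N \<delta> Wm r c l"
    by (rule region_params[OF \<Phi> \<alpha>m N r(1) _ c _ l \<delta>]) (use r r0 near in auto)
  then obtain e0 where e0: "0 < e0" "region_below e0 \<alpha>m N \<delta> Wm r c l" by blast
  define C0 where "C0 = 2 * Wm + 12 * (b - a)\<^sup>2"
  \<comment> \<open>With \<open>l\<close> and \<open>r\<close> fixed, \<open>K * \<epsilon>\<close>
    bounds the time that \<open>hits_b_early\<close> requires, so it fits below \<open>T\<close> for
    small \<epsilon>.\<close>
  define K where "K = B / l + e / 8 + 2 * barrier_time c r"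
  have id: "((\<lambda>\<epsilon>::real. \<epsilon>) \<longlongrightarrow> 0) (at_right 0)" by (auto intro!: tendsto_eq_intros)
  have ev1: "\<forall>\<^sub>F \<epsilon> in at_right 0. K * \<epsilon> < T"
    by (rule order_tendstoD(2)[OF tendsto_mult_right_zero[OF id] T])
  have ev2: "\<forall>\<^sub>F \<epsilon> in at_right 0. 32 * N * C0 * \<epsilon> < ((1 + \<kappa>)\<^sup>2 - 1) * w"
    by (rule order_tendstoD(2)[OF tendsto_mult_right_zero[OF id]])
       (use \<kappa> w in \<open>auto intro!: mult_pos_pos simp: power2_eq_square algebra_simps add_pos_pos\<close>)
  have ev3: "\<forall>\<^sub>F \<epsilon> in at_right 0. \<epsilon> < e0" by (rule order_tendstoD(2)[OF id e0(1)])
  have ev4: "\<forall>\<^sub>F \<epsilon> in at_right 0. b - e0 < \<beta> \<epsilon>" by (rule order_tendstoD(1)[OF \<beta>_lim]) (use e0 in simp)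
  have ev5: "\<forall>\<^sub>F \<epsilon>::real in at_right 0. 0 < \<epsilon>" by (rule eventually_at_right_less)
  have ev6: "\<forall>\<^sub>F \<epsilon> in at_right 0. dist (travel (\<alpha> \<epsilon>)) (travel \<alpha>\<^sub>0) < e / 8"
  proof -
    have "\<forall>\<^sub>F \<epsilon> in at_right 0. \<alpha> \<epsilon> \<in> {a..b}"
      using ev5 by eventually_elim (use \<alpha> \<alpha>m in force)
    from continuous_on_tendsto_compose[OF continuous_on_travel \<alpha>_lim \<alpha>\<^sub>0 this]
    show ?thesis using e by (intro tendstoD) auto
  qed
  have tl: "transition_length W b \<alpha>\<^sub>0 = travel b - travel \<alpha>\<^sub>0"
    using \<alpha>\<^sub>0 by (intro transition_length_eq) auto
  show "\<forall>\<^sub>F \<epsilon> in at_right 0. dist (S \<epsilon> / \<epsilon>) (transition_length W b \<alpha>\<^sub>0) < e"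
    using layer hit ev1 ev2 ev3 ev4 ev5 ev6
  proof eventually_elim
    case (elim \<epsilon>)
    then obtain v' where L: "layer W a b q T \<omega> \<epsilon> \<omega>' (v \<epsilon>) v' (\<alpha> \<epsilon>) (\<beta> \<epsilon>) N \<delta> Wm" by blast
    interpret L: layer_region W a b q T \<omega> \<epsilon> \<omega>' "v \<epsilon>" v' "\<alpha> \<epsilon>" "\<beta> \<epsilon>" N \<delta> Wm a1 r c l
      unfolding a1_def by (rule region_belowD[OF e0(2) L]) (use elim \<alpha>[of \<epsilon>] \<beta>[of \<epsilon>] in auto)
    define x where "x = travel b - travel (\<alpha> \<epsilon>)"
    have tr: "0 \<le> travel (\<alpha> \<epsilon>)" "travel (\<alpha> \<epsilon>) \<le> travel b"
      using travel_mono[of a "\<alpha> \<epsilon>"] travel_mono[of "\<alpha> \<epsilon>" b] L.\<alpha>\<beta> by auto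
    have x: "0 \<le> x" "x \<le> B" using tr by (auto simp: x_def B_def)
    have "x / l \<le> B / l" using x l by (intro divide_right_mono) auto
    hence "(x / l + e / 8 + 2 * barrier_time c r) * \<epsilon> \<le> K * \<epsilon>"
      unfolding K_def using elim(7) by (intro mult_right_mono) auto
    hence le: "(x / l + e / 8 + 2 * barrier_time c r) * \<epsilon> < T" using elim(3) by linarith
    then obtain t where t: "t \<in> {0..(x / l + e / 8 + barrier_time c r) * \<epsilon>}" "v \<epsilon> t = b"
      using L.hits_b_early[of "e / 8"] e by (auto simp: x_def)
    have bt: "0 \<le> barrier_time c r" by (simp add: barrier_time_def)
    have tle: "(x / l + e / 8 + barrier_time c r) * \<epsilon> \<le> (x / l + e / 8 + 2 * barrier_time c r) * \<epsilon>"
      using bt elim(7) by (intro mult_right_mono) auto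
    have S: "0 \<le> S \<epsilon>" "v \<epsilon> (S \<epsilon>) = b" "strict_mono_on {0..S \<epsilon>} (v \<epsilon>)" "S \<epsilon> \<le> t"
      using elim(2) t tle le by (auto simp: increasing_hit_def)
    have ST: "S \<epsilon> < T" using S(4) t tle le by auto
    have up: "S \<epsilon> / \<epsilon> \<le> x / l + e / 8 + barrier_time c r"
      using S(4) t elim(7) by (simp add: pos_divide_le_eq)
    have "x / l = x + \<kappa> * x" by (simp add: l_def algebra_simps)
    also have "\<dots> \<le> x + e / 8" using mult_left_mono[OF x(2), of \<kappa>] \<kappa> by linarith
    finally have up': "S \<epsilon> / \<epsilon> \<le> x + e / 8 + e / 8 + e / 8" using up r(3) by linarith
    have "\<epsilon> * (travel (b - r) - travel (\<alpha> \<epsilon>)) \<le> (1 + \<kappa>) * S \<epsilon>"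
    proof (rule L.hit_time_lower[OF S(1) ST S(2,3)])
      fix y assume y: "a1 \<le> y" "y \<le> b - r"
      have "32 * N * L.C0 * \<epsilon> \<le> ((1 + \<kappa>)\<^sup>2 - 1) * w" using elim(4) by (simp add: L.C0_def C0_def)
      also have "\<dots> \<le> ((1 + \<kappa>)\<^sup>2 - 1) * W y"
        using w(2)[of y] y \<kappa> by (intro mult_left_mono) (auto simp: power2_eq_square algebra_simps)
      finally show "32 * N * L.C0 * \<epsilon> \<le> ((1 + \<kappa>)\<^sup>2 - 1) * W y" .
    qed (use \<kappa> in auto)
    hence lo: "(travel (b - r) - travel (\<alpha> \<epsilon>)) / (1 + \<kappa>) \<le> S \<epsilon> / \<epsilon>"
      using elim(7) \<kappa> by (simp add: field_simps)
    have "travel (b - r) \<le> B" unfolding B_def using L.r L.r_le by (intro travel_mono) auto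
    hence "travel (b - r) - travel (\<alpha> \<epsilon>) \<le> B" using tr by linarith
    from div_perturb[OF this B \<kappa>(1)] lo \<kappa>(2)
    have lo': "travel (b - r) - travel (\<alpha> \<epsilon>) - e / 8 \<le> S \<epsilon> / \<epsilon>" by linarith
    have d: "\<bar>travel (\<alpha> \<epsilon>) - travel \<alpha>\<^sub>0\<bar> < e / 8" using elim(8) by (simp add: dist_real_def)
    \<comment> \<open>Each side has lost at most four times e / 8.\<close>
    show ?case unfolding tl dist_real_def abs_less_iff
      using d up' lo' r(4) e unfolding x_def abs_less_iff by linarith
  qed
qed

end

theorem lemma3p10:
  fixes W :: "real \<Rightarrow> real" and a b q :: real
  assumes "double_well W a b q"
  shows "\<exists>(M :: (real \<Rightarrow> real) \<Rightarrow> real)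
          (C :: real \<Rightarrow> real \<Rightarrow> real \<Rightarrow> real)
          (\<delta> :: real \<Rightarrow> real \<Rightarrow> real \<Rightarrow> real)
          (\<epsilon>\<^sub>0 :: real \<Rightarrow> real \<Rightarrow> real \<Rightarrow> (real \<Rightarrow> real) \<Rightarrow> real).
    (\<forall>\<rho>. 0 < M \<rho>) \<and>
    (\<forall>\<alpha>m N \<kappa>\<^sub>0. 0 < C \<alpha>m N \<kappa>\<^sub>0) \<and>
    (\<forall>\<alpha>m N \<kappa>\<^sub>0. 0 < \<delta> \<alpha>m N \<kappa>\<^sub>0) \<and>
    (\<forall>\<alpha>m N \<kappa>\<^sub>0 \<rho>. 0 < \<epsilon>\<^sub>0 \<alpha>m N \<kappa>\<^sub>0 \<rho>) \<and>
    (\<forall>\<alpha>m \<kappa>\<^sub>0 T \<omega> \<omega>' \<alpha> \<beta> \<alpha>\<^sub>0 \<rho> N.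
      layer_setting W a b q \<alpha>m \<kappa>\<^sub>0 T \<omega> \<omega>' \<alpha> \<beta> \<alpha>\<^sub>0 \<longrightarrow>
      N = C1_norm T \<omega> \<omega>' \<longrightarrow>
      (SUP t\<in>{0..T}. \<omega> t) - (INF t\<in>{0..T}. \<omega> t) < \<delta> \<alpha>m N \<kappa>\<^sub>0 \<longrightarrow>
      (\<rho> \<longlongrightarrow> 0) (at_right 0) \<longrightarrow>
      (\<forall>\<epsilon>>0. \<bar>\<beta> \<epsilon> - b\<bar> \<le> \<rho> \<epsilon>) \<longrightarrow>
      (\<forall>\<epsilon>>0. \<alpha> \<epsilon> \<in> {\<alpha>m..b} \<and> \<beta> \<epsilon> \<in> {\<alpha>m..b}) \<longrightarrow>
      (\<lambda>\<epsilon>. d_W W (\<alpha> \<epsilon>) \<alpha>\<^sub>0) \<in> o[at_right 0](\<lambda>\<epsilon>. \<epsilon>) \<longrightarrow>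
      (\<lambda>\<epsilon>. d_W W (\<beta> \<epsilon>) b) \<in> o[at_right 0](\<lambda>\<epsilon>. \<epsilon>) \<longrightarrow>
      (\<exists>\<theta> :: real \<Rightarrow> real.
        (\<forall>\<epsilon>>0. \<theta> \<epsilon> \<le> b) \<and>
        (\<exists>e>0. antimono_on {0<..<e} \<theta>) \<and>
        (\<theta> \<longlongrightarrow> b) (at_right 0) \<and>
        (\<lambda>\<epsilon>. d_W W (\<theta> \<epsilon>) b) \<in> o[at_right 0](\<lambda>\<epsilon>. \<epsilon>) \<and>
        (\<forall>\<epsilon> v. 0 < \<epsilon> \<longrightarrow> \<epsilon> < \<epsilon>\<^sub>0 \<alpha>m N \<kappa>\<^sub>0 \<rho> \<longrightarrow>
           G_minimizer W T \<omega> (\<alpha> \<epsilon>) (\<beta> \<epsilon>) \<epsilon> v \<longrightarrow>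
           (\<exists>!S. increasing_hit T v (\<theta> \<epsilon>) S) \<and>
           (\<forall>S. increasing_hit T v (\<theta> \<epsilon>) S \<longrightarrow> S / \<epsilon> \<le> M \<rho>)) \<and>
        (\<forall>v S. (\<forall>\<^sub>F \<epsilon> in at_right 0. G_minimizer W T \<omega> (\<alpha> \<epsilon>) (\<beta> \<epsilon>) \<epsilon> (v \<epsilon>) \<and>
                   increasing_hit T (v \<epsilon>) (\<theta> \<epsilon>) (S \<epsilon>)) \<longrightarrow>
           ((\<lambda>\<epsilon>. S \<epsilon> / \<epsilon>) \<longlongrightarrow> transition_length W b \<alpha>\<^sub>0) (at_right 0)) \<and>
        (\<forall>\<epsilon>. 0 < \<epsilon> \<longrightarrow> \<epsilon> < \<epsilon>\<^sub>0 \<alpha>m N \<kappa>\<^sub>0 \<rho> \<longrightarrow>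
           \<theta> \<epsilon> \<ge> b - C \<alpha>m N \<kappa>\<^sub>0 * max (b - \<beta> \<epsilon>) (\<epsilon> powr (1 / (1 + q))))))"
proof -
  interpret double_well W a b q by (rule assms)
  obtain r0 c where r0: "0 < r0" "0 < c" "r0 < b - a"
    and near: "\<And>x. b - r0 \<le> x \<Longrightarrow> x \<le> b \<Longrightarrow> deriv W x \<le> - c * (b - x) powr q"
    using deriv_W_near_b by blast
  obtain Wm where Wm: "\<forall>x\<in>{a..b}. W x \<le> Wm" using Wm_exists by blast
  have "continuous_on UNIV (\<lambda>x. sqrt (W x))" by (intro continuous_intros W_cont)
  then obtain \<Phi> where \<Phi>: "(\<Phi> has_real_derivative sqrt (W x)) (at x)" for x
    using einterval_antiderivative[of "-\<infinity>" "\<infinity>" "\<lambda>x. sqrt (W x)"]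
    by (auto simp: continuous_on_eq_continuous_at has_real_derivative_iff_has_vector_derivative)
  define C0 where "C0 = 2 * Wm + 12 * (b - a)\<^sup>2"
  have C0: "0 \<le> C0" using Wm[rule_format, of a] a_less_b by (simp add: C0_def)
  define gap where "gap = (\<lambda>m. \<Phi> m - \<Phi> ((a + m) / 2))"
  have gap: "0 < gap m" if "a < m" "m < b" for m
    unfolding gap_def diff_gt_0_iff_gt by (rule sqrt_W_antiderivative_less[OF \<Phi>]) (use that in auto)
  \<comment> \<open>The first entry keeps \<omega> between 1/2 and 2; the second gives 2 \<delta> C0
    \<le> gap / 2, the share granted in \<open>region_params\<close>. Outside (a, b) no setting
    exists, and 1 merely keeps \<delta> positive.\<close>
  define \<delta> where "\<delta> = (\<lambda>m. if a < m \<and> m < b then min (1 / 2) (gap m / (4 * (C0 + 1))) else 1)"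
  have \<delta>: "0 < \<delta> m" for m using gap[of m] C0 by (auto simp: \<delta>_def)
  have \<delta>': "\<delta> m \<le> 1 / 2" "2 * \<delta> m * (2 * Wm + 12 * (b - a)\<^sup>2) \<le> (\<Phi> m - \<Phi> ((a + m) / 2)) / 2" if "a < m" "m < b" for m
  proof -
    have \<delta>m: "\<delta> m = min (1 / 2) (gap m / (4 * (C0 + 1)))" using that by (simp add: \<delta>_def)
    show "\<delta> m \<le> 1 / 2" unfolding \<delta>m by (rule min.cobounded1)
    have "\<delta> m \<le> gap m / (4 * (C0 + 1))" unfolding \<delta>m by (rule min.cobounded2)
    hence "\<delta> m * (4 * (C0 + 1)) \<le> gap m" using C0 by (subst (asm) pos_le_divide_eq) auto
    moreover have "0 \<le> \<delta> m" using \<delta>[of m] by simp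
    moreover have gapm: "\<Phi> m - \<Phi> ((a + m) / 2) = gap m" by (simp add: gap_def)
    ultimately show "2 * \<delta> m * (2 * Wm + 12 * (b - a)\<^sup>2) \<le> (\<Phi> m - \<Phi> ((a + m) / 2)) / 2"
      unfolding C0_def[symmetric] gapm by (simp add: algebra_simps)
  qed
  \<comment> \<open>An implication, so that a positive threshold can be chosen for all arguments,
    inadmissible ones included. It makes both \<epsilon> and the rate \<rho>, which dominates
    \<open>b - \<beta> \<epsilon>\<close>, fall below the threshold of
    \<open>region_below\<close>.\<close>
  define P where "P = (\<lambda>m N \<rho> e0. a < m \<and> m < b \<and> 0 \<le> N \<and> (\<rho> \<longlongrightarrow> 0) (at_right 0) \<longrightarrow>
    (\<exists>e. region_below e m N (\<delta> m) Wm r0 c (1 / 2) \<and> (\<forall>\<epsilon>. 0 < \<epsilon> \<longrightarrow> \<epsilon> < e0 \<longrightarrow> \<epsilon> < e \<and> \<rho> \<epsilon> < e)))"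
  have ex: "\<exists>e0>0. P m N \<rho> e0" for m N :: real and \<rho> :: "real \<Rightarrow> real"
  proof (cases "a < m \<and> m < b \<and> 0 \<le> N \<and> (\<rho> \<longlongrightarrow> 0) (at_right 0)")
    case True
    hence m: "a < m" "m < b" "0 \<le> N" and \<rho>: "(\<rho> \<longlongrightarrow> 0) (at_right 0)" by auto
    have "\<exists>e>0. region_below e m N (\<delta> m) Wm r0 c (1 / 2)"
      by (rule region_params[OF \<Phi> m r0(1) _ r0(2) near _ _ \<delta>'(2)[OF m(1,2)]]) (use r0 in auto)
    then obtain e where e: "0 < e" "region_below e m N (\<delta> m) Wm r0 c (1 / 2)" by blast
    obtain d where "0 < d" "\<And>\<epsilon>. 0 < \<epsilon> \<Longrightarrow> \<epsilon> < d \<Longrightarrow> \<rho> \<epsilon> < e"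
      using order_tendstoD(2)[OF \<rho> e(1)] unfolding eventually_at_right_field by auto
    thus ?thesis unfolding P_def using e by (intro exI[of _ "min e d"]) auto
  qed (auto simp: P_def intro: exI[of _ 1])
  define e0 where "e0 = (\<lambda>m N \<rho>. SOME e0. 0 < e0 \<and> P m N \<rho> e0)"
  have e0: "0 < e0 m N \<rho>" "P m N \<rho> (e0 m N \<rho>)" for m N \<rho>
    using someI_ex[OF ex[of m N \<rho>]] unfolding e0_def by auto
  \<comment> \<open>The time that \<open>hits_b_early\<close> requires for \<open>l = 1 / 2\<close>
    and \<eta> = 1; dividing by \<open>l\<close> doubles \<open>travel b\<close>. It is determined
    by \<open>W\<close> and the choices made for \<open>W\<close>, so \<open>M\<close> can be
    constant in \<rho>.\<close>
  define K where "K = 2 * travel b + 1 + 2 * barrier_time c r0"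
  have K: "0 < K"
  proof -
    have "0 \<le> travel b" using travel_mono[of a b] a_less_b by simp
    moreover have "0 \<le> barrier_time c r0" by (simp add: barrier_time_def)
    ultimately show ?thesis unfolding K_def by linarith
  qed
  show ?thesis
  \<comment> \<open>\<open>C\<close> = 1 suffices because the level \<theta> is never below
    \<beta>.\<close>
  proof (rule exI[of _ "\<lambda>_. K"], rule exI[of _ "\<lambda>_ _ _. 1"], rule exI[of _ "\<lambda>m _ _. \<delta> m"],
      rule exI[of _ "\<lambda>m N _ \<rho>. e0 m N \<rho>"], intro conjI allI impI, goal_cases)
    case (5 \<alpha>m \<kappa>\<^sub>0 T \<omega> \<omega>' \<alpha> \<beta> \<alpha>\<^sub>0 \<rho> N)
    note set = 5(1) and N = 5(2) and osc = 5(3) and \<rho> = 5(4,5) and \<alpha>\<beta> = 5(6)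
    interpret s: layer_setting W a b q \<alpha>m \<kappa>\<^sub>0 T \<omega> \<omega>' \<alpha> \<beta> \<alpha>\<^sub>0 by (rule set)
    note \<alpha>m = s.\<alpha>m_range
    have T: "0 < T" using s.T_range by simp
    have lay: "\<exists>v'. layer W a b q T \<omega> \<epsilon> \<omega>' v v' (\<alpha> \<epsilon>) (\<beta> \<epsilon>) N (\<delta> \<alpha>m) Wm"
      if "0 < \<epsilon>" "G_minimizer W T \<omega> (\<alpha> \<epsilon>) (\<beta> \<epsilon>) \<epsilon> v" for \<epsilon> v
      unfolding N by (rule layer_of_minimizer[OF set osc \<delta>'(1)[OF \<alpha>m] Wm that])
    have N0: "0 \<le> N"
    proof -
      have \<omega>c: "continuous_on {0..T} \<omega>" using s.\<omega>_deriv by (rule DERIV_continuous_on)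
      have "0 \<le> (SUP t\<in>{0..T}. \<bar>f t\<bar>)" if f: "continuous_on {0..T} f" for f :: "real \<Rightarrow> real"
      proof -
        have "bdd_above ((\<lambda>t. \<bar>f t\<bar>) ` {0..T})"
          by (intro bounded_imp_bdd_above compact_imp_bounded compact_continuous_image compact_Icc continuous_intros f)
        from cSUP_upper[OF _ this, of 0] T show ?thesis using abs_ge_zero[of "f 0"] by auto
      qed
      from this[OF \<omega>c] this[OF s.\<omega>'_cont] show ?thesis by (simp add: N C1_norm_def)
    qed
    \<comment> \<open>On intervals too short to guarantee a dead core, the level must still be at
      least \<beta> and be hit by an increasing path. If \<alpha> < \<beta>, the terminal value is
      hit at \<open>T\<close> at the latest; otherwise \<alpha> is hit at time 0.\<close>
    define \<theta> where "\<theta> = (\<lambda>\<epsilon>. if K * \<epsilon> \<le> T then b else max (\<alpha> \<epsilon>) (\<beta> \<epsilon>))"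
    have ev: "\<forall>\<^sub>F \<epsilon> in at_right 0. \<theta> \<epsilon> = b"
      unfolding eventually_at_right_field
      by (intro exI[of _ "T / K"]) (use T K in \<open>auto simp: \<theta>_def pos_less_divide_eq mult.commute\<close>)
    have hit: "\<exists>S. increasing_hit T v (\<theta> \<epsilon>) S \<and> S \<le> K * \<epsilon>"
      if \<epsilon>: "0 < \<epsilon>" "\<epsilon> < e0 \<alpha>m N \<rho>" and min: "G_minimizer W T \<omega> (\<alpha> \<epsilon>) (\<beta> \<epsilon>) \<epsilon> v" for \<epsilon> v
    proof -
      obtain v' where L: "layer W a b q T \<omega> \<epsilon> \<omega>' v v' (\<alpha> \<epsilon>) (\<beta> \<epsilon>) N (\<delta> \<alpha>m) Wm"
        using lay[OF \<epsilon>(1) min] by blast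
      obtain e where e: "region_below e \<alpha>m N (\<delta> \<alpha>m) Wm r0 c (1 / 2)" "\<epsilon> < e" "\<rho> \<epsilon> < e"
        using e0(2)[of \<alpha>m N \<rho>] \<alpha>m N0 \<rho>(1) \<epsilon> unfolding P_def by blast
      have "b - \<beta> \<epsilon> < e" using \<rho>(2)[rule_format, OF \<epsilon>(1)] e(3) by linarith
      then interpret L: layer_region W a b q T \<omega> \<epsilon> \<omega>' v v' "\<alpha> \<epsilon>" "\<beta> \<epsilon>" N "\<delta> \<alpha>m" Wm "(a + \<alpha>m) / 2" r0 c "1 / 2"
        using \<alpha>\<beta> \<epsilon> by (intro region_belowD[OF e(1) L e(2)]) auto
      show ?thesis
      proof (cases "K * \<epsilon> \<le> T")
        case True
        have "0 \<le> travel (\<alpha> \<epsilon>)" using travel_mono[of a "\<alpha> \<epsilon>"] L.\<alpha>\<beta> by auto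
        hence "(travel b - travel (\<alpha> \<epsilon>)) / (1 / 2) + 1 + 2 * barrier_time c r0 \<le> K" by (simp add: K_def)
        from mult_right_mono[OF this, of \<epsilon>] \<epsilon>
        have le: "((travel b - travel (\<alpha> \<epsilon>)) / (1 / 2) + 1 + 2 * barrier_time c r0) * \<epsilon> \<le> K * \<epsilon>" by simp
        have "0 \<le> barrier_time c r0" by (simp add: barrier_time_def)
        hence le': "((travel b - travel (\<alpha> \<epsilon>)) / (1 / 2) + 1 + barrier_time c r0) * \<epsilon>
            \<le> ((travel b - travel (\<alpha> \<epsilon>)) / (1 / 2) + 1 + 2 * barrier_time c r0) * \<epsilon>"
          using \<epsilon> by (intro mult_right_mono) auto
        obtain t where t: "0 \<le> t" "t \<le> ((travel b - travel (\<alpha> \<epsilon>)) / (1 / 2) + 1 + barrier_time c r0) * \<epsilon>" "v t = b"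
          using L.hits_b_early[OF zero_less_one order.trans[OF le True]] by auto
        have tK: "t \<le> K * \<epsilon>" using t(2) le le' by linarith
        obtain S where "S \<in> {0..t}" "increasing_hit T v b S"
          using L.increasing_hit_exists[of t b] t tK True L.\<alpha>\<beta> by auto
        thus ?thesis using tK True by (intro exI[of _ S]) (auto simp: \<theta>_def)
      next
        case False
        have "\<exists>S\<in>{0..T}. increasing_hit T v (\<theta> \<epsilon>) S"
        proof (cases "\<alpha> \<epsilon> < \<beta> \<epsilon>")
          case True
          thus ?thesis using L.increasing_hit_exists[of T "\<beta> \<epsilon>"] L.v_T False T by (auto simp: \<theta>_def)
        next
          case 2: False
          hence "increasing_hit T v (\<theta> \<epsilon>) 0"
            using L.v_0 False T by (auto simp: \<theta>_def increasing_hit_def strict_mono_on_def)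
          thus ?thesis using T by (intro bexI[of _ 0]) auto
        qed
        thus ?thesis using False by force
      qed
    qed
    have unique: "S = S'" if "increasing_hit T v \<theta> S" "increasing_hit T v \<theta> S'" for v \<theta> S S'
      by (rule order_antisym) (use that in \<open>auto simp: increasing_hit_def\<close>)
    show ?case
    proof (intro exI[of _ \<theta>] conjI allI impI)
      show "\<theta> \<epsilon> \<le> b" if "0 < \<epsilon>" for \<epsilon> using \<alpha>\<beta> that by (auto simp: \<theta>_def)
      \<comment> \<open>For \<epsilon> below \<open>T / K\<close> the level is constantly
        \<open>b\<close>, so the convergence to \<open>b\<close> is monotone in the weak
        sense.\<close>
      show "\<exists>e>0. antimono_on {0<..<e} \<theta>"
      proof (intro exI[of _ "T / K"] conjI monotone_onI)
        fix x y assume xy: "x \<in> {0<..<T / K}" "y \<in> {0<..<T / K}"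
        hence "K * x \<le> T" "K * y \<le> T" using K by (auto simp: pos_less_divide_eq mult.commute)
        thus "\<theta> y \<le> \<theta> x" by (simp add: \<theta>_def)
      qed (use T K in simp)
      show "(\<theta> \<longlongrightarrow> b) (at_right 0)" using ev by (rule tendsto_eventually)
      show "(\<lambda>\<epsilon>. d_W W (\<theta> \<epsilon>) b) \<in> o[at_right 0](\<lambda>\<epsilon>. \<epsilon>)"
      proof (rule landau_o.smallI)
        fix k :: real assume "0 < k"
        show "\<forall>\<^sub>F \<epsilon> in at_right 0. norm (d_W W (\<theta> \<epsilon>) b) \<le> k * norm \<epsilon>"
          using ev by eventually_elim (use \<open>0 < k\<close> in \<open>simp add: d_W_def\<close>)
      qed
    next
      fix \<epsilon> v assume \<epsilon>: "0 < \<epsilon>" "\<epsilon> < e0 \<alpha>m N \<rho>" and min: "G_minimizer W T \<omega> (\<alpha> \<epsilon>) (\<beta> \<epsilon>) \<epsilon> v"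
      obtain S where S: "increasing_hit T v (\<theta> \<epsilon>) S" "S \<le> K * \<epsilon>" using hit[OF \<epsilon> min] by blast
      show "\<exists>!S. increasing_hit T v (\<theta> \<epsilon>) S" using S(1) unique by blast
      fix S' assume "increasing_hit T v (\<theta> \<epsilon>) S'"
      hence "S' = S" using S(1) unique by blast
      thus "S' / \<epsilon> \<le> K" using S(2) \<epsilon> by (simp add: pos_divide_le_eq)
    next
      fix v :: "real \<Rightarrow> real \<Rightarrow> real" and S
      assume *: "\<forall>\<^sub>F \<epsilon> in at_right 0. G_minimizer W T \<omega> (\<alpha> \<epsilon>) (\<beta> \<epsilon>) \<epsilon> (v \<epsilon>) \<and> increasing_hit T (v \<epsilon>) (\<theta> \<epsilon>) (S \<epsilon>)"
      have pos: "\<forall>\<^sub>F \<epsilon>::real in at_right 0. 0 < \<epsilon>" by (rule eventually_at_right_less)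
      have 1: "\<forall>\<^sub>F \<epsilon> in at_right 0. \<exists>v'. layer W a b q T \<omega> \<epsilon> \<omega>' (v \<epsilon>) v' (\<alpha> \<epsilon>) (\<beta> \<epsilon>) N (\<delta> \<alpha>m) Wm"
        using * pos by eventually_elim (use lay in blast)
      have 2: "\<forall>\<^sub>F \<epsilon> in at_right 0. increasing_hit T (v \<epsilon>) b (S \<epsilon>)"
        using * ev by eventually_elim simp
      show "((\<lambda>\<epsilon>. S \<epsilon> / \<epsilon>) \<longlongrightarrow> transition_length W b \<alpha>\<^sub>0) (at_right 0)"
        by (rule hit_time_limit[OF \<alpha>m r0(1) less_imp_le[OF r0(3)] r0(2) near \<Phi> \<delta>'(2)[OF \<alpha>m] T N0 _ _ s.\<alpha>_lim s.\<alpha>\<^sub>0_range s.\<beta>_lim 1 2])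
           (use \<alpha>\<beta> in auto)
    next
      fix \<epsilon> :: real assume \<epsilon>: "0 < \<epsilon>"
      have "0 \<le> \<epsilon> powr (1 / (1 + q))" "\<beta> \<epsilon> \<le> b" using \<alpha>\<beta> \<epsilon> by auto
      thus "b - 1 * max (b - \<beta> \<epsilon>) (\<epsilon> powr (1 / (1 + q))) \<le> \<theta> \<epsilon>"
        by (auto simp: \<theta>_def max_def)
    qed
  qed (use K \<delta> e0 in auto)
qed

end
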